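(* Let $d\ge 2$. Every extreme point of the set $(S^*_d)$ is a Suffridge polynomial, i.e. if $f$ is an extreme point of $(S^*_d)$ then the curve $f(\mathbb T)$ has exactly $d-1$ cusps and $d-2$ double points.
   Context: $(S_d)$ is the set of polynomials $f(z)=z+a_2z^2+\dots+a_dz^d$ that are univalent in the unit disk $\mathbb D$, and $(S^*_d)=\{f\in(S_d): a_d=1/d\}$, regarded as a (compact) subset of the finite-dimensional real vector space of complex polynomials of degree $\le d$; an extreme point is a point not expressible as $\frac12(f_1+f_2)$ with $f_1\ne f_2$ in $(S^*_d)$. $\mathbb T$ is the unit circle. A cusp of $f(\mathbb T)$ is a point $f(\zeta)$ with $|\zeta|=1$, $f'(\zeta)=0$; a double point is a point $f(\zeta_1)=f(\zeta_2)$ with $|\zeta_1|=|\zeta_2|=1$, $\zeta_1\ne\zeta_2$. A Suffridge polynomial is an $f\in(S_d)$ for which $f(\mathbb T)$ has $d-1$ cusps and $d-2$ double points (the maximal possible numbers). *)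

theory Defs
  imports "HOL-Analysis.Analysis" "HOL-Computational_Algebra.Polynomial"
begin

definition S_poly :: "nat \<Rightarrow> complex poly set" where
  "S_poly d = {f. degree f \<le> d \<and> coeff f 0 = 0 \<and> coeff f 1 = 1 \<and>
                  inj_on (poly f) (ball 0 1)}"

definition S_star_poly :: "nat \<Rightarrow> complex poly set" where
  "S_star_poly d = {f \<in> S_poly d. coeff f d = 1 / of_nat d}"

definition extreme_point_poly :: "complex poly set \<Rightarrow> complex poly \<Rightarrow> bool" where
  "extreme_point_poly A f \<longleftrightarrow> f \<in> A \<and>
     (\<forall>f1\<in>A. \<forall>f2\<in>A. f = smult (1/2) (f1 + f2) \<longrightarrow> f1 = f2)"

definition cusps :: "complex poly \<Rightarrow> complex set" where
  "cusps f = {poly f \<zeta> | \<zeta>. norm \<zeta> = 1 \<and> poly (pderiv f) \<zeta> = 0}"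

definition double_points :: "complex poly \<Rightarrow> complex set" where
  "double_points f = {poly f \<zeta>1 | \<zeta>1 \<zeta>2. norm \<zeta>1 = 1 \<and> norm \<zeta>2 = 1 \<and> \<zeta>1 \<noteq> \<zeta>2 \<and>
                                      poly f \<zeta>1 = poly f \<zeta>2}"

definition suffridge :: "nat \<Rightarrow> complex poly \<Rightarrow> bool" where
  "suffridge d f \<longleftrightarrow> f \<in> S_poly d \<and> finite (cusps f) \<and> card (cusps f) = d - 1 \<and>
                      finite (double_points f) \<and> card (double_points f) = d - 2"

end

theory Submission
  imports Defs "HOL-Complex_Analysis.Complex_Analysis"
    "HOL-Computational_Algebra.Fundamental_Theorem_Algebra"
begin

text \<open>
  For \<open>f\<close> in the class, all zeros of \<open>f'\<close> lie on the circle and are simple, since near a boundary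
  point of order \<open>m\<close> the image of the disc fills a sector of opening \<open>m \<pi>\<close> and such sectors cannot
  overlap. Hence \<open>z f'(z) = z\<^sup>d\<^sup>+\<^sup>1 cnj (z f'(z))\<close> on the circle, so that the tangent direction of
  \<open>\<theta> \<mapsto> f(e\<^bsup>i\<theta>\<^esup>)\<close> is \<open>\<plusminus> i e\<^bsup>i(d+1)\<theta>/2\<^esup>\<close>, independently of \<open>f\<close>, and the arcs between cusps are strictly convex.

  Lower bound: the real space of admissible directions \<open>g\<close> has dimension \<open>d - 2\<close>, and each double point
  imposes one linear condition (the two branches keep a common tangent line). If there are fewer than
  \<open>d - 2\<close> double points, some \<open>g \<noteq> 0\<close> satisfies all of them; by convexity the branches then stay on
  opposite sides of that line, so \<open>f \<plusminus> t g\<close> is univalent for small \<open>t\<close> and \<open>f\<close> is not extreme.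

  Upper bound: \<open>(f(z) - f(w)) / (z - w)\<close> has a continuous logarithm on the part of the closed bidisc
  where it does not vanish. Following its argument in the manner of Hopf's Umlaufsatz, starting from a
  point of maximal modulus, shows that the pairs of preimages of double points do not cross, and that
  the arc cut off by such a pair, of length \<open>2 \<pi> k / (d + 1)\<close>, carries exactly \<open>k + 1\<close> cusps. Counting cusps
  in this laminar family of arcs leaves room for at most \<open>d - 2\<close> pairs.
\<close>

subsection \<open>Sectors in the image near a boundary point\<close>

text \<open>Injectivity is known on the open disc only, and it is there that it must be proved again
  after a perturbation. Pairs of preimages of double points and critical points on the diagonal are
  the places of the closed bidisc where injectivity is not stable by continuity alone. The number
  \<open>d - 2\<close> has two origins. Fixing the coefficients of z and z^d and pairing the others
  by conjugation leaves \<open>d - 2\<close> real parameters. On the other side, an innermost arc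
  between paired preimages holds at least two of the \<open>d - 1\<close> cusps and can be collapsed
  onto one of them, so there are at most \<open>d - 2\<close> arcs. Planarity of the image curve
  enters through one continuous argument on a star-shaped set, not through the Jordan curve theorem.
  Local information determines differences of arguments only modulo 2 pi. The point of maximal
  modulus supplies an exact value from which the others follow, and it is never a preimage of a
  double point, so cutting the circle there breaks no pair.\<close>

lemma norm_one_minus_less_one:
  fixes y :: complex
  assumes "0 < \<rho>" "\<rho> * (norm y)\<^sup>2 < 2 * Re y"
  shows "norm (1 - of_real \<rho> * y) < 1"
proof -
  have "(norm (1 - of_real \<rho> * y))\<^sup>2 = 1 - 2 * \<rho> * Re y + \<rho> * (\<rho> * (norm y)\<^sup>2)"
    by (simp add: cmod_power2) (simp add: power2_eq_square algebra_simps)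
  also have "\<dots> < 1"
    using assms mult_strict_left_mono[OF assms(2,1)] by simp
  finally show ?thesis
    using abs_square_less_1[of "norm (1 - of_real \<rho> * y)"] by simp
qed

text \<open>As \<open>x\<close> runs through the right half plane, \<open>(- \<zeta> x) ^ m\<close> sweeps out a sector of opening \<open>m \<pi>\<close>.\<close>

lemma sector_covered:
  fixes f h :: "complex poly"
  assumes \<zeta>: "norm \<zeta> = 1" and m: "m > 0"
    and f: "\<And>z. poly f z = w0 + (z - \<zeta>) ^ m * poly h z"
    and C: "poly h \<zeta> \<noteq> 0" and x: "Re x > 0" and \<delta>: "\<delta> > 0"
  shows "\<exists>\<rho>0>0. \<forall>\<rho>. 0 < \<rho> \<and> \<rho> < \<rho>0 \<longrightarrow>
           (\<exists>y. norm (y - x) < \<delta> \<and> norm (\<zeta> - of_real \<rho> * \<zeta> * y) < 1 \<and>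
                poly f (\<zeta> - of_real \<rho> * \<zeta> * y) = w0 + of_real \<rho> ^ m * (poly h \<zeta> * (- \<zeta> * x) ^ m))"
proof -
  have "finite {y. y ^ m = x ^ m}"
    using m by (intro finite_nth_roots) auto
  then obtain d1 where d1: "d1 > 0" "\<And>y. y ^ m = x ^ m \<Longrightarrow> y \<noteq> x \<Longrightarrow> d1 \<le> dist x y"
    using finite_set_avoid[of "{y. y ^ m = x ^ m}" x] by auto
  \<comment> \<open>With this radius the closed ball around \<open>x\<close> contains no other m-th
    root of \<open>x ^ m\<close>, so \<open>y ^ m - x ^ m\<close> is bounded away from 0 on its
    boundary, and the ball stays in the right half plane.\<close>
  define r where "r = min (d1/2) (min \<delta> (Re x / 2))"
  have r: "r > 0" "r < d1" "r \<le> \<delta>" "r \<le> Re x / 2"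
    using d1 \<delta> x by (auto simp: r_def)
  define N where "N = norm x + r"
  have N: "N > 0" using r by (simp add: N_def add_nonneg_pos)
  have "\<exists>y\<in>sphere x r. \<forall>z\<in>sphere x r. norm (y ^ m - x ^ m) \<le> norm (z ^ m - x ^ m)"
    using r by (intro continuous_attains_inf continuous_intros) auto
  then obtain y0 where y0: "y0 \<in> sphere x r" "\<And>z. z \<in> sphere x r \<Longrightarrow> norm (y0 ^ m - x ^ m) \<le> norm (z ^ m - x ^ m)"
    by auto
  define \<mu> where "\<mu> = norm (y0 ^ m - x ^ m)"
  have \<mu>: "\<mu> > 0"
  proof -
    have "y0 ^ m \<noteq> x ^ m"
      using d1(2)[of y0] y0(1) r by (auto simp: dist_commute)
    then show ?thesis by (simp add: \<mu>_def)
  qed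
  have "isCont (poly h) \<zeta>" by simp
  then obtain e where e: "e > 0" "\<And>z. dist z \<zeta> < e \<Longrightarrow> dist (poly h z) (poly h \<zeta>) < norm (poly h \<zeta>) * (\<mu> / (2 * N ^ m))"
    unfolding continuous_at_eps_delta using C \<mu> N
    by (metis (no_types, lifting) divide_pos_pos mult_pos_pos zero_less_norm_iff zero_less_numeral zero_less_power)
  define \<rho>0 where "\<rho>0 = min (e / N) (Re x / N\<^sup>2)"
  show ?thesis
  proof (intro exI[of _ \<rho>0] conjI allI impI)
    show "\<rho>0 > 0" using e N x by (auto simp: \<rho>0_def)
    fix \<rho> assume \<rho>: "0 < \<rho> \<and> \<rho> < \<rho>0"
    have \<rho>N: "\<rho> * N < e" "\<rho> * N\<^sup>2 < Re x"
      using \<rho> N by (auto simp: \<rho>0_def field_simps)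
    \<comment> \<open>Substituting z = \<zeta>(1 - \<rho> y) and dividing by (-\<rho> \<zeta>)^m
      h(\<zeta>) turns the desired equation for f into \<open>Y y = 0\<close>. For small \<rho> the
      function \<open>Y\<close> is within \<mu>/2 of \<open>y ^ m - x ^ m\<close>, which vanishes at
      \<open>x\<close> and has modulus at least \<mu> on the sphere; a Rouche-type argument then
      gives a zero.\<close>
    define Y where "Y = (\<lambda>y. y ^ m * (poly h (\<zeta> - of_real \<rho> * \<zeta> * y) / poly h \<zeta>) - x ^ m)"
    have close: "norm (Y y - (y ^ m - x ^ m)) < \<mu> / 2" if y: "y \<in> cball x r" for y
    proof -
      have ny: "norm y \<le> N"
        using y norm_triangle_ineq2[of y x] by (auto simp: N_def dist_norm norm_minus_commute)
      have "dist (\<zeta> - of_real \<rho> * \<zeta> * y) \<zeta> = \<rho> * norm y"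
        using \<zeta> \<rho> by (simp add: dist_norm norm_mult)
      also have "\<dots> \<le> \<rho> * N" using ny \<rho> by (intro mult_left_mono) auto
      finally have "dist (\<zeta> - of_real \<rho> * \<zeta> * y) \<zeta> < e" using \<rho>N by simp
      from e(2)[OF this] have "norm (poly h (\<zeta> - of_real \<rho> * \<zeta> * y) / poly h \<zeta> - 1) < \<mu> / (2 * N ^ m)"
        using C by (simp add: dist_norm norm_divide divide_less_eq mult.commute flip: diff_divide_distrib
          add: diff_divide_eq_iff) (simp add: field_simps norm_divide)
      moreover have "norm (Y y - (y ^ m - x ^ m)) = norm y ^ m * norm (poly h (\<zeta> - of_real \<rho> * \<zeta> * y) / poly h \<zeta> - 1)"
        by (simp add: Y_def algebra_simps flip: norm_mult norm_power)
      moreover have "norm y ^ m \<le> N ^ m" using ny by (intro power_mono) auto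
      ultimately have "norm (Y y - (y ^ m - x ^ m)) \<le> N ^ m * norm (poly h (\<zeta> - of_real \<rho> * \<zeta> * y) / poly h \<zeta> - 1)"
        by (simp add: mult_right_mono)
      also have "\<dots> < N ^ m * (\<mu> / (2 * N ^ m))"
        using N \<open>norm (poly h (\<zeta> - of_real \<rho> * \<zeta> * y) / poly h \<zeta> - 1) < _\<close> by (intro mult_strict_left_mono) auto
      also have "\<dots> = \<mu> / 2" using N by simp
      finally show ?thesis .
    qed
    have "\<exists>y\<in>ball x r. Y y = 0"
    proof (rule holomorphic_contract_to_zero[of x r Y])
      show "continuous_on (cball x r) Y" unfolding Y_def by (intro continuous_intros) (use C in auto)
      show "Y holomorphic_on ball x r" unfolding Y_def by (intro holomorphic_intros) (use C in auto)
      show "r > 0" by fact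
      fix z assume z: "norm (x - z) = r"
      have "norm (Y x) < \<mu> / 2" using close[of x] r by simp
      moreover have "norm (z ^ m - x ^ m) \<ge> \<mu>" using y0(2)[of z] z by (simp add: \<mu>_def dist_norm)
      moreover have "norm (Y z - (z ^ m - x ^ m)) < \<mu> / 2" using close[of z] z by (simp add: dist_norm)
      ultimately show "norm (Y x) < norm (Y z)"
        using norm_triangle_ineq2[of "z ^ m - x ^ m" "z ^ m - x ^ m - Y z"] by (simp add: norm_minus_commute)
    qed auto
    then obtain y where y: "y \<in> ball x r" "Y y = 0" by auto
    show "\<exists>y. norm (y - x) < \<delta> \<and> norm (\<zeta> - of_real \<rho> * \<zeta> * y) < 1 \<and>
                poly f (\<zeta> - of_real \<rho> * \<zeta> * y) = w0 + of_real \<rho> ^ m * (poly h \<zeta> * (- \<zeta> * x) ^ m)"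
    proof (intro exI[of _ y] conjI)
      show "norm (y - x) < \<delta>" using y r by (auto simp: dist_norm norm_minus_commute)
      have ny: "norm y \<le> N"
        using y norm_triangle_ineq2[of y x] by (auto simp: N_def dist_norm norm_minus_commute)
      have "Re x - Re y \<le> r" using y abs_Re_le_cmod[of "x - y"] by (auto simp: dist_norm)
      hence Rey: "Re x \<le> 2 * Re y" using r by simp
      have "\<rho> * (norm y)\<^sup>2 \<le> \<rho> * N\<^sup>2" using ny \<rho> by (intro mult_left_mono power_mono) auto
      hence "norm (1 - of_real \<rho> * y) < 1"
        using Rey \<rho>N \<rho> by (intro norm_one_minus_less_one) linarith+
      moreover have "\<zeta> - of_real \<rho> * \<zeta> * y = \<zeta> * (1 - of_real \<rho> * y)" by (simp add: algebra_simps)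
      ultimately show "norm (\<zeta> - of_real \<rho> * \<zeta> * y) < 1" using \<zeta> by (simp add: norm_mult)
      have "y ^ m * poly h (\<zeta> - of_real \<rho> * \<zeta> * y) = x ^ m * poly h \<zeta>"
        using y(2) C by (simp add: Y_def field_simps)
      hence "(- of_real \<rho> * \<zeta>) ^ m * (y ^ m * poly h (\<zeta> - of_real \<rho> * \<zeta> * y)) = (- of_real \<rho> * \<zeta>) ^ m * (x ^ m * poly h \<zeta>)"
        by simp
      moreover have "(\<zeta> - of_real \<rho> * \<zeta> * y - \<zeta>) ^ m = (- of_real \<rho> * \<zeta>) ^ m * y ^ m"
        by (simp flip: power_mult_distrib)
      moreover have "(- of_real \<rho> * \<zeta>) ^ m * x ^ m = of_real \<rho> ^ m * (- \<zeta> * x) ^ m"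
        by (simp flip: power_mult_distrib add: mult.assoc)
      ultimately show "poly f (\<zeta> - of_real \<rho> * \<zeta> * y) = w0 + of_real \<rho> ^ m * (poly h \<zeta> * (- \<zeta> * x) ^ m)"
        unfolding f by (metis mult.assoc mult.commute)
    qed
  qed
qed

text \<open>The hypothesis \<open>eq\<close> says that the two image sectors share a ray from
  \<open>w0\<close>. Values far enough down that ray are taken at a point near \<zeta>1 and at a
  point near \<zeta>2, which are different points of the disc.\<close>

lemma sector_overlap_distinct:
  fixes f h1 h2 :: "complex poly"
  assumes inj: "inj_on (poly f) (ball 0 1)"
    and \<zeta>: "norm \<zeta>1 = 1" "norm \<zeta>2 = 1" "\<zeta>1 \<noteq> \<zeta>2" and m: "m1 > 0" "m2 > 0"
    and f1: "\<And>z. poly f z = w0 + (z - \<zeta>1) ^ m1 * poly h1 z" and C1: "poly h1 \<zeta>1 \<noteq> 0"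
    and f2: "\<And>z. poly f z = w0 + (z - \<zeta>2) ^ m2 * poly h2 z" and C2: "poly h2 \<zeta>2 \<noteq> 0"
    and x: "Re x1 > 0" "Re x2 > 0"
    and eq: "poly h1 \<zeta>1 * (- \<zeta>1 * x1) ^ m1 = poly h2 \<zeta>2 * (- \<zeta>2 * x2) ^ m2"
  shows False
proof -
  define D where "D = norm (\<zeta>1 - \<zeta>2)"
  have D: "D > 0" using \<zeta> by (simp add: D_def)
  obtain r1 where r1: "r1 > 0" and R1: "\<And>\<rho>. 0 < \<rho> \<Longrightarrow> \<rho> < r1 \<Longrightarrow>
           (\<exists>y. norm (y - x1) < 1 \<and> norm (\<zeta>1 - of_real \<rho> * \<zeta>1 * y) < 1 \<and>
                poly f (\<zeta>1 - of_real \<rho> * \<zeta>1 * y) = w0 + of_real \<rho> ^ m1 * (poly h1 \<zeta>1 * (- \<zeta>1 * x1) ^ m1))"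
    using sector_covered[OF \<zeta>(1) m(1) f1 C1 x(1), of 1] by auto
  obtain r2 where r2: "r2 > 0" and R2: "\<And>\<rho>. 0 < \<rho> \<Longrightarrow> \<rho> < r2 \<Longrightarrow>
           (\<exists>y. norm (y - x2) < 1 \<and> norm (\<zeta>2 - of_real \<rho> * \<zeta>2 * y) < 1 \<and>
                poly f (\<zeta>2 - of_real \<rho> * \<zeta>2 * y) = w0 + of_real \<rho> ^ m2 * (poly h2 \<zeta>2 * (- \<zeta>2 * x2) ^ m2))"
    using sector_covered[OF \<zeta>(2) m(2) f2 C2 x(2), of 1] by auto
  define s1 where "s1 = min r1 (D / (2 * (norm x1 + 1)))"
  define s2 where "s2 = min r2 (D / (2 * (norm x2 + 1)))"
  have pos: "norm x1 + 1 > 0" "norm x2 + 1 > 0" by (auto intro: add_nonneg_pos)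
  have s: "s1 > 0" "s2 > 0" using r1 r2 D pos by (auto simp: s1_def s2_def)
  \<comment> \<open>The orders may differ, so the two scales cannot be equal: \<sigma> is the common
    distance parameter along the ray, and \<rho>1, \<rho>2 are its roots of order \<open>m1\<close>
    and \<open>m2\<close>.\<close>
  define \<sigma> where "\<sigma> = min (s1 ^ m1) (s2 ^ m2) / 2"
  have \<sigma>: "\<sigma> > 0" "\<sigma> < s1 ^ m1" "\<sigma> < s2 ^ m2" 
  proof -
    have "s1 ^ m1 > 0" "s2 ^ m2 > 0" using s by auto
    then show "\<sigma> > 0" "\<sigma> < s1 ^ m1" "\<sigma> < s2 ^ m2" by (auto simp: \<sigma>_def min_def)
  qed
  define \<rho>1 where "\<rho>1 = root m1 \<sigma>"
  define \<rho>2 where "\<rho>2 = root m2 \<sigma>"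
  have \<rho>1: "\<rho>1 > 0" "\<rho>1 < s1" "\<rho>1 ^ m1 = \<sigma>"
    using \<sigma> m s real_root_less_mono[OF m(1) \<sigma>(2)] by (auto simp: \<rho>1_def real_root_power_cancel real_root_pow_pos2)
  have \<rho>2: "\<rho>2 > 0" "\<rho>2 < s2" "\<rho>2 ^ m2 = \<sigma>"
    using \<sigma> m s real_root_less_mono[OF m(2) \<sigma>(3)] by (auto simp: \<rho>2_def real_root_power_cancel real_root_pow_pos2)
  obtain y1 where y1: "norm (y1 - x1) < 1" "norm (\<zeta>1 - of_real \<rho>1 * \<zeta>1 * y1) < 1"
      "poly f (\<zeta>1 - of_real \<rho>1 * \<zeta>1 * y1) = w0 + of_real \<rho>1 ^ m1 * (poly h1 \<zeta>1 * (- \<zeta>1 * x1) ^ m1)"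
    using R1[of \<rho>1] \<rho>1 by (auto simp: s1_def)
  obtain y2 where y2: "norm (y2 - x2) < 1" "norm (\<zeta>2 - of_real \<rho>2 * \<zeta>2 * y2) < 1"
      "poly f (\<zeta>2 - of_real \<rho>2 * \<zeta>2 * y2) = w0 + of_real \<rho>2 ^ m2 * (poly h2 \<zeta>2 * (- \<zeta>2 * x2) ^ m2)"
    using R2[of \<rho>2] \<rho>2 by (auto simp: s2_def)
  have "(of_real \<rho>1 :: complex) ^ m1 = of_real \<rho>2 ^ m2"
    using \<rho>1 \<rho>2 by (metis of_real_power)
  hence "poly f (\<zeta>1 - of_real \<rho>1 * \<zeta>1 * y1) = poly f (\<zeta>2 - of_real \<rho>2 * \<zeta>2 * y2)"
    using y1(3) y2(3) eq by simp
  hence "\<zeta>1 - of_real \<rho>1 * \<zeta>1 * y1 = \<zeta>2 - of_real \<rho>2 * \<zeta>2 * y2"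
    using inj y1(2) y2(2) by (auto simp: inj_on_def)
  hence "\<zeta>1 - \<zeta>2 = of_real \<rho>1 * \<zeta>1 * y1 - of_real \<rho>2 * \<zeta>2 * y2"
    by (simp add: algebra_simps)
  hence "D \<le> norm (of_real \<rho>1 * \<zeta>1 * y1) + norm (of_real \<rho>2 * \<zeta>2 * y2)"
    unfolding D_def by (metis norm_triangle_ineq4)
  also have "\<dots> = \<rho>1 * norm y1 + \<rho>2 * norm y2" using \<zeta> \<rho>1 \<rho>2 by (simp add: norm_mult)
  finally have le: "D \<le> \<rho>1 * norm y1 + \<rho>2 * norm y2" .
  have "norm y1 \<le> norm x1 + 1" "norm y2 \<le> norm x2 + 1"
    using y1(1) y2(1) norm_triangle_ineq2[of y1 x1] norm_triangle_ineq2[of y2 x2] by auto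
  hence "\<rho>1 * norm y1 \<le> \<rho>1 * (norm x1 + 1)" "\<rho>2 * norm y2 \<le> \<rho>2 * (norm x2 + 1)"
    using \<rho>1 \<rho>2 by (auto intro: mult_left_mono)
  moreover have "\<rho>1 * (norm x1 + 1) < D / 2" "\<rho>2 * (norm x2 + 1) < D / 2"
    using \<rho>1(2) \<rho>2(2) pos by (auto simp: s1_def s2_def field_simps)
  ultimately show False using le by simp
qed

lemma poly_factor_at:
  fixes f :: "complex poly"
  assumes "degree f > 0"
  obtains m h where "m > 0" "\<And>z. poly f z = poly f \<zeta> + (z - \<zeta>) ^ m * poly h z" "poly h \<zeta> \<noteq> 0"
proof -
  define p where "p = f - [:poly f \<zeta>:]"
  have p0: "p \<noteq> 0"
  proof
    assume "p = 0"
    hence "f = [:poly f \<zeta>:]" by (simp add: p_def)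
    hence "degree f = 0" by (metis degree_pCons_0)
    with assms show False by simp
  qed
  have "poly p \<zeta> = 0" by (simp add: p_def)
  hence "order \<zeta> p > 0" using p0 by (simp add: order_gt_0_iff)
  moreover obtain h where h: "p = [:- \<zeta>, 1:] ^ order \<zeta> p * h" "\<not> [:-\<zeta>, 1:] dvd h"
    using order_decomp[OF p0] by blast
  moreover have "poly f z = poly f \<zeta> + (z - \<zeta>) ^ order \<zeta> p * poly h z" for z
  proof -
    have "poly p z = (z - \<zeta>) ^ order \<zeta> p * poly h z"
      by (subst h(1)) (simp add: poly_power)
    then show ?thesis by (simp add: p_def algebra_simps)
  qed
  moreover have "poly h \<zeta> \<noteq> 0" using h(2) by (simp add: poly_eq_0_iff_dvd)
  ultimately show ?thesis using that by blast
qed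

text \<open>From m = 3 on, the directions exp(i pi/m) and exp(-i pi/m) both lie in the right half
  plane and have the same m-th power -1. The tolerance \<open>D\<close>, half their distance, keeps
  the two resulting preimages apart.\<close>

lemma univalent_local_order_le_2:
  fixes f h :: "complex poly"
  assumes inj: "inj_on (poly f) (ball 0 1)" and \<zeta>: "norm \<zeta> = 1"
    and f: "\<And>z. poly f z = w0 + (z - \<zeta>) ^ m * poly h z" and C: "poly h \<zeta> \<noteq> 0"
  shows "m \<le> 2"
proof (rule ccontr)
  assume "\<not> m \<le> 2"
  hence m: "m \<ge> 3" by simp
  define x1 where "x1 = cis (pi / m)"
  define x2 where "x2 = cis (- (pi / m))"
  have pm: "0 < pi / m" "pi / m < pi / 2" using m by (auto simp: field_simps)
  have x: "Re x1 > 0" "Re x2 > 0" using pm by (auto simp: x1_def x2_def intro!: cos_gt_zero_pi)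
  have "real m * (pi / m) = pi" "real m * - (pi / m) = - pi" using m by auto
  hence "x1 ^ m = cis pi" "x2 ^ m = cis (- pi)" unfolding x1_def x2_def Complex.DeMoivre by simp_all
  hence xm: "x1 ^ m = -1" "x2 ^ m = -1" by (simp_all add: complex_eq_iff)
  have "pi / m < pi" using pm pi_gt_zero by linarith
  hence "sin (pi / m) > 0" using pm(1) by (rule sin_gt_zero[rotated])
  hence "Im x1 > 0" "Im x2 < 0" by (auto simp: x1_def x2_def)
  hence "x1 \<noteq> x2" by auto
  define D where "D = norm (x1 - x2) / 2"
  have D: "D > 0" using \<open>x1 \<noteq> x2\<close> by (simp add: D_def)
  have m0: "m > 0" using m by simp
  obtain r1 where r1: "r1 > 0" and R1: "\<And>\<rho>. 0 < \<rho> \<Longrightarrow> \<rho> < r1 \<Longrightarrow>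
           (\<exists>y. norm (y - x1) < D \<and> norm (\<zeta> - of_real \<rho> * \<zeta> * y) < 1 \<and>
                poly f (\<zeta> - of_real \<rho> * \<zeta> * y) = w0 + of_real \<rho> ^ m * (poly h \<zeta> * (- \<zeta> * x1) ^ m))"
    using sector_covered[OF \<zeta> m0 f C x(1) D] by auto
  obtain r2 where r2: "r2 > 0" and R2: "\<And>\<rho>. 0 < \<rho> \<Longrightarrow> \<rho> < r2 \<Longrightarrow>
           (\<exists>y. norm (y - x2) < D \<and> norm (\<zeta> - of_real \<rho> * \<zeta> * y) < 1 \<and>
                poly f (\<zeta> - of_real \<rho> * \<zeta> * y) = w0 + of_real \<rho> ^ m * (poly h \<zeta> * (- \<zeta> * x2) ^ m))"
    using sector_covered[OF \<zeta> m0 f C x(2) D] by auto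
  define \<rho> where "\<rho> = min r1 r2 / 2"
  have \<rho>: "\<rho> > 0" "\<rho> < r1" "\<rho> < r2" using r1 r2 by (auto simp: \<rho>_def min_def)
  obtain y1 where y1: "norm (y1 - x1) < D" "norm (\<zeta> - of_real \<rho> * \<zeta> * y1) < 1"
      "poly f (\<zeta> - of_real \<rho> * \<zeta> * y1) = w0 + of_real \<rho> ^ m * (poly h \<zeta> * (- \<zeta> * x1) ^ m)"
    using R1 \<rho> by blast
  obtain y2 where y2: "norm (y2 - x2) < D" "norm (\<zeta> - of_real \<rho> * \<zeta> * y2) < 1"
      "poly f (\<zeta> - of_real \<rho> * \<zeta> * y2) = w0 + of_real \<rho> ^ m * (poly h \<zeta> * (- \<zeta> * x2) ^ m)"
    using R2 \<rho> by blast
  have "poly f (\<zeta> - of_real \<rho> * \<zeta> * y1) = poly f (\<zeta> - of_real \<rho> * \<zeta> * y2)"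
    unfolding y1 y2 power_mult_distrib xm ..
  hence "\<zeta> - of_real \<rho> * \<zeta> * y1 = \<zeta> - of_real \<rho> * \<zeta> * y2"
    using inj y1(2) y2(2) by (auto simp: inj_on_def)
  moreover have "\<zeta> \<noteq> 0" using \<zeta> by auto
  ultimately have "y1 = y2" using \<rho> by simp
  hence "norm (x1 - x2) < 2 * D"
    using y1(1) y2(1) norm_triangle_ineq[of "x1 - y1" "y1 - x2"] by (simp add: norm_minus_commute)
  then show False by (simp add: D_def)
qed

lemma Re_csqrt_pos:
  assumes "z \<notin> \<real>\<^sub>\<le>\<^sub>0"
  shows "Re (csqrt z) > 0"
proof -
  have "Re (csqrt z) \<noteq> 0"
  proof
    assume "Re (csqrt z) = 0"
    hence "z = of_real (- (Im (csqrt z))\<^sup>2)"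
      using power2_csqrt[of z] by (auto simp: complex_eq_iff power2_eq_square)
    hence "Im z = 0" "Re z \<le> 0" by (metis Im_complex_of_real, metis Re_complex_of_real neg_le_0_iff_le zero_le_power2)
    thus False using assms by (simp add: complex_nonpos_Reals_iff)
  qed
  thus ?thesis using csqrt_principal[of z] by auto
qed

text \<open>The set of all E x^m with Re x > 0 is an open half plane for m = 1 and a slit plane for
  m = 2. Two such sets can be disjoint only if they are opposite half planes.\<close>

lemma half_plane_powers_meet:
  fixes E1 E2 :: complex
  assumes E: "E1 \<noteq> 0" "E2 \<noteq> 0" and m: "m1 \<in> {1,2}" "m2 \<in> {1,2::nat}"
    and ex: "\<not> (m1 = 1 \<and> m2 = 1 \<and> E2 / E1 \<in> \<real>\<^sub>\<le>\<^sub>0)"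
  shows "\<exists>x1 x2. Re x1 > 0 \<and> Re x2 > 0 \<and> E1 * x1 ^ m1 = E2 * x2 ^ m2"
proof -
  have two: "\<exists>x1 x2. Re x1 > 0 \<and> Re x2 > 0 \<and> F1 * x1 ^ 2 = F2 * x2 ^ n"
    if F: "F1 \<noteq> 0" "F2 \<noteq> 0" and n: "n \<in> {1,2::nat}" for F1 F2 :: complex and n
  proof -
    have "\<exists>x2. Re x2 > 0 \<and> F2 * x2 ^ n / F1 \<notin> \<real>\<^sub>\<le>\<^sub>0"
    proof (cases "F2 / F1 \<in> \<real>\<^sub>\<le>\<^sub>0")
      case True
      then obtain r where r: "F2 / F1 = of_real r" "r \<le> 0" by (auto elim: nonpos_Reals_cases)
      have "r \<noteq> 0" using r F by auto
      \<comment> \<open>If 1 lands on the slit, 1 + i does not: its first and second powers are not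
        real, so their multiples by \<open>r\<close> are off the axis.\<close>
      have "F2 * (1 + \<i>) ^ n / F1 = of_real r * (1 + \<i>) ^ n" using r by (metis times_divide_eq_left)
      also have "\<dots> \<notin> \<real>\<^sub>\<le>\<^sub>0" using n \<open>r \<noteq> 0\<close> by (auto simp: complex_nonpos_Reals_iff power2_eq_square)
      finally show ?thesis by (intro exI[of _ "1 + \<i>"]) auto
    qed (auto intro!: exI[of _ 1])
    then obtain x2 where x2: "Re x2 > 0" "F2 * x2 ^ n / F1 \<notin> \<real>\<^sub>\<le>\<^sub>0" by auto
    show ?thesis
      by (rule exI[of _ "csqrt (F2 * x2 ^ n / F1)"], rule exI[of _ x2]) (use x2 F Re_csqrt_pos in auto)
  qed
  consider "m1 = 2" | "m2 = 2" | "m1 = 1" "m2 = 1" "E2 / E1 \<notin> \<real>\<^sub>\<le>\<^sub>0" using m ex by auto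
  thus ?thesis
  proof cases
    case 1 thus ?thesis using two[OF E m(2)] by auto
  next
    case 2 thus ?thesis using two[OF E(2,1) m(1)] by metis
  next
    case 3
    \<comment> \<open>The square root bisects the two normals: since s^2 = E2/E1, multiplying by
      |s|^2 = s cnj s gives E1 s |s|^2 = E2 cnj s, and both factors have positive real part.\<close>
    define s where "s = csqrt (E2 / E1)"
    have s: "Re s > 0" using 3 Re_csqrt_pos by (simp add: s_def)
    have "s ^ 2 = E2 / E1" by (simp add: s_def)
    hence "E1 * (s * of_real (norm s ^ 2)) = E2 * cnj s"
      using E unfolding complex_norm_square by (simp add: field_simps power2_eq_square)
    moreover have "Re (s * of_real (norm s ^ 2)) > 0"
    proof -
      have "s \<noteq> 0" using s by auto
      thus ?thesis using s by (simp del: of_real_power)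
    qed
    ultimately show ?thesis using s 3 by (intro exI[of _ "s * of_real (norm s ^ 2)"] exI[of _ "cnj s"]) auto
  qed
qed

subsection \<open>Critical points and double points\<close>

text \<open>\<open>euler_op p\<close> is \<open>z p'(z)\<close>; the tangent vector of \<open>\<theta> \<mapsto> p(e\<^bsup>i\<theta>\<^esup>)\<close> is \<open>\<i>\<close> times its value.\<close>

definition euler_op :: "complex poly \<Rightarrow> complex poly" where
  "euler_op p = pCons 0 (pderiv p)"

lemma poly_euler_op: "poly (euler_op p) z = z * poly (pderiv p) z"
  by (simp add: euler_op_def)

text \<open>The exponent is a parameter and not the degree, so that the condition is real-linear and
  also covers 0 and perturbation directions of degree below \<open>d\<close>.\<close>

definition self_reciprocal :: "nat \<Rightarrow> complex poly \<Rightarrow> bool" where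
  "self_reciprocal d p \<longleftrightarrow>
     (\<forall>z. norm z = 1 \<longrightarrow> poly (euler_op p) z = z ^ (d + 1) * cnj (poly (euler_op p) z))"

lemma pderiv_eq_of_factor:
  fixes f h :: "complex poly"
  assumes "\<And>z. poly f z = w0 + (z - \<zeta>) ^ m * poly h z"
  shows "m = 1 \<Longrightarrow> poly (pderiv f) \<zeta> = poly h \<zeta>"
    and "m = 2 \<Longrightarrow> poly (pderiv f) \<zeta> = 0 \<and> poly (pderiv (pderiv f)) \<zeta> = 2 * poly h \<zeta>"
proof -
  define l where "l = [:-\<zeta>, 1:]"
  have l: "pderiv l = 1" "poly l \<zeta> = 0" by (simp_all add: l_def pderiv_pCons)
  have "f = [:w0:] + l ^ m * h"
    by (subst poly_eq_poly_eq_iff[symmetric]) (auto simp: fun_eq_iff assms poly_power l_def)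
  thus "m = 1 \<Longrightarrow> poly (pderiv f) \<zeta> = poly h \<zeta>"
    and "m = 2 \<Longrightarrow> poly (pderiv f) \<zeta> = 0 \<and> poly (pderiv (pderiv f)) \<zeta> = 2 * poly h \<zeta>"
    by (auto simp: pderiv_add pderiv_mult power2_eq_square l pderiv_pCons)
qed

section \<open>Critical points, tangency and finiteness for a normalised univalent
  polynomial\<close>

locale star_class =
  fixes d :: nat and f :: "complex poly"
  assumes d2: "d \<ge> 2" and f_star: "f \<in> S_star_poly d"
begin

lemma f_inj: "inj_on (poly f) (ball 0 1)"
  and f_coeff0: "coeff f 0 = 0" and f_coeff1: "coeff f 1 = 1" and f_coeffd: "coeff f d = 1 / of_nat d"
  using f_star by (auto simp: S_star_poly_def S_poly_def)

lemma f_degree: "degree f = d"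
proof -
  have "degree f \<le> d" using f_star by (auto simp: S_star_poly_def S_poly_def)
  moreover have "coeff f d \<noteq> 0" using f_coeffd d2 by simp
  ultimately show ?thesis using le_degree[of f d] by (simp add: le_antisym)
qed

lemma degree_pderiv_f: "degree (pderiv f) = d - 1"
  by (simp add: degree_pderiv f_degree)

lemma lead_coeff_pderiv_f: "lead_coeff (pderiv f) = 1"
  using d2 by (simp add: degree_pderiv_f coeff_pderiv f_coeffd)

lemma pderiv_f_0: "poly (pderiv f) 0 = 1"
  using f_coeff1 by (simp add: poly_0_coeff_0 coeff_pderiv)

lemma pderiv_f_nz: "pderiv f \<noteq> 0"
  using lead_coeff_pderiv_f by auto

lemma pderiv_f_nonzero:
  assumes "norm z < 1" shows "poly (pderiv f) z \<noteq> 0"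
proof -
  have "deriv (poly f) z \<noteq> 0"
    using assms f_inj by (intro holomorphic_injective_imp_regular[of _ "ball 0 1"]) (auto intro!: holomorphic_intros)
  moreover have "deriv (poly f) z = poly (pderiv f) z"
    by (intro DERIV_imp_deriv poly_DERIV)
  ultimately show ?thesis by simp
qed

text \<open>The derivative is monic with constant term 1, so the moduli of its zeros multiply to 1;
  none is below 1 because f is univalent in the disc, hence none is above.\<close>

lemma norm_crit:
  assumes "poly (pderiv f) z = 0" shows "norm z = 1"
proof -
  let ?Z = "{z. poly (pderiv f) z = 0}"
  have fin: "finite ?Z" using pderiv_f_nz poly_roots_finite by blast
  have ge: "norm x \<ge> 1" if "x \<in> ?Z" for x using that pderiv_f_nonzero[of x] by force
  have "pderiv f = (\<Prod>z\<in>?Z. [:-z, 1:] ^ order z (pderiv f))"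
    using complex_poly_decompose[of "pderiv f"] lead_coeff_pderiv_f by simp
  hence "1 = poly (\<Prod>z\<in>?Z. [:-z, 1:] ^ order z (pderiv f)) 0" using pderiv_f_0 by simp
  also have "\<dots> = (\<Prod>z\<in>?Z. (-z) ^ order z (pderiv f))" by (simp add: poly_prod poly_power)
  finally have "norm (1::complex) = norm (\<Prod>z\<in>?Z. (-z) ^ order z (pderiv f))" by simp
  hence "1 = (\<Prod>z\<in>?Z. norm z ^ order z (pderiv f))" by (simp add: prod_norm[symmetric] norm_power)
  also have "\<dots> = norm z ^ order z (pderiv f) * (\<Prod>z\<in>?Z - {z}. norm z ^ order z (pderiv f))"
    using fin assms by (subst prod.remove[of _ z]) auto
  also have "\<dots> \<ge> norm z ^ order z (pderiv f) * 1"
    using ge by (intro mult_left_mono prod_ge_1) (auto intro: one_le_power)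
  finally have "norm z ^ order z (pderiv f) \<le> 1" by simp
  moreover have "order z (pderiv f) > 0" using assms pderiv_f_nz by (simp add: order_gt_0_iff)
  ultimately have "norm z \<le> 1"
    by (metis linorder_not_le one_less_power)
  thus ?thesis using ge[of z] assms by simp
qed

lemma crit_simple:
  assumes "poly (pderiv f) \<zeta> = 0" shows "poly (pderiv (pderiv f)) \<zeta> \<noteq> 0"
proof -
  obtain m h where mh: "m > 0" "\<And>z. poly f z = poly f \<zeta> + (z - \<zeta>) ^ m * poly h z" "poly h \<zeta> \<noteq> 0"
    using poly_factor_at[of f \<zeta>] f_degree d2 by auto
  have "m \<le> 2" using univalent_local_order_le_2[OF f_inj norm_crit[OF assms] mh(2,3)] .
  moreover have "m \<noteq> 1" using pderiv_eq_of_factor(1)[OF mh(2)] assms mh(3) by auto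
  ultimately have "m = 2" using mh(1) by simp
  thus ?thesis using pderiv_eq_of_factor(2)[OF mh(2)] mh(3) by simp
qed

definition crit_pts :: "complex set" where "crit_pts = {z. poly (pderiv f) z = 0}"

lemma finite_crit_pts: "finite crit_pts"
  using pderiv_f_nz poly_roots_finite by (auto simp: crit_pts_def)

lemma pderiv_f_factor: "pderiv f = (\<Prod>z\<in>crit_pts. [:-z, 1:])"
proof -
  have "rsquarefree (pderiv f)"
    using crit_simple by (auto simp: rsquarefree_roots)
  from complex_poly_decompose_rsquarefree[OF this] show ?thesis using lead_coeff_pderiv_f by (simp add: crit_pts_def)
qed

lemma card_crit_pts: "card crit_pts = d - 1"
proof -
  have "degree (pderiv f) = (\<Sum>z\<in>crit_pts. degree [:-z, 1:])"
    by (subst pderiv_f_factor, rule degree_prod_eq_sum_degree) auto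
  thus ?thesis by (simp add: degree_pderiv_f)
qed

text \<open>In this normalisation at 0 every factor has positive real part on the closed disc away
  from its zero, so principal logarithms can be taken factor by factor later.\<close>

lemma poly_pderiv_f: "poly (pderiv f) z = (\<Prod>\<zeta>\<in>crit_pts. 1 - z / \<zeta>)"
proof -
  have eq: "poly (pderiv f) x = (\<Prod>\<zeta>\<in>crit_pts. x - \<zeta>)" for x
    by (subst pderiv_f_factor) (simp add: poly_prod)
  have nz: "\<zeta> \<noteq> 0" if "\<zeta> \<in> crit_pts" for \<zeta> using that norm_crit[of \<zeta>] by (auto simp: crit_pts_def)
  have "(\<Prod>\<zeta>\<in>crit_pts. 1 - z / \<zeta>) = (\<Prod>\<zeta>\<in>crit_pts. (z - \<zeta>) / (0 - \<zeta>))"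
    using nz by (intro prod.cong) (auto simp: field_simps)
  also have "\<dots> = poly (pderiv f) z / poly (pderiv f) 0" unfolding eq by (rule prod_dividef)
  finally show ?thesis using pderiv_f_0 by simp
qed

text \<open>On the circle cnj (z - \<zeta>) = (1 - z/\<zeta>)/z. Taking the product over the
  \<open>d - 1\<close> critical points leaves no unimodular constant, because f' is both monic and
  equal to 1 at 0.\<close>

lemma f_self_reciprocal: "self_reciprocal d f"
  unfolding self_reciprocal_def
proof (intro allI impI)
  fix z :: complex assume z: "norm z = 1"
  have z0: "z \<noteq> 0" using z by auto
  have cz: "cnj x = 1 / x" if "norm x = 1" for x 
  proof -
    have "x * cnj x = 1" using that complex_norm_square[of x] by simp
    moreover have "x \<noteq> 0" using that by auto
    ultimately show ?thesis by (simp add: field_simps)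
  qed
  have eq: "poly (pderiv f) x = (\<Prod>\<zeta>\<in>crit_pts. x - \<zeta>)" for x
    by (subst pderiv_f_factor) (simp add: poly_prod)
  have nz: "\<zeta> \<noteq> 0" "norm \<zeta> = 1" if "\<zeta> \<in> crit_pts" for \<zeta> using that norm_crit[of \<zeta>] by (auto simp: crit_pts_def)
  have "cnj (poly (pderiv f) z) = (\<Prod>\<zeta>\<in>crit_pts. 1 / z - 1 / \<zeta>)"
    unfolding eq using nz cz z by (simp add: cnj_prod)
  also have "\<dots> = (\<Prod>\<zeta>\<in>crit_pts. (1 - z / \<zeta>) / z)"
    using nz z0 by (intro prod.cong) (auto simp: field_simps)
  also have "\<dots> = poly (pderiv f) z / z ^ (d - 1)"
    unfolding poly_pderiv_f by (simp add: prod_dividef card_crit_pts)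
  finally have "cnj (poly (pderiv f) z) = poly (pderiv f) z / z ^ (d - 1)" .
  moreover have "z ^ (d + 1) = z ^ 2 * z ^ (d - 1)" using d2 by (simp flip: power_add)
  ultimately show "poly (euler_op f) z = z ^ (d + 1) * cnj (poly (euler_op f) z)"
    using z0 cz[OF z] by (simp add: poly_euler_op power2_eq_square)
qed

text \<open>The image of a small ball around \<open>z\<close> is open and contains f(w), hence also
  f(u) for points \<open>u\<close> of the disc close to \<open>w\<close>; injectivity in the open
  disc forces \<open>u\<close> into that ball, although it is far from \<open>z\<close>.\<close>

lemma closed_disc_inj:
  assumes z: "norm z < 1" and w: "norm w \<le> 1" and eq: "poly f z = poly f w"
  shows "z = w"
proof (rule ccontr)
  assume "z \<noteq> w"
  define r where "r = min (1 - norm z) (dist z w / 2)"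
  have r: "r > 0" "r \<le> 1 - norm z" "2 * r \<le> dist z w" using z \<open>z \<noteq> w\<close> by (auto simp: r_def min_def)
  have sub: "ball z r \<subseteq> ball 0 1"
  proof
    fix u assume "u \<in> ball z r"
    thus "u \<in> ball 0 1" using r(2) norm_triangle_ineq2[of u z] by (auto simp: dist_norm norm_minus_commute)
  qed
  have "open (poly f ` ball z r)"
    by (rule invariance_of_domain) (auto intro!: continuous_intros inj_on_subset[OF f_inj sub])
  moreover have "poly f w \<in> poly f ` ball z r" using r by (auto simp flip: eq)
  moreover have "isCont (poly f) w" by simp
  ultimately have "eventually (\<lambda>u. poly f u \<in> poly f ` ball z r) (at w)"
    by (metis isCont_def topological_tendstoD)
  then obtain e where e: "e > 0" "\<And>u. u \<noteq> w \<Longrightarrow> dist u w < e \<Longrightarrow> poly f u \<in> poly f ` ball z r"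
    by (auto simp: eventually_at)
  have "w \<in> closure (ball 0 1)" using w by (simp add: closure_ball)
  then obtain u where u: "u \<in> ball 0 1" "dist u w < min e r"
    using e(1) r(1) unfolding closure_approachable by (metis min_less_iff_conj)
  have "poly f u \<in> poly f ` ball z r"
    using u e(2)[of u] \<open>poly f w \<in> _\<close> by (cases "u = w") auto
  hence "u \<in> ball z r" using u(1) f_inj sub by (meson image_iff inj_onD subsetD inj_on_image_mem_iff)
  hence "dist z w < 2 * r" using u(2) dist_triangle[of z w u] by simp
  thus False using r by simp
qed

text \<open>The image sectors at the two preimages must not overlap, and opposite half planes are
  the only possibility left. So both preimages are regular and the two tangent vectors are
  antiparallel.\<close>

lemma double_pair:
  assumes \<zeta>: "norm \<zeta>1 = 1" "norm \<zeta>2 = 1" "\<zeta>1 \<noteq> \<zeta>2" and eq: "poly f \<zeta>1 = poly f \<zeta>2"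
  shows "\<exists>c>0. poly (euler_op f) \<zeta>2 = - of_real c * poly (euler_op f) \<zeta>1"
    and "poly (euler_op f) \<zeta>1 \<noteq> 0"
proof -
  obtain m1 h1 where mh1: "m1 > 0" "\<And>z. poly f z = poly f \<zeta>1 + (z - \<zeta>1) ^ m1 * poly h1 z" "poly h1 \<zeta>1 \<noteq> 0"
    using poly_factor_at[of f \<zeta>1] f_degree d2 by auto
  obtain m2 h2 where mh2: "m2 > 0" "\<And>z. poly f z = poly f \<zeta>1 + (z - \<zeta>2) ^ m2 * poly h2 z" "poly h2 \<zeta>2 \<noteq> 0"
    using poly_factor_at[of f \<zeta>2] f_degree d2 eq by auto
  have nz: "\<zeta>1 \<noteq> 0" "\<zeta>2 \<noteq> 0" using \<zeta> by auto
  have "m1 \<le> 2" "m2 \<le> 2"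
    using univalent_local_order_le_2[OF f_inj \<zeta>(1) mh1(2,3)] univalent_local_order_le_2[OF f_inj \<zeta>(2) mh2(2,3)] by auto
  hence m: "m1 \<in> {1,2}" "m2 \<in> {1,2}" using mh1(1) mh2(1) by auto
  define E1 where "E1 = poly h1 \<zeta>1 * (- \<zeta>1) ^ m1"
  define E2 where "E2 = poly h2 \<zeta>2 * (- \<zeta>2) ^ m2"
  have E: "E1 \<noteq> 0" "E2 \<noteq> 0" using mh1(3) mh2(3) nz by (auto simp: E1_def E2_def)
  have no: "\<nexists>x1 x2. Re x1 > 0 \<and> Re x2 > 0 \<and> E1 * x1 ^ m1 = E2 * x2 ^ m2"
  proof
    assume "\<exists>x1 x2. Re x1 > 0 \<and> Re x2 > 0 \<and> E1 * x1 ^ m1 = E2 * x2 ^ m2"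
    then obtain x1 x2 where x: "Re x1 > 0" "Re x2 > 0" "E1 * x1 ^ m1 = E2 * x2 ^ m2" by auto
    show False
      by (rule sector_overlap_distinct[OF f_inj \<zeta> mh1(1) mh2(1) mh1(2,3) mh2(2,3) x(1,2)])
        (use x(3) in \<open>simp only: E1_def E2_def power_mult_distrib mult.assoc\<close>)
  qed
  have *: "m1 = 1" "m2 = 1" "E2 / E1 \<in> \<real>\<^sub>\<le>\<^sub>0"
    using half_plane_powers_meet[OF E m] no by auto
  have q1: "poly (euler_op f) \<zeta>1 = - E1" using pderiv_eq_of_factor(1)[OF mh1(2)] * by (simp add: poly_euler_op E1_def)
  have q2: "poly (euler_op f) \<zeta>2 = - E2" using pderiv_eq_of_factor(1)[OF mh2(2)] * by (simp add: poly_euler_op E2_def)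
  obtain r where r: "E2 / E1 = of_real r" "r \<le> 0" using *(3) by (auto elim: nonpos_Reals_cases)
  have "r \<noteq> 0" using r E by auto
  thus "\<exists>c>0. poly (euler_op f) \<zeta>2 = - of_real c * poly (euler_op f) \<zeta>1"
    using r E by (intro exI[of _ "-r"]) (auto simp: q1 q2 field_simps)
  show "poly (euler_op f) \<zeta>1 \<noteq> 0" using q1 E by simp
qed

text \<open>Three vectors cannot be pairwise antiparallel: two reversals give a positive factor, the
  direct comparison a negative one.\<close>

lemma no_triple:
  assumes "norm \<zeta>1 = 1" "norm \<zeta>2 = 1" "norm \<zeta>3 = 1" "poly f \<zeta>1 = poly f \<zeta>2" "poly f \<zeta>1 = poly f \<zeta>3"
    "\<zeta>1 \<noteq> \<zeta>2" "\<zeta>1 \<noteq> \<zeta>3"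
  shows "\<zeta>2 = \<zeta>3"
proof (rule ccontr)
  assume ne: "\<zeta>2 \<noteq> \<zeta>3"
  let ?q = "poly (euler_op f)"
  obtain a where a: "a > 0" "?q \<zeta>2 = - of_real a * ?q \<zeta>1" using double_pair(1)[of \<zeta>1 \<zeta>2] assms by auto
  obtain b where b: "b > 0" "?q \<zeta>3 = - of_real b * ?q \<zeta>2" using double_pair(1)[of \<zeta>2 \<zeta>3] assms ne by auto
  obtain c where c: "c > 0" "?q \<zeta>3 = - of_real c * ?q \<zeta>1" using double_pair(1)[of \<zeta>1 \<zeta>3] assms ne by auto
  have "?q \<zeta>1 \<noteq> 0" using double_pair(2)[of \<zeta>1 \<zeta>2] assms by auto
  moreover have "?q \<zeta>3 = of_real (a * b) * ?q \<zeta>1" using a(2) b(2) by simp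
  ultimately have "of_real (a * b) = (of_real (- c) :: complex)"
    using c(2) by (metis mult_cancel_right of_real_minus)
  hence "a * b = - c" using of_real_eq_iff by blast
  thus False using a b c by (smt (verit) mult_pos_pos)
qed

text \<open>By self-reciprocity the line spanned by z f'(z) determines z^(d+1), and antiparallel
  vectors span the same line.\<close>

lemma double_pair_root:
  assumes \<zeta>: "norm \<zeta>1 = 1" "norm \<zeta>2 = 1" "\<zeta>1 \<noteq> \<zeta>2" and eq: "poly f \<zeta>1 = poly f \<zeta>2"
  shows "\<zeta>1 ^ (d + 1) = \<zeta>2 ^ (d + 1)"
proof -
  let ?q = "poly (euler_op f)"
  obtain c where c: "c > 0" "?q \<zeta>2 = - of_real c * ?q \<zeta>1" using double_pair(1)[OF assms] by auto
  have q1: "?q \<zeta>1 \<noteq> 0" using double_pair(2)[OF assms] .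
  have 1: "?q \<zeta>1 = \<zeta>1 ^ (d + 1) * cnj (?q \<zeta>1)" "?q \<zeta>2 = \<zeta>2 ^ (d + 1) * cnj (?q \<zeta>2)"
    using f_self_reciprocal \<zeta> by (auto simp: self_reciprocal_def)
  have "- of_real c * ?q \<zeta>1 = - of_real c * (\<zeta>2 ^ (d + 1) * cnj (?q \<zeta>1))"
    using 1(2) unfolding c(2) by (simp only: complex_cnj_mult complex_cnj_minus complex_cnj_complex_of_real mult_ac)
  hence "?q \<zeta>1 = \<zeta>2 ^ (d + 1) * cnj (?q \<zeta>1)" using c(1) by simp
  with 1(1) have "\<zeta>1 ^ (d + 1) * cnj (?q \<zeta>1) = \<zeta>2 ^ (d + 1) * cnj (?q \<zeta>1)" by metis
  thus ?thesis using q1 by simp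
qed

text \<open>Two preimages differ by a root of unity w of order dividing \<open>d + 1\<close>, so one
  of them is a zero of f(w z) - f(z). This polynomial is nonzero since its linear coefficient is w -
  1, and there are finitely many w.\<close>

lemma finite_double_points: "finite (double_points f)"
proof -
  define W where "W = {w::complex. w ^ (d + 1) = 1} - {1}"
  define T where "T = (\<lambda>w. {x. poly (f \<circ>\<^sub>p [:0, w:] - f) x = 0})"
  have finW: "finite W" unfolding W_def by (intro finite_Diff finite_nth_roots) auto
  have "finite (T w)" if "w \<in> W" for w
  proof -
    have "coeff (f \<circ>\<^sub>p [:0, w:] - f) 1 = w - 1"
      using coeff_pcompose_linear[of f w 1] f_coeff1 by simp
    hence "f \<circ>\<^sub>p [:0, w:] - f \<noteq> 0" using that by (auto simp: W_def)
    thus ?thesis unfolding T_def by (rule poly_roots_finite)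
  qed
  hence "finite (poly f ` (\<Union>w\<in>W. T w))" using finW by auto
  moreover have "double_points f \<subseteq> poly f ` (\<Union>w\<in>W. T w)"
  proof
    fix w assume "w \<in> double_points f"
    then obtain \<zeta>1 \<zeta>2 where \<zeta>: "norm \<zeta>1 = 1" "norm \<zeta>2 = 1" "\<zeta>1 \<noteq> \<zeta>2" "poly f \<zeta>1 = poly f \<zeta>2" "w = poly f \<zeta>1"
      by (auto simp: double_points_def)
    have nz: "\<zeta>1 \<noteq> 0" using \<zeta> by auto
    have "\<zeta>2 / \<zeta>1 \<in> W" using double_pair_root[OF \<zeta>(1-4)] nz \<zeta>(3) by (auto simp: W_def power_divide)
    moreover have "\<zeta>1 \<in> T (\<zeta>2 / \<zeta>1)" using \<zeta> nz by (simp add: T_def poly_pcompose)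
    ultimately show "w \<in> poly f ` (\<Union>w\<in>W. T w)" using \<zeta>(5) by blast
  qed
  ultimately show ?thesis by (rule finite_subset[rotated])
qed

lemma cusps_image: "cusps f = poly f ` crit_pts"
  using norm_crit by (auto simp: cusps_def crit_pts_def)

text \<open>Distinct critical points have distinct values because preimages of a double point are
  regular.\<close>

lemma card_cusps: "finite (cusps f)" "card (cusps f) = d - 1"
proof -
  have "inj_on (poly f) crit_pts"
  proof (rule inj_onI, rule ccontr)
    fix x y assume xy: "x \<in> crit_pts" "y \<in> crit_pts" "poly f x = poly f y" "x \<noteq> y"
    have "poly (euler_op f) x \<noteq> 0" using double_pair(2)[of x y] xy norm_crit by (auto simp: crit_pts_def)
    thus False using xy by (simp add: poly_euler_op crit_pts_def)
  qed
  thus "finite (cusps f)" "card (cusps f) = d - 1"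
    using finite_crit_pts card_crit_pts by (auto simp: cusps_image card_image)
qed

end

subsection \<open>Univalence of perturbations\<close>

lemma line_derivative:
  assumes "(F has_field_derivative D) (at (a + of_real \<tau> * v))"
  shows "((\<lambda>\<tau>. Im (F (a + of_real \<tau> * v))) has_real_derivative Im (D * v)) (at \<tau>)"
    and "((\<lambda>\<tau>. Re (F (a + of_real \<tau> * v))) has_real_derivative Re (D * v)) (at \<tau>)"
proof -
  have "((\<lambda>\<tau>. a + of_real \<tau> * v) has_vector_derivative v) (at \<tau>)"
    by (auto intro!: derivative_eq_intros)
  hence *: "((F \<circ> (\<lambda>\<tau>. a + of_real \<tau> * v)) has_vector_derivative v * D) (at \<tau>)"
    using assms by (intro field_vector_diff_chain_at) auto
  show "((\<lambda>\<tau>. Im (F (a + of_real \<tau> * v))) has_real_derivative Im (D * v)) (at \<tau>)"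
    using bounded_linear.has_vector_derivative[OF bounded_linear_Im *]
    unfolding has_real_derivative_iff_has_vector_derivative by (simp add: o_def mult.commute)
  show "((\<lambda>\<tau>. Re (F (a + of_real \<tau> * v))) has_real_derivative Re (D * v)) (at \<tau>)"
    using bounded_linear.has_vector_derivative[OF bounded_linear_Re *]
    unfolding has_real_derivative_iff_has_vector_derivative by (simp add: o_def mult.commute)
qed

text \<open>This is the Noshiro-Warschawski criterion. Along the segment from \<open>x\<close> to
  \<open>y\<close> the real part of \<kappa> F / (y - x) increases strictly, so F cannot take the
  same value at both ends.\<close>

lemma inj_on_convex_Re_deriv:
  fixes F :: "complex \<Rightarrow> complex"
  assumes S: "convex S" and D: "\<And>s. s \<in> S \<Longrightarrow> (F has_field_derivative D s) (at s)"
    and pos: "\<And>s. s \<in> S \<Longrightarrow> Re (\<kappa> * D s) > 0"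
  shows "inj_on F S"
proof (rule inj_onI, rule ccontr)
  fix x y assume xy: "x \<in> S" "y \<in> S" "F x = F y" "x \<noteq> y"
  define v where "v = y - x"
  have v: "v \<noteq> 0" using xy by (simp add: v_def)
  have seg: "x + of_real \<tau> * v \<in> S" if "0 \<le> \<tau>" "\<tau> \<le> 1" for \<tau>
  proof -
    have "x + of_real \<tau> * v = (1 - \<tau>) *\<^sub>R x + \<tau> *\<^sub>R y" by (simp add: v_def scaleR_conv_of_real algebra_simps)
    thus ?thesis using convexD_alt[OF S xy(1,2) that] by simp
  qed
  have "(\<lambda>\<tau>. Re (\<kappa> / v * F (x + of_real \<tau> * v))) 0 < (\<lambda>\<tau>. Re (\<kappa> / v * F (x + of_real \<tau> * v))) (1::real)"
  proof (rule DERIV_pos_imp_increasing[of 0 1 "\<lambda>\<tau>. Re (\<kappa> / v * F (x + of_real \<tau> * v))"])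
    fix \<tau> :: real assume \<tau>: "0 \<le> \<tau>" "\<tau> \<le> 1"
    have "((\<lambda>s. \<kappa> / v * F s) has_field_derivative \<kappa> / v * D (x + of_real \<tau> * v)) (at (x + of_real \<tau> * v))"
      by (intro DERIV_cmult D seg \<tau>)
    from line_derivative(2)[OF this] have "((\<lambda>\<tau>. Re (\<kappa> / v * F (x + of_real \<tau> * v))) has_real_derivative
        Re (\<kappa> * D (x + of_real \<tau> * v))) (at \<tau>)" using v by (simp add: field_simps)
    thus "\<exists>y. ((\<lambda>\<tau>. Re (\<kappa> / v * F (x + of_real \<tau> * v))) has_real_derivative y) (at \<tau>) \<and> 0 < y"
      using pos[OF seg[OF \<tau>]] by blast
  qed auto
  thus False using xy by (simp add: v_def)
qed

lemma open_box2:
  fixes U :: "(real \<times> 'a :: real_normed_vector) set"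
  assumes "open U" "(0, 0) \<in> U"
  obtains \<epsilon> where "\<epsilon> > 0" "\<And>t s. \<bar>t\<bar> < \<epsilon> \<Longrightarrow> norm s < \<epsilon> \<Longrightarrow> (t, s) \<in> U"
proof -
  obtain A B where AB: "open A" "open B" "(0,0) \<in> A \<times> B" "A \<times> B \<subseteq> U"
    using open_prod_elim[OF assms] by blast
  obtain a where a: "a > 0" "ball 0 a \<subseteq> A" using AB open_contains_ball by (metis mem_Sigma_iff)
  obtain b where b: "b > 0" "ball 0 b \<subseteq> B" using AB open_contains_ball by (metis mem_Sigma_iff)
  show ?thesis
    by (rule that[of "min a b"]) (use a b AB(4) in \<open>auto simp: subset_iff\<close>)
qed

lemma log_coordinate:
  assumes "norm (\<zeta> :: complex) = 1" "\<epsilon> > 0"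
  obtains \<epsilon>' where "\<epsilon>' > 0" "\<And>z. norm (z - \<zeta>) < \<epsilon>' \<Longrightarrow> \<exists>s. norm s < \<epsilon> \<and> z = \<zeta> * exp s"
proof -
  have "isCont Ln 1" by (intro continuous_at_Ln) simp
  then obtain e where e: "e > 0" "\<And>z. dist z 1 < e \<Longrightarrow> dist (Ln z) (Ln 1) < \<epsilon>"
    unfolding continuous_at_eps_delta using assms(2) by blast
  have nz: "\<zeta> \<noteq> 0" using assms by auto
  show ?thesis
  proof (rule that[of "min e 1"])
    fix z assume z: "norm (z - \<zeta>) < min e 1"
    have "z / \<zeta> - 1 = (z - \<zeta>) / \<zeta>" using nz by (simp add: field_simps)
    hence *: "norm (z / \<zeta> - 1) < e" "norm (z / \<zeta> - 1) < 1" using z assms(1) by (simp_all add: norm_divide)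
    hence "z \<noteq> 0" by auto
    thus "\<exists>s. norm s < \<epsilon> \<and> z = \<zeta> * exp s"
      using e(2)[of "z / \<zeta>"] * nz by (intro exI[of _ "Ln (z / \<zeta>)"]) (auto simp: dist_norm)
  qed (use e in auto)
qed

text \<open>The tangent direction at \<open>\<zeta> e\<^bsup>iy\<^esup>\<close> does not depend on the self-reciprocal polynomial.\<close>

lemma euler_polar:
  assumes sr: "self_reciprocal d p" and \<zeta>: "norm \<zeta> = 1" and u: "norm u = 1" "u\<^sup>2 = \<zeta> ^ (d + 1)"
  shows "cnj u * cis (- (real (d + 1) * y / 2)) * poly (euler_op p) (\<zeta> * cis y) \<in> \<real>"
proof -
  let ?E = "poly (euler_op p) (\<zeta> * cis y)"
  define a where "a = real (d + 1) * y / 2"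
  have uu: "cnj u * u = 1" using u(1) complex_norm_square[of u] by (simp add: mult.commute)
  have "norm (\<zeta> * cis y) = 1" using \<zeta> by (simp add: norm_mult)
  hence "?E = (\<zeta> * cis y) ^ (d + 1) * cnj ?E" using sr unfolding self_reciprocal_def by blast
  also have "(\<zeta> * cis y) ^ (d + 1) = u\<^sup>2 * cis (2 * a)"
    using u(2) by (simp only: power_mult_distrib Complex.DeMoivre) (simp add: a_def mult.commute)
  finally have E: "?E = u\<^sup>2 * cis (2 * a) * cnj ?E" .
  have "cnj u * cis (- a) * ?E = cnj u * cis (- a) * (u\<^sup>2 * cis (2 * a) * cnj ?E)"
    by (subst E) simp
  also have "\<dots> = (cnj u * u) * u * (cis (- a) * cis (2 * a)) * cnj ?E" by (simp add: power2_eq_square mult_ac)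
  also have "\<dots> = u * cis a * cnj ?E" by (simp add: uu cis_mult)
  also have "\<dots> = cnj (cnj u * cis (- a) * ?E)" by (simp add: cis_cnj)
  finally show ?thesis unfolding a_def by (metis Reals_cnj_iff)
qed

lemma ex_half_power:
  assumes "norm (\<zeta>::complex) = 1"
  obtains u where "norm u = 1" "u\<^sup>2 = \<zeta> ^ (d + 1)"
proof (rule that[of "csqrt (\<zeta> ^ (d + 1))"])
  show "norm (csqrt (\<zeta> ^ (d + 1))) = 1" using assms by (simp add: norm_power norm_mult)
qed simp

lemma euler_op_perturb:
  "poly (euler_op (f + smult c g)) z = poly (euler_op f) z + c * poly (euler_op g) z"
  by (simp add: poly_euler_op pderiv_add pderiv_smult ring_distribs)

lemma self_reciprocal_perturb:
  assumes "self_reciprocal d f" "self_reciprocal d g"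
  shows "self_reciprocal d (f + smult (of_real t) g)"
  unfolding self_reciprocal_def
proof (intro allI impI)
  fix z :: complex assume z: "norm z = 1"
  define a b where "a = poly (euler_op f) z" and "b = poly (euler_op g) z"
  have "a = z ^ (d + 1) * cnj a" "b = z ^ (d + 1) * cnj b"
    using assms z unfolding self_reciprocal_def a_def b_def by blast+
  hence "a + of_real t * b = z ^ (d + 1) * cnj a + of_real t * (z ^ (d + 1) * cnj b)" by metis
  also have "\<dots> = z ^ (d + 1) * cnj (a + of_real t * b)" by (simp add: algebra_simps)
  finally show "poly (euler_op (f + smult (of_real t) g)) z =
      z ^ (d + 1) * cnj (poly (euler_op (f + smult (of_real t) g)) z)"
    by (simp only: euler_op_perturb a_def b_def)
qed

lemma has_field_derivative_poly_exp:
  "((\<lambda>s. poly p (\<zeta> * exp s)) has_field_derivative poly (euler_op p) (\<zeta> * exp s)) (at s)"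
  by (auto intro!: derivative_eq_intros simp: poly_euler_op)

lemma norm_shift_le:
  assumes "Re s \<le> x" "x \<le> 0"
  shows "norm (\<i> * of_real (Im s) + of_real x) \<le> norm s"
proof -
  have "x\<^sup>2 \<le> (Re s)\<^sup>2" using assms by (simp flip: abs_le_square_iff)
  thus ?thesis by (simp add: cmod_def)
qed

text \<open>In the coordinate \<open>z = \<zeta> e\<^sup>s\<close> the signed distance to the tangent line increases away from \<open>\<zeta>\<close> along the
  imaginary axis (there the tangent rotates monotonically) and also as \<open>Re s\<close> decreases.\<close>

lemma boundary_side:
  fixes f g :: "complex poly"
  assumes sr: "self_reciprocal d f" "self_reciprocal d g" and \<zeta>: "norm \<zeta> = 1"
    and q: "poly (euler_op f) \<zeta> \<noteq> 0"
  obtains \<epsilon> where "\<epsilon> > 0"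
    "\<And>t z. \<bar>t\<bar> < \<epsilon> \<Longrightarrow> norm (z - \<zeta>) < \<epsilon> \<Longrightarrow> norm z \<le> 1 \<Longrightarrow> z \<noteq> \<zeta> \<Longrightarrow>
       Im ((poly (f + smult (of_real t) g) z - poly (f + smult (of_real t) g) \<zeta>) / (\<i> * poly (euler_op f) \<zeta>)) > 0"
proof -
  define q where "q = poly (euler_op f) \<zeta>"
  have q0: "q \<noteq> 0" using assms by (simp add: q_def)
  define h where "h = (\<lambda>t. f + smult (of_real t) g)"
  define Q where "Q = (\<lambda>t s. poly (euler_op (h t)) (\<zeta> * exp s))"
  have Q: "Q t s = poly (euler_op f) (\<zeta> * exp s) + of_real t * poly (euler_op g) (\<zeta> * exp s)" for t s
    by (simp add: Q_def h_def euler_op_perturb)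
  have "open {x. Re (Q (fst x) (snd x) / q) > 0}" unfolding Q
    using q0 by (intro open_Collect_less continuous_intros) auto
  then obtain \<epsilon>1 where \<epsilon>1: "\<epsilon>1 > 0" "\<And>t s. \<bar>t\<bar> < \<epsilon>1 \<Longrightarrow> norm s < \<epsilon>1 \<Longrightarrow> Re (Q t s / q) > 0"
    by (rule open_box2) (use q0 in \<open>auto simp: Q q_def\<close>)
  \<comment> \<open>The bound pi/(d+1) keeps the tangent rotation (d+1)y/2 inside (-pi/2, pi/2),
    where the cosine is positive and the sine has the sign of \<open>y\<close>.\<close>
  define \<epsilon> where "\<epsilon> = min \<epsilon>1 (pi / real (d + 1))"
  have \<epsilon>: "\<epsilon> > 0" using \<epsilon>1 by (simp add: \<epsilon>_def)
  obtain u where u: "norm u = 1" "u\<^sup>2 = \<zeta> ^ (d + 1)" using ex_half_power[OF \<zeta>] .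
  have u0: "u \<noteq> 0" "cnj u \<noteq> 0" using u by auto
  have angle: "\<bar>real (d + 1) * y / 2\<bar> < pi / 2" if "\<bar>y\<bar> < \<epsilon>" for y
  proof -
    have "\<bar>y\<bar> * real (d + 1) < pi" using that unfolding \<epsilon>_def by (simp add: field_simps)
    thus ?thesis by (simp add: abs_mult mult.commute)
  qed
  \<comment> \<open>The common tangent direction gives Q/q = r cis((d+1)y/2) with \<open>r\<close>
    real. Positivity of the real part near the contact gives r > 0, so the imaginary part has the
    sign of \<open>y\<close>.\<close>
  have sgn: "Im (Q t (\<i> * of_real y) / q) * sgn y > 0" if t: "\<bar>t\<bar> < \<epsilon>" and y: "\<bar>y\<bar> < \<epsilon>" "y \<noteq> 0" for t y
  proof -
    let ?a = "real (d + 1) * y / 2"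
    have "cnj u * cis (- ?a) * poly (euler_op (h t)) (\<zeta> * cis y) \<in> \<real>"
      unfolding h_def by (intro euler_polar self_reciprocal_perturb sr \<zeta> u)
    moreover have "cnj u * cis (- (real (d + 1) * 0 / 2)) * poly (euler_op f) (\<zeta> * cis 0) \<in> \<real>"
      by (intro euler_polar sr \<zeta> u)
    ultimately have "cnj u * cis (- ?a) * Q t (\<i> * of_real y) / (cnj u * q) \<in> \<real>"
      by (intro Reals_divide) (auto simp: Q_def q_def cis_conv_exp mult.commute)
    then obtain r where "cnj u * cis (- ?a) * Q t (\<i> * of_real y) / (cnj u * q) = of_real r" by (auto elim: Reals_cases)
    hence "cis (- ?a) * Q t (\<i> * of_real y) / q = of_real r" using u0 by simp
    hence "cis ?a * (cis (- ?a) * Q t (\<i> * of_real y) / q) = cis ?a * of_real r" by simp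
    moreover have "cis ?a * (cis (- ?a) * Q t (\<i> * of_real y) / q) = (cis ?a * cis (- ?a)) * (Q t (\<i> * of_real y) / q)"
      by (simp only: mult.assoc times_divide_eq_right)
    ultimately have r: "Q t (\<i> * of_real y) / q = of_real r * cis ?a"
      by (simp add: cis_mult mult.commute)
    have "cos ?a > 0" using angle[OF y(1)] by (intro cos_gt_zero_pi) auto
    moreover have "Re (Q t (\<i> * of_real y) / q) > 0" using t y by (intro \<epsilon>1) (auto simp: \<epsilon>_def norm_mult)
    ultimately have "r > 0" unfolding r by (simp add: zero_less_mult_iff)
    moreover have "sin ?a * sgn y > 0"
    proof (cases "y > 0")
      case True
      have "?a < pi" using angle[OF y(1)] pi_gt_zero by linarith
      thus ?thesis using True by (auto intro!: sin_gt_zero)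
    next
      case False
      have "- ?a < pi" using angle[OF y(1)] pi_gt_zero by linarith
      moreover have "?a < 0" using False y by (simp add: mult_less_0_iff)
      ultimately have "sin (- ?a) > 0" by (intro sin_gt_zero) linarith+
      thus ?thesis using False y by simp
    qed
    ultimately show ?thesis unfolding r by (simp add: mult.assoc)
  qed
  define P where "P = (\<lambda>t s. (poly (h t) (\<zeta> * exp s) - poly (h t) \<zeta>) / (\<i> * q))"
  have dP: "(P t has_field_derivative Q t s / (\<i> * q)) (at s)" for t s
    unfolding P_def Q_def
    by (auto intro!: derivative_eq_intros simp: q0 poly_euler_op)
  have P0: "P t 0 = 0" for t by (simp add: P_def)
  have axis: "Im (P t (\<i> * of_real y)) > 0" if t: "\<bar>t\<bar> < \<epsilon>" and y: "\<bar>y\<bar> < \<epsilon>" "y \<noteq> 0" for t y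
  proof -
    have der: "((\<lambda>\<tau>. Im (P t (0 + of_real \<tau> * \<i>))) has_real_derivative Im (Q t (\<i> * of_real \<tau>) / q)) (at \<tau>)" for \<tau>
      using line_derivative(1)[where a = 0 and \<tau> = \<tau> and v = \<i>, OF dP[of t]] by (simp add: mult.commute)
    have cont: "continuous_on A (\<lambda>\<tau>. Im (P t (0 + of_real \<tau> * \<i>)))" for A
      using der by (meson DERIV_continuous continuous_at_imp_continuous_on)
    show ?thesis
    proof (cases "y > 0")
      case True
      have "Im (P t (0 + of_real 0 * \<i>)) < Im (P t (0 + of_real y * \<i>))"
      proof (rule DERIV_pos_imp_increasing_open[OF True])
        fix x assume "0 < x" "x < y"
        thus "\<exists>D. ((\<lambda>\<tau>. Im (P t (0 + of_real \<tau> * \<i>))) has_real_derivative D) (at x) \<and> D > 0"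
          using der[of x] sgn[OF t, of x] y by auto
      qed (rule cont)
      thus ?thesis by (simp add: P0 mult.commute)
    next
      case False
      hence "y < 0" using y by simp
      have "Im (P t (0 + of_real y * \<i>)) > Im (P t (0 + of_real 0 * \<i>))"
      proof (rule DERIV_neg_imp_decreasing_open[OF \<open>y < 0\<close>])
        fix x assume "y < x" "x < 0"
        thus "\<exists>D. ((\<lambda>\<tau>. Im (P t (0 + of_real \<tau> * \<i>))) has_real_derivative D) (at x) \<and> D < 0"
          using der[of x] sgn[OF t, of x] y by auto
      qed (rule cont)
      thus ?thesis by (simp add: P0 mult.commute)
    qed
  qed
  have main: "Im (P t s) > 0" if t: "\<bar>t\<bar> < \<epsilon>" and s: "norm s < \<epsilon>" "Re s \<le> 0" "s \<noteq> 0" for t s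
  proof -
    define y where "y = Im s"
    have y: "\<bar>y\<bar> < \<epsilon>" using s abs_Im_le_cmod[of s] by (simp add: y_def)
    have s_eq: "s = \<i> * of_real y + of_real (Re s) * 1" by (simp add: complex_eq_iff y_def)
    have ax: "Im (P t (\<i> * of_real y)) \<ge> 0" using axis[OF t y] P0 by (cases "y = 0") auto
    show ?thesis
    proof (cases "Re s = 0")
      case True
      hence "y \<noteq> 0" using s by (auto simp: y_def complex_eq_iff)
      thus ?thesis using axis[OF t y] s_eq True by simp
    next
      case False
      hence neg: "Re s < 0" using s by simp
      have "Im (P t (\<i> * of_real y + of_real (Re s) * 1)) > Im (P t (\<i> * of_real y + of_real 0 * 1))"
      proof (rule DERIV_neg_imp_decreasing[OF neg])
        fix x assume x: "Re s \<le> x" "x \<le> 0"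
        have "norm (\<i> * of_real y + of_real x * 1) \<le> norm s"
          using norm_shift_le[OF x] by (simp add: y_def)
        hence "Re (Q t (\<i> * of_real y + of_real x * 1) / q) > 0" using t s by (intro \<epsilon>1) (auto simp: \<epsilon>_def)
        moreover have "Im (Q t (\<i> * of_real y + of_real x * 1) / (\<i> * q) * 1) = - Re (Q t (\<i> * of_real y + of_real x * 1) / q)"
        proof -
          have "Im (X / (\<i> * q)) = - Re (X / q)" for X
          proof -
            have "X / (\<i> * q) = - \<i> * (X / q)" using q0 by (simp add: field_simps)
            moreover have "Im (- \<i> * w) = - Re w" for w by simp
            ultimately show ?thesis by metis
          qed
          thus ?thesis by simp
        qed
        ultimately have "Im (Q t (\<i> * of_real y + of_real x * 1) / (\<i> * q) * 1) < 0" by linarith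
        thus "\<exists>D. ((\<lambda>x. Im (P t (\<i> * of_real y + of_real x * 1))) has_real_derivative D) (at x) \<and> D < 0"
          using line_derivative(1)[where a = "\<i> * of_real y" and \<tau> = x and v = 1, OF dP[of t]] by blast
      qed
      thus ?thesis using ax s_eq by simp
    qed
  qed
  obtain \<epsilon>' where \<epsilon>': "\<epsilon>' > 0" "\<And>z. norm (z - \<zeta>) < \<epsilon>' \<Longrightarrow> \<exists>s. norm s < \<epsilon> \<and> z = \<zeta> * exp s"
    using log_coordinate[OF \<zeta> \<epsilon>] by blast
  show ?thesis
  proof (rule that[of "min \<epsilon> \<epsilon>'"])
    fix t z assume *: "\<bar>t\<bar> < min \<epsilon> \<epsilon>'" "norm (z - \<zeta>) < min \<epsilon> \<epsilon>'" "norm z \<le> 1" "z \<noteq> \<zeta>"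
    obtain s where s: "norm s < \<epsilon>" "z = \<zeta> * exp s" using \<epsilon>'(2)[of z] * by auto
    have "s \<noteq> 0" "Re s \<le> 0" using s * \<zeta> by (auto simp: norm_mult)
    thus "Im ((poly (f + smult (of_real t) g) z - poly (f + smult (of_real t) g) \<zeta>) / (\<i> * poly (euler_op f) \<zeta>)) > 0"
      using main[of t s] s * by (simp add: P_def h_def q_def)
  qed (use \<epsilon> \<epsilon>' in auto)
qed

text \<open>In the coordinate \<open>z = \<zeta> e\<^sup>s\<close> the derivative \<open>Q t s\<close> has, after a rotation \<open>\<kappa>\<close>, positive real part on the
  left half plane near the cusp: on the imaginary axis it is \<open>R t y * sin (a (y - y0))\<close> with both factors
  changing sign at the displaced cusp \<open>y0\<close>, and it increases as \<open>Re s\<close> decreases.\<close>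

lemma cusp_locally_injective:
  fixes f g :: "complex poly"
  assumes sr: "self_reciprocal d f" "self_reciprocal d g" and \<zeta>: "norm \<zeta> = 1"
    and q0: "poly (euler_op f) \<zeta> = 0" and q1: "poly (pderiv (euler_op f)) \<zeta> \<noteq> 0"
  obtains \<epsilon> where "\<epsilon> > 0"
    "\<And>t. \<bar>t\<bar> < \<epsilon> \<Longrightarrow> inj_on (poly (f + smult (of_real t) g)) (ball \<zeta> \<epsilon> \<inter> ball 0 1)"
proof -
  define h where "h = (\<lambda>t. f + smult (of_real t) g)"
  define Q where "Q = (\<lambda>t s. poly (euler_op (h t)) (\<zeta> * exp s))"
  define Q' where "Q' = (\<lambda>t s. poly (euler_op (euler_op (h t))) (\<zeta> * exp s))"
  have Q: "Q t s = poly (euler_op f) (\<zeta> * exp s) + of_real t * poly (euler_op g) (\<zeta> * exp s)" for t s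
    by (simp add: Q_def h_def euler_op_perturb)
  have ee: "euler_op (h t) = euler_op f + smult (of_real t) (euler_op g)" for t
    by (simp add: h_def euler_op_def pderiv_add pderiv_smult)
  have Q': "Q' t s = poly (euler_op (euler_op f)) (\<zeta> * exp s) + of_real t * poly (euler_op (euler_op g)) (\<zeta> * exp s)" for t s
    by (simp add: Q'_def ee euler_op_perturb)
  have dQ: "(Q t has_field_derivative Q' t s) (at s)" for t s
    unfolding Q_def Q'_def by (rule has_field_derivative_poly_exp)
  define a where "a = real (d + 1) / 2"
  have a0: "a > 0" by (simp add: a_def)
  obtain u0 where u0: "norm u0 = 1" "u0\<^sup>2 = \<zeta> ^ (d + 1)" using ex_half_power[OF \<zeta>] .
  have Q00: "Q 0 0 = 0" using q0 by (simp add: Q)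
  have Q'00: "Q' 0 0 \<noteq> 0" using q1 \<zeta> by (auto simp: Q' poly_euler_op)
  have real: "cnj u * exp (- of_real a * (\<i> * of_real y)) * Q t (\<i> * of_real y) \<in> \<real>"
    if u: "norm u = 1" "u\<^sup>2 = \<zeta> ^ (d + 1)" for u t y
  proof -
    have "cnj u * cis (- (real (d + 1) * y / 2)) * poly (euler_op (h t)) (\<zeta> * cis y) \<in> \<real>"
      unfolding h_def by (intro euler_polar self_reciprocal_perturb sr \<zeta> u)
    moreover have "cis (- (real (d + 1) * y / 2)) = exp (- of_real a * (\<i> * of_real y))"
      unfolding cis_conv_exp by (rule arg_cong[where f = exp]) (simp add: a_def)
    moreover have "cis y = exp (\<i> * of_real y)" by (simp add: cis_conv_exp)
    ultimately show ?thesis by (simp add: Q_def)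
  qed
  have d\<Psi>: "((\<lambda>s. cnj u * exp (- of_real a * s) * Q t s) has_field_derivative
        cnj u * exp (- of_real a * s) * (Q' t s - of_real a * Q t s)) (at s)" for u t s
    by (rule derivative_eq_intros dQ refl)+ (simp add: algebra_simps)
  \<comment> \<open>The rotated derivative is real along the whole imaginary axis, hence so is its
    own derivative there. As it is also nonzero at 0, its real part has a definite sign.\<close>
  have "Im (cnj u0 * (Q' 0 0 * \<i>)) = 0"
  proof -
    have "((\<lambda>\<tau>. Im (cnj u0 * exp (- of_real a * (0 + of_real \<tau> * \<i>)) * Q 0 (0 + of_real \<tau> * \<i>))) has_real_derivative
        Im (cnj u0 * (Q' 0 0 * \<i>))) (at 0)"
      using line_derivative(1)[where a = 0 and \<tau> = 0 and v = \<i>, OF d\<Psi>[of u0 0]] Q00 by (simp add: mult.assoc)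
    moreover have "(\<lambda>\<tau>. Im (cnj u0 * exp (- of_real a * (0 + of_real \<tau> * \<i>)) * Q 0 (0 + of_real \<tau> * \<i>))) = (\<lambda>_. 0)"
    proof
      fix \<tau>
      show "Im (cnj u0 * exp (- of_real a * (0 + of_real \<tau> * \<i>)) * Q 0 (0 + of_real \<tau> * \<i>)) = 0"
        using real[OF u0, of \<tau> 0] by (simp add: complex_is_Real_iff mult.commute)
    qed
    ultimately show ?thesis by (metis DERIV_const DERIV_unique)
  qed
  moreover have "cnj u0 * (Q' 0 0 * \<i>) \<noteq> 0" using u0 Q'00 by auto
  ultimately have "Re (cnj u0 * (Q' 0 0 * \<i>)) \<noteq> 0" by (auto simp: complex_eq_iff)
  \<comment> \<open>Both square roots of \<zeta>^(d+1) are admissible; the sign is chosen so that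
    \<open>R\<close> increases in \<open>y\<close>.\<close>
  then obtain u where u: "norm u = 1" "u\<^sup>2 = \<zeta> ^ (d + 1)" and upos: "Re (cnj u * (Q' 0 0 * \<i>)) > 0"
  proof (cases "Re (cnj u0 * (Q' 0 0 * \<i>)) > 0")
    case True thus ?thesis using that[of u0] u0 by blast
  next
    case False thus ?thesis using that[of "-u0"] u0 \<open>Re (cnj u0 * (Q' 0 0 * \<i>)) \<noteq> 0\<close> by auto
  qed
  have uu: "u * cnj u = 1" using u(1) complex_norm_square[of u] by simp
  define R where "R = (\<lambda>t y. Re (cnj u * exp (- of_real a * (\<i> * of_real y)) * Q t (\<i> * of_real y)))"
  have QR: "Q t (\<i> * of_real y) = of_real (R t y) * u * exp (of_real a * (\<i> * of_real y))" for t y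
  proof -
    have "of_real (R t y) = cnj u * exp (- of_real a * (\<i> * of_real y)) * Q t (\<i> * of_real y)"
      unfolding R_def by (rule of_real_Re[OF real[OF u]])
    hence "of_real (R t y) * u * exp (of_real a * (\<i> * of_real y))
       = (u * cnj u) * (exp (- of_real a * (\<i> * of_real y)) * exp (of_real a * (\<i> * of_real y))) * Q t (\<i> * of_real y)"
      by (simp only: mult_ac)
    thus ?thesis by (simp add: uu flip: exp_add)
  qed
  have dR: "(R t has_real_derivative Re (cnj u * exp (- of_real a * (\<i> * of_real y)) * (Q' t (\<i> * of_real y) - of_real a * Q t (\<i> * of_real y)) * \<i>)) (at y)" for t y
    using line_derivative(2)[where a = 0 and \<tau> = y and v = \<i>, OF d\<Psi>[of u t]] by (simp add: R_def mult.commute[of _ \<i>] del: Re_complex_of_real)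
  have "open {x. Re (cnj u * exp (- of_real a * snd x) * (Q' (fst x) (snd x) - of_real a * Q (fst x) (snd x)) * \<i>) > 0}"
    unfolding Q Q' by (intro open_Collect_less continuous_intros)
  then obtain \<epsilon>1 where \<epsilon>1: "\<epsilon>1 > 0" "\<And>t s. \<bar>t\<bar> < \<epsilon>1 \<Longrightarrow> norm s < \<epsilon>1 \<Longrightarrow>
      Re (cnj u * exp (- of_real a * s) * (Q' t s - of_real a * Q t s) * \<i>) > 0"
    by (rule open_box2) (use upos Q00 in \<open>auto simp: mult_ac\<close>)
  \<comment> \<open>The derivative at \<open>s\<close> will be rotated by the tangent angle at
    another point, the displaced cusp, so positivity is needed with \<open>s\<close> and the angle
    varying independently.\<close>
  have "open {x. Re (cnj u * exp (- of_real a * (\<i> * of_real (Im (snd (snd x))))) * Q' (fst x) (fst (snd x)) * \<i>) > 0}" 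
    unfolding Q' by (intro open_Collect_less continuous_intros)
  then obtain A B where AB: "open A" "open B" "(0, 0, 0) \<in> A \<times> B" "A \<times> B \<subseteq>
     {x. Re (cnj u * exp (- of_real a * (\<i> * of_real (Im (snd (snd x))))) * Q' (fst x) (fst (snd x)) * \<i>) > 0}"
    by (rule open_prod_elim[of _ "(0, 0, 0)"]) (use upos in \<open>auto simp: mult.assoc\<close>)
  obtain B1 B2 where B12: "open B1" "open B2" "(0, 0) \<in> B1 \<times> B2" "B1 \<times> B2 \<subseteq> B"
    using open_prod_elim[OF AB(2), of "(0, 0)"] AB(3) by auto
  obtain e0 where e0: "e0 > 0" "ball 0 e0 \<subseteq> A" using AB open_contains_ball by (metis mem_Sigma_iff)
  obtain e1 where e1: "e1 > 0" "ball 0 e1 \<subseteq> B1" using B12 open_contains_ball by (metis mem_Sigma_iff)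
  obtain e2 where e2: "e2 > 0" "ball 0 e2 \<subseteq> B2" using B12 open_contains_ball by (metis mem_Sigma_iff)
  define \<epsilon>2 where "\<epsilon>2 = min e0 (min e1 e2)"
  have \<epsilon>2: "\<epsilon>2 > 0" using e0 e1 e2 by (simp add: \<epsilon>2_def)
  have \<epsilon>2': "Re (cnj u * exp (- of_real a * (\<i> * of_real y)) * Q' t s * \<i>) > 0"
    if "\<bar>t\<bar> < \<epsilon>2" "norm s < \<epsilon>2" "\<bar>y\<bar> < \<epsilon>2" for t s y
  proof -
    have "t \<in> A" using that(1) e0 by (auto simp: \<epsilon>2_def subset_iff)
    moreover have "s \<in> B1" using that(2) e1 by (auto simp: \<epsilon>2_def subset_iff)
    moreover have "\<i> * of_real y \<in> B2" using that(3) e2 by (auto simp: \<epsilon>2_def subset_iff norm_mult)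
    ultimately have "(t, s, \<i> * of_real y) \<in> A \<times> B" using B12 by auto
    thus ?thesis using AB(4) by auto
  qed
  define \<eta> where "\<eta> = min (min \<epsilon>1 \<epsilon>2) (pi / (2 * a)) / 2"
  have \<eta>: "\<eta> > 0" "\<eta> < \<epsilon>1" "\<eta> < \<epsilon>2" "2 * \<eta> * a < pi"
  proof -
    have "min (min \<epsilon>1 \<epsilon>2) (pi / (2 * a)) > 0" using \<epsilon>1 \<epsilon>2 a0 by auto
    thus "\<eta> > 0" "\<eta> < \<epsilon>1" "\<eta> < \<epsilon>2" by (auto simp: \<eta>_def)
    have "2 * \<eta> \<le> pi / (2 * a)" by (simp add: \<eta>_def)
    hence "2 * \<eta> * a \<le> pi / 2" using a0 by (simp add: field_simps)
    thus "2 * \<eta> * a < pi" using pi_gt_zero by linarith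
  qed
  have R_mono: "R t y < R t y'" if "\<bar>t\<bar> < \<epsilon>1" "- \<eta> \<le> y" "y < y'" "y' \<le> \<eta>" for t y y'
  proof (rule DERIV_pos_imp_increasing[OF that(3)])
    fix x assume "y \<le> x" "x \<le> y'"
    thus "\<exists>D. (R t has_real_derivative D) (at x) \<and> D > 0"
      using dR[of t x] \<epsilon>1(2)[of t "\<i> * of_real x"] that \<eta> by (auto simp: norm_mult)
  qed
  have R00: "R 0 0 = 0" by (simp add: R_def Q00)
  have R0: "R 0 \<eta> > 0" "R 0 (- \<eta>) < 0" using R_mono[of 0 0 \<eta>] R_mono[of 0 "-\<eta>" 0] R00 \<eta> \<epsilon>1 by auto
  have "open {t. R t \<eta> > 0 \<and> R t (- \<eta>) < 0}" unfolding R_def Q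
    by (intro open_Collect_conj open_Collect_less continuous_intros)
  then obtain \<epsilon>3 where \<epsilon>3: "\<epsilon>3 > 0" "\<And>t. \<bar>t\<bar> < \<epsilon>3 \<Longrightarrow> R t \<eta> > 0 \<and> R t (- \<eta>) < 0"
    using R0 unfolding open_contains_ball by (auto simp: subset_iff dest!: bspec[of _ _ 0])
  define S where "S = ball 0 \<eta> \<inter> {s. Re s < 0}"
  have convS: "convex S" unfolding S_def by (intro convex_Int convex_ball convex_halfspace_Re_lt)
  have main: "inj_on (\<lambda>s. poly (h t) (\<zeta> * exp s)) S" if t: "\<bar>t\<bar> < min (min \<epsilon>1 \<epsilon>2) \<epsilon>3" for t
  proof -
    have "continuous_on {- \<eta>..\<eta>} (R t)" unfolding R_def Q by (intro continuous_intros)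
    hence "\<exists>y. - \<eta> \<le> y \<and> y \<le> \<eta> \<and> R t y = 0"
      using \<epsilon>3(2)[of t] t \<eta> by (intro IVT') auto
    then obtain y0 where y0: "- \<eta> \<le> y0" "y0 \<le> \<eta>" "R t y0 = 0" by auto
    \<comment> \<open>This rotation aligns with the inward normal direction at the displaced cusp
      \<open>y0\<close>, and the resulting phase on the axis is a(y - y0).\<close>
    define \<kappa> where "\<kappa> = - \<i> * cnj u * exp (- of_real a * (\<i> * of_real y0))"
    have axis: "Re (\<kappa> * Q t (\<i> * of_real y)) \<ge> 0" if y: "\<bar>y\<bar> < \<eta>" for y
    proof -
      have "\<kappa> * Q t (\<i> * of_real y) = - \<i> * of_real (R t y) * (u * cnj u) *
          (exp (- of_real a * (\<i> * of_real y0)) * exp (of_real a * (\<i> * of_real y)))"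
        unfolding \<kappa>_def QR by (simp only: mult_ac)
      also have "exp (- of_real a * (\<i> * of_real y0)) * exp (of_real a * (\<i> * of_real y)) = cis (a * (y - y0))"
        unfolding cis_conv_exp by (simp add: algebra_simps flip: exp_add)
      finally have "Re (\<kappa> * Q t (\<i> * of_real y)) = R t y * sin (a * (y - y0))" by (simp add: uu)
      moreover have "R t y * sin (a * (y - y0)) \<ge> 0"
      proof (cases y y0 rule: linorder_cases)
        case equal thus ?thesis by simp
      next
        case greater
        have "R t y > 0" using R_mono[of t y0 y] greater y y0 t by auto
        moreover have "a * (y - y0) \<le> a * (2 * \<eta>)" using y y0 a0 by (intro mult_left_mono) auto
        hence "a * (y - y0) < pi" using \<eta>(4) by (simp only: mult_ac)
        hence "sin (a * (y - y0)) > 0" using greater a0 by (intro sin_gt_zero) auto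
        ultimately show ?thesis by simp
      next
        case less
        have "R t y < 0" using R_mono[of t y y0] less y y0 t by auto
        moreover have "a * (y0 - y) \<le> a * (2 * \<eta>)" using y y0 a0 by (intro mult_left_mono) auto
        hence "a * (y0 - y) < pi" using \<eta>(4) by (simp only: mult_ac)
        hence "sin (a * (y0 - y)) > 0" using less a0 by (intro sin_gt_zero) auto
        hence "sin (- (a * (y0 - y))) < 0" unfolding sin_minus by simp
        hence "sin (a * (y - y0)) < 0" by (simp add: algebra_simps)
        ultimately show ?thesis by (simp add: mult_nonpos_nonpos)
      qed
      ultimately show ?thesis by simp
    qed
    show ?thesis
    proof (rule inj_on_convex_Re_deriv[OF convS, where \<kappa> = \<kappa> and D = "Q t"])
      fix s assume "s \<in> S"
      show "((\<lambda>s. poly (h t) (\<zeta> * exp s)) has_field_derivative Q t s) (at s)"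
        unfolding Q_def by (rule has_field_derivative_poly_exp)
    next
      fix s assume "s \<in> S"
      hence s: "norm s < \<eta>" "Re s < 0" by (auto simp: S_def)
      define y where "y = Im s"
      have y: "\<bar>y\<bar> < \<eta>" using s abs_Im_le_cmod[of s] by (simp add: y_def)
      have s_eq: "s = \<i> * of_real y + of_real (Re s) * 1" by (simp add: complex_eq_iff y_def)
      have "Re (\<kappa> * Q t (\<i> * of_real y + of_real (Re s) * 1)) > Re (\<kappa> * Q t (\<i> * of_real y + of_real 0 * 1))"
      proof (rule DERIV_neg_imp_decreasing[OF s(2)])
        fix x assume x: "Re s \<le> x" "x \<le> 0"
        have "norm (\<i> * of_real y + of_real x * 1) \<le> norm s"
          using norm_shift_le[OF x] by (simp add: y_def)
        hence "Re (cnj u * exp (- of_real a * (\<i> * of_real y0)) * Q' t (\<i> * of_real y + of_real x * 1) * \<i>) > 0"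
          using s \<eta> t y0 by (intro \<epsilon>2') auto
        moreover have "\<kappa> * Q' t (\<i> * of_real y + of_real x * 1) * 1 =
            - (cnj u * exp (- of_real a * (\<i> * of_real y0)) * Q' t (\<i> * of_real y + of_real x * 1) * \<i>)"
          unfolding \<kappa>_def by (simp only: mult_ac mult_minus_left mult_minus_right mult_1)
        moreover have "((\<lambda>s. \<kappa> * Q t s) has_field_derivative \<kappa> * Q' t (\<i> * of_real y + of_real x * 1)) (at (\<i> * of_real y + of_real x * 1))"
          by (intro DERIV_cmult dQ)
        ultimately have "((\<lambda>s. \<kappa> * Q t s) has_field_derivative \<kappa> * Q' t (\<i> * of_real y + of_real x * 1)) (at (\<i> * of_real y + of_real x * 1))"
          "Re (\<kappa> * Q' t (\<i> * of_real y + of_real x * 1) * 1) < 0" by auto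
        thus "\<exists>D. ((\<lambda>x. Re (\<kappa> * Q t (\<i> * of_real y + of_real x * 1))) has_real_derivative D) (at x) \<and> D < 0"
          using line_derivative(2) by blast
      qed
      thus "Re (\<kappa> * Q t s) > 0" using axis[OF y] s_eq by simp
    qed
  qed
  obtain \<epsilon>' where \<epsilon>': "\<epsilon>' > 0" "\<And>z. norm (z - \<zeta>) < \<epsilon>' \<Longrightarrow> \<exists>s. norm s < \<eta> \<and> z = \<zeta> * exp s"
    using log_coordinate[OF \<zeta> \<eta>(1)] by blast
  define \<epsilon> where "\<epsilon> = min \<epsilon>' (min (min \<epsilon>1 \<epsilon>2) \<epsilon>3)"
  show ?thesis
  proof (rule that[of \<epsilon>])
    show "\<epsilon> > 0" using \<epsilon>' \<epsilon>1 \<epsilon>2 \<epsilon>3 by (simp add: \<epsilon>_def)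
    fix t assume t: "\<bar>t\<bar> < \<epsilon>"
    have *: "\<exists>s\<in>S. z = \<zeta> * exp s" if "z \<in> ball \<zeta> \<epsilon> \<inter> ball 0 1" for z
    proof -
      have "norm (z - \<zeta>) < \<epsilon>'" using that by (auto simp: \<epsilon>_def dist_norm norm_minus_commute)
      then obtain s where s: "norm s < \<eta>" "z = \<zeta> * exp s" using \<epsilon>'(2) by blast
      moreover have "Re s < 0" using that s \<zeta> by (auto simp: norm_mult)
      ultimately show ?thesis by (auto simp: S_def)
    qed
    have inj: "inj_on (\<lambda>s. poly (h t) (\<zeta> * exp s)) S" using main[of t] t by (simp add: \<epsilon>_def)
    show "inj_on (poly (f + smult (of_real t) g)) (ball \<zeta> \<epsilon> \<inter> ball 0 1)"
    proof (rule inj_onI)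
      fix x y assume xy: "x \<in> ball \<zeta> \<epsilon> \<inter> ball 0 1" "y \<in> ball \<zeta> \<epsilon> \<inter> ball 0 1"
        "poly (f + smult (of_real t) g) x = poly (f + smult (of_real t) g) y"
      obtain s where s: "s \<in> S" "x = \<zeta> * exp s" using *[OF xy(1)] by blast
      obtain s' where s': "s' \<in> S" "y = \<zeta> * exp s'" using *[OF xy(2)] by blast
      have "s = s'" using inj_onD[OF inj, of s s'] xy(3) s s' by (simp add: h_def)
      thus "x = y" using s s' by simp
    qed
  qed
qed

section \<open>From local to global univalence of the perturbed polynomial\<close>

context star_class
begin

text \<open>Four situations occur at a limit pair. On the diagonal, regular points follow from the
  derivative criterion and critical points from the cusp analysis. Off the diagonal, distinct values
  stay distinct by continuity, and at a double point the two branches remain on opposite sides of a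
  common line. The hypothesis \<open>tang\<close> is what makes that line common.\<close>

lemma perturbation_locally_injective:
  assumes g: "self_reciprocal d g"
    and tang: "\<And>\<zeta>1 \<zeta>2. norm \<zeta>1 = 1 \<Longrightarrow> norm \<zeta>2 = 1 \<Longrightarrow> \<zeta>1 \<noteq> \<zeta>2 \<Longrightarrow> poly f \<zeta>1 = poly f \<zeta>2 \<Longrightarrow>
      Im ((poly g \<zeta>1 - poly g \<zeta>2) / (\<i> * poly (euler_op f) \<zeta>1)) = 0"
    and z: "norm z \<le> 1" and w: "norm w \<le> 1"
  shows "\<exists>\<epsilon>>0. \<forall>t z' w'. \<bar>t\<bar> < \<epsilon> \<and> norm (z' - z) < \<epsilon> \<and> norm (w' - w) < \<epsilon> \<and> norm z' < 1 \<and> norm w' < 1 \<and> z' \<noteq> w'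
           \<longrightarrow> poly (f + smult (of_real t) g) z' \<noteq> poly (f + smult (of_real t) g) w'"
proof -
  define h where "h = (\<lambda>t. f + smult (of_real t) g)"
  have h: "poly (h t) x = poly f x + of_real t * poly g x" for t x by (simp add: h_def)
  have from_inj: ?thesis if "z = w" "\<epsilon> > 0" "\<And>t. \<bar>t\<bar> < \<epsilon> \<Longrightarrow> inj_on (poly (h t)) (ball z \<epsilon> \<inter> ball 0 1)" for \<epsilon>
  proof (intro exI[of _ \<epsilon>] conjI allI impI that)
    fix t z' w' assume *: "\<bar>t\<bar> < \<epsilon> \<and> norm (z' - z) < \<epsilon> \<and> norm (w' - w) < \<epsilon> \<and> norm z' < 1 \<and> norm w' < 1 \<and> z' \<noteq> w'"
    hence "z' \<in> ball z \<epsilon> \<inter> ball 0 1" "w' \<in> ball z \<epsilon> \<inter> ball 0 1"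
      using that(1) by (auto simp: dist_norm norm_minus_commute)
    thus "poly (f + smult (of_real t) g) z' \<noteq> poly (f + smult (of_real t) g) w'"
      using that(3)[of t] * unfolding inj_on_def h_def by blast
  qed
  consider "z = w" "poly (pderiv f) z \<noteq> 0" | "z = w" "poly (pderiv f) z = 0" | "poly f z \<noteq> poly f w"
    | "z \<noteq> w" "poly f z = poly f w" by blast
  thus ?thesis
  proof cases
    case 1
    define c where "c = poly (pderiv f) z"
    have "open {x. Re (1 / c * (poly (pderiv f) (z + snd x) + of_real (fst x) * poly (pderiv g) (z + snd x))) > 0}"
      by (intro open_Collect_less continuous_intros)
    then obtain \<epsilon> where \<epsilon>: "\<epsilon> > 0" "\<And>t s. \<bar>t\<bar> < \<epsilon> \<Longrightarrow> norm s < \<epsilon> \<Longrightarrow>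
        Re (1 / c * (poly (pderiv f) (z + s) + of_real t * poly (pderiv g) (z + s))) > 0"
      by (rule open_box2) (use 1 in \<open>auto simp: c_def\<close>)
    have "inj_on (poly (h t)) (ball z \<epsilon>)" if t: "\<bar>t\<bar> < \<epsilon>" for t
    proof (rule inj_on_convex_Re_deriv[where D = "poly (pderiv (h t))"])
      fix s assume s: "s \<in> ball z \<epsilon>"
      show "(poly (h t) has_field_derivative poly (pderiv (h t)) s) (at s)" by (rule poly_DERIV)
      show "Re (1 / c * poly (pderiv (h t)) s) > 0"
        using \<epsilon>(2)[OF t, of "s - z"] s by (simp add: h_def pderiv_add pderiv_smult dist_norm norm_minus_commute)
    qed auto
    thus ?thesis using from_inj[OF 1(1) \<epsilon>(1)] by (meson inf_le1 inj_on_subset)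
  next
    case 2
    have "norm z = 1" using 2 norm_crit by blast
    moreover have "poly (euler_op f) z = 0" using 2 by (simp add: poly_euler_op)
    moreover have "poly (pderiv (euler_op f)) z \<noteq> 0"
      using 2 crit_simple \<open>norm z = 1\<close> by (auto simp: euler_op_def pderiv_pCons)
    ultimately obtain \<epsilon> where "\<epsilon> > 0" "\<And>t. \<bar>t\<bar> < \<epsilon> \<Longrightarrow> inj_on (poly (h t)) (ball z \<epsilon> \<inter> ball 0 1)"
      using cusp_locally_injective[OF f_self_reciprocal g] unfolding h_def by metis
    thus ?thesis using from_inj 2 by blast
  next
    case 3
    have "open {x. poly f (z + fst (snd x)) + of_real (fst x) * poly g (z + fst (snd x)) \<noteq>
                   poly f (w + snd (snd x)) + of_real (fst x) * poly g (w + snd (snd x))}"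
      by (intro open_Collect_neq continuous_intros)
    then obtain \<epsilon> where \<epsilon>: "\<epsilon> > 0" "\<And>t s. \<bar>t\<bar> < \<epsilon> \<Longrightarrow> norm s < \<epsilon> \<Longrightarrow>
        poly (h t) (z + fst s) \<noteq> poly (h t) (w + snd s)"
      unfolding h by (rule open_box2) (use 3 in auto)
    show ?thesis
    proof (intro exI[of _ "\<epsilon>/2"] conjI allI impI)
      fix t z' w'
      assume *: "\<bar>t\<bar> < \<epsilon> / 2 \<and> norm (z' - z) < \<epsilon> / 2 \<and> norm (w' - w) < \<epsilon> / 2 \<and> norm z' < 1 \<and> norm w' < 1 \<and> z' \<noteq> w'"
      have "norm (z' - z, w' - w) \<le> norm (z' - z) + norm (w' - w)"
        by (simp add: norm_Pair sqrt_sum_squares_le_sum)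
      hence "norm (z' - z, w' - w) < \<epsilon>" using * by simp
      thus "poly (f + smult (of_real t) g) z' \<noteq> poly (f + smult (of_real t) g) w'"
        using \<epsilon>(2)[of t "(z' - z, w' - w)"] * \<epsilon>(1) by (simp add: h_def)
    qed (use \<epsilon> in auto)
  next
    case 4
    have n: "norm z = 1" "norm w = 1"
      using closed_disc_inj[of z w] closed_disc_inj[of w z] 4 z w by force+
    obtain c where c: "c > 0" "poly (euler_op f) w = - of_real c * poly (euler_op f) z"
      using double_pair(1)[OF n 4] by auto
    have q: "poly (euler_op f) z \<noteq> 0" "poly (euler_op f) w \<noteq> 0" using double_pair(2)[OF n 4] c by auto
    obtain e1 where e1: "e1 > 0" "\<And>t x. \<bar>t\<bar> < e1 \<Longrightarrow> norm (x - z) < e1 \<Longrightarrow> norm x \<le> 1 \<Longrightarrow> x \<noteq> z \<Longrightarrow>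
       Im ((poly (h t) x - poly (h t) z) / (\<i> * poly (euler_op f) z)) > 0"
      using boundary_side[OF f_self_reciprocal g n(1) q(1)] unfolding h_def by metis
    obtain e2 where e2: "e2 > 0" "\<And>t x. \<bar>t\<bar> < e2 \<Longrightarrow> norm (x - w) < e2 \<Longrightarrow> norm x \<le> 1 \<Longrightarrow> x \<noteq> w \<Longrightarrow>
       Im ((poly (h t) x - poly (h t) w) / (\<i> * poly (euler_op f) w)) > 0"
      using boundary_side[OF f_self_reciprocal g n(2) q(2)] unfolding h_def by metis
    show ?thesis
    proof (intro exI[of _ "min e1 e2"] conjI allI impI notI)
      show "min e1 e2 > 0" using e1 e2 by simp
      fix t z' w'
      assume *: "\<bar>t\<bar> < min e1 e2 \<and> norm (z' - z) < min e1 e2 \<and> norm (w' - w) < min e1 e2 \<and> norm z' < 1 \<and> norm w' < 1 \<and> z' \<noteq> w'"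
      assume "poly (f + smult (of_real t) g) z' = poly (f + smult (of_real t) g) w'"
      hence eq: "poly (h t) z' = poly (h t) w'" by (simp add: h_def)
      define k where "k = \<i> * poly (euler_op f) z"
      have k: "k \<noteq> 0" using q by (simp add: k_def)
      have "Im ((poly (h t) z' - poly (h t) z) / k) > 0"
        unfolding k_def using * n by (intro e1) auto
      moreover have "Im ((poly (h t) w' - poly (h t) w) / k) < 0"
      proof -
        have "Im ((poly (h t) w' - poly (h t) w) / (\<i> * poly (euler_op f) w)) > 0"
          using * n by (intro e2) auto
        moreover have "(poly (h t) w' - poly (h t) w) / (\<i> * poly (euler_op f) w) =
            of_real (- 1 / c) * ((poly (h t) w' - poly (h t) w) / k)"
          using c q k unfolding c(2) k_def by (simp add: field_simps)
        moreover have "Im (of_real (- 1 / c) * X) = - Im X / c" for X by simp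
        ultimately have "0 < - Im ((poly (h t) w' - poly (h t) w) / k) / c" by metis
        thus ?thesis using c(1) by (simp add: field_simps)
      qed
      \<comment> \<open>Both contact points move, but their displacement relative to each other is
        parallel to the tangent, so no gap or overlap opens between the two half planes.\<close>
      moreover have "Im ((poly (h t) z - poly (h t) w) / k) = 0"
      proof -
        have "(poly (h t) z - poly (h t) w) / k = of_real t * ((poly g z - poly g w) / k)"
          using 4 by (simp add: h algebra_simps diff_divide_distrib)
        moreover have "Im ((poly g z - poly g w) / k) = 0" using tang[OF n 4] by (simp add: k_def)
        moreover have "Im (of_real t * X) = t * Im X" for X by simp
        ultimately show ?thesis by (metis mult_zero_right)
      qed
      moreover have "(poly (h t) z' - poly (h t) z) / k + (poly (h t) z - poly (h t) w) / k = (poly (h t) w' - poly (h t) w) / k"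
        using eq by (simp add: diff_divide_distrib)
      ultimately show False by (metis add.right_neutral less_asym plus_complex.sel(2))
    qed
  qed
qed

text \<open>Counterexamples for parameters tending to 0 accumulate at some pair of the closed
  bidisc, where the local statement excludes them.\<close>

lemma perturbation_univalent:
  assumes g: "self_reciprocal d g"
    and tang: "\<And>\<zeta>1 \<zeta>2. norm \<zeta>1 = 1 \<Longrightarrow> norm \<zeta>2 = 1 \<Longrightarrow> \<zeta>1 \<noteq> \<zeta>2 \<Longrightarrow> poly f \<zeta>1 = poly f \<zeta>2 \<Longrightarrow>
      Im ((poly g \<zeta>1 - poly g \<zeta>2) / (\<i> * poly (euler_op f) \<zeta>1)) = 0"
  shows "\<exists>\<epsilon>>0. \<forall>t. \<bar>t\<bar> < \<epsilon> \<longrightarrow> inj_on (poly (f + smult (of_real t) g)) (ball 0 1)"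
proof (rule ccontr)
  define h where "h = (\<lambda>t::real. poly (f + smult (of_real t) g))"
  assume neg: "\<not> ?thesis"
  have "\<exists>t z w. \<bar>t\<bar> < 1 / real (Suc n) \<and> norm z < 1 \<and> norm w < 1 \<and> z \<noteq> w \<and> h t z = h t w" for n
  proof -
    have "1 / real (Suc n) > 0" by simp
    then obtain t where "\<bar>t\<bar> < 1 / real (Suc n)" "\<not> inj_on (h t) (ball 0 1)" using neg unfolding h_def by blast
    moreover from this(2) obtain x y where "norm x < 1" "norm y < 1" "h t x = h t y" "x \<noteq> y"
      by (auto simp: inj_on_def)
    ultimately show ?thesis by blast
  qed
  then obtain T A B where TAB: "\<And>n. \<bar>T n\<bar> < 1 / real (Suc n)" "\<And>n. norm (A n) < 1" "\<And>n. norm (B n) < 1"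
      "\<And>n. A n \<noteq> B n" "\<And>n. h (T n) (A n) = h (T n) (B n)"
    by metis
  have K: "compact (cball 0 1 \<times> cball (0::complex) (1::real) :: (complex \<times> complex) set)"
    by (intro compact_Times compact_cball)
  have "\<forall>n. (A n, B n) \<in> cball 0 1 \<times> cball 0 1" using TAB(2,3) by (auto intro: less_imp_le)
  then obtain l r where l: "l \<in> cball 0 1 \<times> cball 0 1" and r: "strict_mono r" "((\<lambda>n. (A n, B n)) \<circ> r) \<longlonglongrightarrow> l"
    by (rule seq_compactE[OF compact_imp_seq_compact[OF K]])
  obtain z w where zw: "l = (z, w)" by force
  have lim: "(\<lambda>n. A (r n)) \<longlonglongrightarrow> z" "(\<lambda>n. B (r n)) \<longlonglongrightarrow> w"
    using tendsto_fst[OF r(2)] tendsto_snd[OF r(2)] by (simp_all add: zw o_def)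
  have "norm z \<le> 1" "norm w \<le> 1" using l zw by auto
  from perturbation_locally_injective[OF g tang this] obtain \<epsilon> where \<epsilon>: "\<epsilon> > 0"
    "\<And>t z' w'. \<bar>t\<bar> < \<epsilon> \<Longrightarrow> norm (z' - z) < \<epsilon> \<Longrightarrow> norm (w' - w) < \<epsilon> \<Longrightarrow> norm z' < 1 \<Longrightarrow> norm w' < 1 \<Longrightarrow> z' \<noteq> w'
           \<Longrightarrow> h t z' \<noteq> h t w'" unfolding h_def by blast
  have "(\<lambda>n. 1 / real (Suc n)) \<longlonglongrightarrow> 0" by (rule LIMSEQ_Suc[OF lim_1_over_n])
  hence "(\<lambda>n. 1 / real (Suc (r n))) \<longlonglongrightarrow> 0" using LIMSEQ_subseq_LIMSEQ[OF _ r(1)] by (force simp: o_def)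
  hence "eventually (\<lambda>n. 1 / real (Suc (r n)) < \<epsilon>) sequentially" using \<epsilon>(1) by (rule order_tendstoD)
  moreover have "eventually (\<lambda>n. dist (A (r n)) z < \<epsilon>) sequentially" "eventually (\<lambda>n. dist (B (r n)) w < \<epsilon>) sequentially"
    using lim \<epsilon>(1) by (auto intro: tendstoD)
  ultimately have "eventually (\<lambda>n. False) sequentially"
  proof eventually_elim
    case (elim n)
    have "\<bar>T (r n)\<bar> < \<epsilon>" using TAB(1)[of "r n"] elim by linarith
    thus False using \<epsilon>(2)[of "T (r n)" "A (r n)" "B (r n)"] TAB elim by (auto simp: dist_norm)
  qed
  thus False by simp
qed

end

subsection \<open>Extreme points have many double points\<close>

text \<open>Gaussian elimination: an equation with a nonzero entry at the pivot \<open>k0\<close>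
  removes this unknown, \<open>A'\<close> is the reduced system, and back substitution gives the
  value at \<open>k0\<close>.\<close>

lemma homogeneous_system_nontrivial:
  fixes A :: "'i \<Rightarrow> 'k \<Rightarrow> real"
  assumes "finite I" "finite K" "card I < card K"
  shows "\<exists>x. (\<exists>k\<in>K. x k \<noteq> 0) \<and> (\<forall>i\<in>I. (\<Sum>k\<in>K. A i k * x k) = 0)"
  using assms
proof (induction I arbitrary: K A rule: finite_induct)
  case empty
  hence "K \<noteq> {}" by auto
  thus ?case by (intro exI[of _ "\<lambda>_. 1"]) auto
next
  case (insert i I)
  show ?case
  proof (cases "\<forall>k\<in>K. A i k = 0")
    case True
    thus ?thesis using insert.IH[of K A] insert.prems insert.hyps by auto
  next
    case False
    then obtain k0 where k0: "k0 \<in> K" "A i k0 \<noteq> 0" by auto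
    define A' where "A' = (\<lambda>j k. A j k - A j k0 * A i k / A i k0)"
    have "card I < card (K - {k0})" using insert k0 by simp
    then obtain x where x: "\<exists>k\<in>K - {k0}. x k \<noteq> 0" "\<forall>j\<in>I. (\<Sum>k\<in>K - {k0}. A' j k * x k) = 0"
      using insert.IH[of "K - {k0}" A'] insert.prems by auto
    define s where "s = (\<Sum>k\<in>K - {k0}. A i k * x k)"
    define y where "y = x(k0 := - s / A i k0)"
    have sum: "(\<Sum>k\<in>K. A j k * y k) = (\<Sum>k\<in>K - {k0}. A j k * x k) - A j k0 * s / A i k0" for j
    proof -
      have "(\<Sum>k\<in>K. A j k * y k) = A j k0 * y k0 + (\<Sum>k\<in>K - {k0}. A j k * y k)"
        using insert.prems k0 by (intro sum.remove) auto
      also have "(\<Sum>k\<in>K - {k0}. A j k * y k) = (\<Sum>k\<in>K - {k0}. A j k * x k)"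
        by (intro sum.cong) (auto simp: y_def)
      finally show ?thesis by (simp add: y_def)
    qed
    have "(\<Sum>k\<in>K. A j k * y k) = 0" if "j \<in> I" for j
    proof -
      have "0 = (\<Sum>k\<in>K - {k0}. A j k * x k - A j k0 / A i k0 * (A i k * x k))"
        using x(2) that by (simp add: A'_def left_diff_distrib mult.assoc)
      also have "\<dots> = (\<Sum>k\<in>K - {k0}. A j k * x k) - A j k0 / A i k0 * s"
        by (simp add: sum_subtractf s_def sum_distrib_left)
      finally show ?thesis using sum[of j] by simp
    qed
    moreover have "(\<Sum>k\<in>K. A i k * y k) = 0" using sum[of i] k0 by (simp add: s_def)
    moreover have "\<exists>k\<in>K. y k \<noteq> 0" using x(1) by (auto simp: y_def)
    ultimately show ?thesis by (intro exI[of _ y]) auto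
  qed
qed

text \<open>Self-reciprocity of \<open>\<Sum> c\<^sub>k z\<^sup>k / k\<close> means \<open>cnj c\<^sub>k = c\<close> at index \<open>d + 1 - k\<close>; the real parametrisation
  \<open>c\<^sub>k = (1 + \<i>) x\<^sub>k + (1 - \<i>) x\<close> at \<open>d + 1 - k\<close> avoids treating the middle index separately.\<close>

definition sr_basis :: "nat \<Rightarrow> nat \<Rightarrow> complex poly" where
  "sr_basis d k = monom ((1 + \<i>) / of_nat k) k + monom ((1 - \<i>) / of_nat (d + 1 - k)) (d + 1 - k)"

text \<open>The range \<open>2..d-1\<close> leaves the coefficients of z and z^d untouched, so these
  are directions within the normalisation, with \<open>d - 2\<close> real parameters.\<close>

definition sr_poly :: "nat \<Rightarrow> (nat \<Rightarrow> real) \<Rightarrow> complex poly" where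
  "sr_poly d x = (\<Sum>k=2..d-1. smult (of_real (x k)) (sr_basis d k))"

lemma poly_euler_op_monom:
  assumes "n > 0" shows "poly (euler_op (monom (c / of_nat n) n)) z = c * z ^ n"
  using assms by (cases n) (auto simp: poly_euler_op pderiv_monom poly_monom simp del: of_nat_Suc)

lemma self_reciprocal_sr_basis:
  assumes "k \<in> {2..d-1}" shows "self_reciprocal d (sr_basis d k)"
  unfolding self_reciprocal_def
proof (intro allI impI)
  fix z :: complex assume z: "norm z = 1"
  define k' where "k' = d + 1 - k"
  have k': "k > 0" "k' > 0" "d + 1 = k + k'" using assms by (auto simp: k'_def)
  have zz: "z * cnj z = 1" using z complex_norm_square[of z] by simp
  have e: "poly (euler_op (sr_basis d k)) z = (1 + \<i>) * z ^ k + (1 - \<i>) * z ^ k'"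
  proof -
    have "euler_op (sr_basis d k) = euler_op (monom ((1 + \<i>) / of_nat k) k) + euler_op (monom ((1 - \<i>) / of_nat k') k')"
      by (simp add: sr_basis_def k'_def euler_op_def pderiv_add)
    thus ?thesis using k' by (simp add: poly_euler_op_monom)
  qed
  have "z ^ (k + k') * cnj z ^ k = (z * cnj z) ^ k * z ^ k'" "z ^ (k + k') * cnj z ^ k' = (z * cnj z) ^ k' * z ^ k"
    by (simp_all add: power_add power_mult_distrib)
  hence "z ^ (k + k') * cnj z ^ k = z ^ k'" "z ^ (k + k') * cnj z ^ k' = z ^ k" by (simp_all add: zz)
  moreover have "z ^ (d + 1) * cnj ((1 + \<i>) * z ^ k + (1 - \<i>) * z ^ k') =
      (1 - \<i>) * (z ^ (k + k') * cnj z ^ k) + (1 + \<i>) * (z ^ (k + k') * cnj z ^ k')"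
    unfolding k'(3) by (simp add: algebra_simps)
  ultimately show "poly (euler_op (sr_basis d k)) z = z ^ (d + 1) * cnj (poly (euler_op (sr_basis d k)) z)"
    by (simp add: e)
qed

lemma self_reciprocal_sr_poly: "self_reciprocal d (sr_poly d x)"
proof -
  have "self_reciprocal d (\<Sum>k\<in>A. smult (of_real (x k)) (sr_basis d k))" if "finite A" "A \<subseteq> {2..d-1}" for A
    using that
  proof (induction rule: finite_induct)
    case empty show ?case by (simp add: self_reciprocal_def poly_euler_op)
  next
    case (insert a A)
    have "self_reciprocal d ((\<Sum>k\<in>A. smult (of_real (x k)) (sr_basis d k)) + smult (of_real (x a)) (sr_basis d a))"
      using insert by (intro self_reciprocal_perturb self_reciprocal_sr_basis) auto
    thus ?case using insert by (simp add: add.commute)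
  qed
  thus ?thesis by (simp add: sr_poly_def)
qed

lemma coeff_sr_poly:
  "coeff (sr_poly d x) j = (if j \<in> {2..d-1}
     then ((1 + \<i>) * of_real (x j) + (1 - \<i>) * of_real (x (d + 1 - j))) / of_nat j else 0)"
proof -
  have "coeff (sr_poly d x) j = (\<Sum>k=2..d-1. (if k = j then of_real (x k) * ((1 + \<i>) / of_nat k) else 0)) +
       (\<Sum>k=2..d-1. (if d + 1 - k = j then of_real (x k) * ((1 - \<i>) / of_nat (d + 1 - k)) else 0))"
    unfolding sr_poly_def sr_basis_def coeff_sum sum.distrib[symmetric]
    by (intro sum.cong refl) (auto simp: ring_distribs)
  also have "(\<Sum>k=2..d-1. (if k = j then of_real (x k) * ((1 + \<i>) / of_nat k) else 0)) =
      (if j \<in> {2..d-1} then of_real (x j) * ((1 + \<i>) / of_nat j) else 0)"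
    by (rule sum.delta) auto
  also have "(\<Sum>k=2..d-1. (if d + 1 - k = j then of_real (x k) * ((1 - \<i>) / of_nat (d + 1 - k)) else 0)) =
      (\<Sum>k=2..d-1. (if k = d + 1 - j then (if j \<in> {2..d-1} then of_real (x (d + 1 - j)) * ((1 - \<i>) / of_nat j) else 0) else 0))"
    by (intro sum.cong) auto
  also have "\<dots> = (if d + 1 - j \<in> {2..d-1} then (if j \<in> {2..d-1} then of_real (x (d + 1 - j)) * ((1 - \<i>) / of_nat j) else 0) else 0)"
    by (rule sum.delta) simp
  also have "\<dots> = (if j \<in> {2..d-1} then of_real (x (d + 1 - j)) * ((1 - \<i>) / of_nat j) else 0)"
    by auto
  finally have "coeff (sr_poly d x) j = (if j \<in> {2..d-1} then of_real (x j) * ((1 + \<i>) / of_nat j) else 0) +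
      (if j \<in> {2..d-1} then of_real (x (d + 1 - j)) * ((1 - \<i>) / of_nat j) else 0)" .
  moreover have "a * (b / c) + a' * (b' / c) = (b * a + b' * a') / c" for a b c a' b' :: complex
    by (simp add: add_divide_distrib mult.commute)
  ultimately show ?thesis by (cases "j \<in> {2..d-1}") (simp_all only: if_True if_False add_0_right)
qed

text \<open>The real and imaginary parts of k times coefficient k are the sum and the difference of
  the parameters at \<open>k\<close> and \<open>d + 1 - k\<close>, so the parameters can be
  recovered, even when the two indices coincide.\<close>

lemma sr_poly_nonzero:
  assumes "k \<in> {2..d-1}" "x k \<noteq> 0" shows "sr_poly d x \<noteq> 0"
proof
  assume "sr_poly d x = 0"
  hence "coeff (sr_poly d x) k = 0" by simp
  hence "(1 + \<i>) * of_real (x k) + (1 - \<i>) * of_real (x (d + 1 - k)) = 0"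
    using assms(1) by (simp add: coeff_sr_poly)
  hence "x k + x (d + 1 - k) = 0" "x k - x (d + 1 - k) = 0" by (simp_all add: complex_eq_iff)
  thus False using assms by simp
qed

context star_class
begin

lemma extreme_card_double_points:
  assumes ext: "extreme_point_poly (S_star_poly d) f"
  shows "d - 2 \<le> card (double_points f)"
proof (rule ccontr)
  assume "\<not> ?thesis"
  hence less: "card (double_points f) < card {2..d-1}" using d2 by simp
  have "\<forall>w\<in>double_points f. \<exists>\<zeta>. norm (fst \<zeta>) = 1 \<and> norm (snd \<zeta>) = 1 \<and> fst \<zeta> \<noteq> snd \<zeta> \<and> poly f (fst \<zeta>) = w \<and> poly f (snd \<zeta>) = w"
    by (auto simp: double_points_def) metis
  then obtain p where p: "\<And>w. w \<in> double_points f \<Longrightarrow> norm (fst (p w)) = 1 \<and> norm (snd (p w)) = 1 \<and>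
      fst (p w) \<noteq> snd (p w) \<and> poly f (fst (p w)) = w \<and> poly f (snd (p w)) = w"
    by metis
  \<comment> \<open>One row per double point: the equation asks that the branches move against each
    other only along the common tangent.\<close>
  define A where "A = (\<lambda>w k. Im ((poly (sr_basis d k) (fst (p w)) - poly (sr_basis d k) (snd (p w))) /
      (\<i> * poly (euler_op f) (fst (p w)))))"
  obtain x where x: "\<exists>k\<in>{2..d-1}. x k \<noteq> 0" "\<And>w. w \<in> double_points f \<Longrightarrow> (\<Sum>k=2..d-1. A w k * x k) = 0"
    using homogeneous_system_nontrivial[OF finite_double_points _ less, of A] by auto
  define g where "g = sr_poly d x"
  have g0: "g \<noteq> 0" using x(1) sr_poly_nonzero unfolding g_def by blast
  have sr: "self_reciprocal d g" unfolding g_def by (rule self_reciprocal_sr_poly)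
  have tang1: "Im ((poly g (fst (p w)) - poly g (snd (p w))) / (\<i> * poly (euler_op f) (fst (p w)))) = 0"
    if "w \<in> double_points f" for w
  proof -
    let ?c = "\<i> * poly (euler_op f) (fst (p w))"
    have "(poly g (fst (p w)) - poly g (snd (p w))) / ?c =
       (\<Sum>k=2..d-1. of_real (x k) * ((poly (sr_basis d k) (fst (p w)) - poly (sr_basis d k) (snd (p w))) / ?c))"
      by (simp add: g_def sr_poly_def poly_sum sum_subtractf[symmetric] sum_divide_distrib algebra_simps)
    also have "Im \<dots> = (\<Sum>k=2..d-1. x k * Im ((poly (sr_basis d k) (fst (p w)) - poly (sr_basis d k) (snd (p w))) / ?c))"
      unfolding Im_sum by (intro sum.cong refl) (simp only: Im_complex_of_real Re_complex_of_real times_complex.sel mult_zero_left add_0_right)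
    also have "\<dots> = 0" using x(2)[OF that] by (simp add: A_def mult.commute)
    finally show ?thesis .
  qed
  \<comment> \<open>The system imposes the condition for one chosen ordering of the two preimages.
    Exchanging them changes the quotient only by a positive real factor, because the tangent vectors
    are antiparallel, and there is no third preimage.\<close>
  have tang: "Im ((poly g \<zeta>1 - poly g \<zeta>2) / (\<i> * poly (euler_op f) \<zeta>1)) = 0"
    if \<zeta>: "norm \<zeta>1 = 1" "norm \<zeta>2 = 1" "\<zeta>1 \<noteq> \<zeta>2" "poly f \<zeta>1 = poly f \<zeta>2" for \<zeta>1 \<zeta>2
  proof -
    define w where "w = poly f \<zeta>1"
    have w: "w \<in> double_points f" using \<zeta> unfolding double_points_def w_def by blast
    note pw = p[OF w]
    have *: "a = \<zeta>1 \<or> a = \<zeta>2" if "norm a = 1" "poly f a = w" for a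
      using no_triple[of \<zeta>1 \<zeta>2 a] that \<zeta> unfolding w_def by metis
    have "fst (p w) = \<zeta>1 \<or> fst (p w) = \<zeta>2" "snd (p w) = \<zeta>1 \<or> snd (p w) = \<zeta>2" "fst (p w) \<noteq> snd (p w)"
      using pw *[of "fst (p w)"] *[of "snd (p w)"] by blast+
    then consider "\<zeta>1 = fst (p w)" "\<zeta>2 = snd (p w)" | "\<zeta>2 = fst (p w)" "\<zeta>1 = snd (p w)"
      by argo
    thus ?thesis
    proof cases
      case 1 thus ?thesis using tang1[OF w] by simp
    next
      case 2
      obtain c where c: "c > 0" "poly (euler_op f) \<zeta>1 = - of_real c * poly (euler_op f) \<zeta>2"
        using double_pair(1)[of \<zeta>2 \<zeta>1] \<zeta> by auto
      have "poly (euler_op f) \<zeta>2 \<noteq> 0" using double_pair(2)[of \<zeta>2 \<zeta>1] \<zeta> by auto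
      hence "(poly g \<zeta>1 - poly g \<zeta>2) / (\<i> * poly (euler_op f) \<zeta>1) =
         of_real (1 / c) * ((poly g \<zeta>2 - poly g \<zeta>1) / (\<i> * poly (euler_op f) \<zeta>2))"
        unfolding c(2) using c(1) by (simp add: field_simps)
      also have "Im \<dots> = 1 / c * Im ((poly g \<zeta>2 - poly g \<zeta>1) / (\<i> * poly (euler_op f) \<zeta>2))"
        by (simp only: Im_complex_of_real Re_complex_of_real times_complex.sel mult_zero_left add_0_right)
      also have "\<dots> = 0" using tang1[OF w] 2 by simp
      finally show ?thesis .
    qed
  qed
  have "\<exists>\<epsilon>>0. \<forall>t. \<bar>t\<bar> < \<epsilon> \<longrightarrow> inj_on (poly (f + smult (of_real t) g)) (ball 0 1)"
    by (rule perturbation_univalent[OF sr]) (rule tang)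
  then obtain \<epsilon> where \<epsilon>: "\<epsilon> > 0" "\<And>t. \<bar>t\<bar> < \<epsilon> \<Longrightarrow> inj_on (poly (f + smult (of_real t) g)) (ball 0 1)"
    by blast
  have in_star: "f + smult (of_real t) g \<in> S_star_poly d" if "\<bar>t\<bar> < \<epsilon>" for t
  proof -
    have cg: "coeff g i = 0" if "i \<notin> {2..d-1}" for i unfolding g_def coeff_sr_poly using that by auto
    have "degree (f + smult (of_real t) g) \<le> d"
      using d2 by (intro degree_le) (auto simp: cg coeff_eq_0 f_degree)
    moreover have "coeff (f + smult (of_real t) g) 0 = 0" "coeff (f + smult (of_real t) g) 1 = 1"
       "coeff (f + smult (of_real t) g) d = 1 / of_nat d"
      using f_coeff0 f_coeff1 f_coeffd d2 by (auto simp: cg)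
    ultimately show ?thesis using \<epsilon>(2)[OF that] by (simp add: S_star_poly_def S_poly_def)
  qed
  define t where "t = \<epsilon> / 2"
  have "f + smult (of_real t) g \<in> S_star_poly d" "f + smult (of_real (-t)) g \<in> S_star_poly d"
    using \<epsilon>(1) by (intro in_star; simp add: t_def)+
  moreover have "f = smult (1/2) ((f + smult (of_real t) g) + (f + smult (of_real (-t)) g))"
    by (rule poly_eqI) (simp only: coeff_smult coeff_add, simp)
  ultimately have "f + smult (of_real t) g = f + smult (of_real (-t)) g"
    using ext unfolding extreme_point_poly_def by blast
  hence "smult (of_real (2 * t)) g = 0" by (simp add: poly_eq_iff)
  thus False using g0 \<epsilon>(1) by (simp add: t_def)
qed

end

subsection \<open>Counting marked points in laminar families of intervals\<close>

text \<open>The total length is generalised to the length outside a closed set, so that the shortest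
  interval can be collapsed to one of its marked points.\<close>

lemma laminar_interval_count:
  fixes X :: "(real \<times> real) set" and Z R :: "real set" and L :: real
  assumes "finite X" "X \<noteq> {}" "finite Z" "closed R" and L: "L > 0"
    and "\<And>I. I \<in> X \<Longrightarrow> fst I < snd I" and "\<And>I. I \<in> X \<Longrightarrow> fst I \<notin> R"
    and "\<And>I. I \<in> X \<Longrightarrow> real (card (Z \<inter> {fst I<..<snd I})) = L * measure lborel ({fst I..snd I} - R) + 1"
    and "\<And>I J. I \<in> X \<Longrightarrow> J \<in> X \<Longrightarrow> I \<noteq> J \<Longrightarrow> {fst I..snd I} \<inter> {fst J..snd J} = {} \<or>
        {fst I..snd I} \<subseteq> {fst J<..<snd J} \<or> {fst J..snd J} \<subseteq> {fst I<..<snd I}"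
  shows "card X + 1 \<le> card Z"
  using assms(1-4,6-9)
proof (induction "card X" arbitrary: X Z R rule: less_induct)
  case less
  note fin = less.prems(1,3) and lt = less.prems(5) and nR = less.prems(6) and count = less.prems(7) and lam = less.prems(8)
  \<comment> \<open>A shortest interval contains no other interval of the family, so every other one
    is disjoint from it or surrounds it.\<close>
  define I where "I = arg_min_on (\<lambda>I. snd I - fst I) X"
  have I: "I \<in> X" "\<And>J. J \<in> X \<Longrightarrow> snd I - fst I \<le> snd J - fst J"
    using arg_min_if_finite[OF less.prems(1,2), of "\<lambda>I. snd I - fst I"] by (auto simp: I_def not_less)
  define a b where "a = fst I" and "b = snd I"
  have ab: "a < b" "a \<notin> R" using lt I nR by (auto simp: a_def b_def)
  have meas: "{x..y} - R \<in> fmeasurable lborel" for x y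
    using less.prems(4) fmeasurable_cbox(1)[of x y] by (intro fmeasurable_Diff) (auto simp: cbox_interval)
  \<comment> \<open>The left endpoint is outside the closed set \<open>R\<close>, so a piece of
    positive length survives next to it. The count then exceeds 1, and being an integer it is at
    least 2.\<close>
  have pos: "measure lborel ({a..b} - R) > 0"
  proof -
    have "open (- R)" using less.prems(4) by auto
    then obtain e where e: "e > 0" "ball a e \<subseteq> - R" using ab by (metis ComplI open_contains_ball)
    define c where "c = min b (a + e / 2)"
    have c: "a < c" using ab e by (simp add: c_def)
    have sub: "{a..c} \<subseteq> {a..b} - R" using e by (auto simp: c_def dist_real_def subset_iff)
    have "0 < measure lborel {a..c}" using c by simp
    also have "\<dots> \<le> measure lborel ({a..b} - R)" by (rule measure_mono_fmeasurable[OF sub _ meas]) auto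
    finally show ?thesis .
  qed
  have cI: "real (card (Z \<inter> {a<..<b})) = L * measure lborel ({a..b} - R) + 1" using count[OF I(1)] by (simp add: a_def b_def)
  have "L * measure lborel ({a..b} - R) > 0" using pos L by simp
  hence cI2: "card (Z \<inter> {a<..<b}) \<ge> 2" using cI by linarith
  then obtain z0 where z0: "z0 \<in> Z" "a < z0" "z0 < b"
    by (metis IntE card.empty ex_in_conv greaterThanLessThan_iff not_numeral_le_zero)
  \<comment> \<open>Keeping one marked point of the collapsed interval removes \<open>L\<close>
    times its remaining length from the count of each surrounding interval, which is what adding the
    interval to \<open>R\<close> removes on the right-hand side. At least one marked point
    disappears.\<close>
  define Z' where "Z' = insert z0 (Z - {a<..<b})"
  have "card (Z - {a<..<b}) = card Z - card (Z \<inter> {a<..<b})" using fin by (simp add: card_Diff_subset_Int)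
  moreover have cle: "card (Z \<inter> {a<..<b}) \<le> card Z" using fin by (intro card_mono) auto
  moreover have "card Z' = card (Z - {a<..<b}) + 1" using fin z0 by (simp add: Z'_def)
  ultimately have cZ': "card Z' + 1 \<le> card Z" using cI2 by linarith
  show ?case
  proof (cases "X = {I}")
    case True
    thus ?thesis using cI2 cle by simp
  next
    case False
    have rel: "J \<in> X \<Longrightarrow> J \<noteq> I \<Longrightarrow> {a..b} \<inter> {fst J..snd J} = {} \<or> {a..b} \<subseteq> {fst J<..<snd J}" for J
    proof -
      assume J: "J \<in> X" "J \<noteq> I"
      have "\<not> {fst J..snd J} \<subseteq> {fst I<..<snd I}"
      proof
        assume *: "{fst J..snd J} \<subseteq> {fst I<..<snd I}"
        have "fst J \<in> {fst J..snd J}" "snd J \<in> {fst J..snd J}" using lt[OF J(1)] by auto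
        hence "fst I < fst J" "snd J < snd I" using * by auto
        thus False using I(2)[OF J(1)] by simp
      qed
      thus ?thesis using lam[OF I(1) J(1)] J(2) by (auto simp: a_def b_def)
    qed
    have "card (X - {I}) + 1 \<le> card Z'"
    proof (rule less.hyps[where R = "R \<union> {a..b}"])
      show "card (X - {I}) < card X" using fin I by (intro psubset_card_mono) auto
      show "finite (X - {I})" "finite Z'" "closed (R \<union> {a..b})" using fin less.prems(4) by (auto simp: Z'_def)
      show "X - {I} \<noteq> {}" using False I(1) by auto
      fix J assume J': "J \<in> X - {I}"
      hence J: "J \<in> X" "J \<noteq> I" by auto
      show "fst J < snd J" using lt J by simp
      have "fst J \<notin> {a..b}"
      proof
        assume *: "fst J \<in> {a..b}"
        moreover have "fst J \<in> {fst J..snd J}" using lt[OF J(1)] by simp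
        ultimately have "{a..b} \<subseteq> {fst J<..<snd J}" using rel[OF J] by blast
        thus False using * by auto
      qed
      thus "fst J \<notin> R \<union> {a..b}" using nR J by auto
      show "real (card (Z' \<inter> {fst J<..<snd J})) = L * measure lborel ({fst J..snd J} - (R \<union> {a..b})) + 1"
        using rel[OF J]
      proof
        assume disj: "{a..b} \<inter> {fst J..snd J} = {}"
        have "z0 \<notin> {fst J..snd J}" 
        proof -
          have "z0 \<in> {a..b}" using z0 by simp
          thus ?thesis using disj by blast
        qed
        moreover have "{a<..<b} \<inter> {fst J<..<snd J} = {}" 
        proof -
          have "{a<..<b} \<subseteq> {a..b}" "{fst J<..<snd J} \<subseteq> {fst J..snd J}" by auto
          thus ?thesis using disj by blast
        qed
        ultimately have "Z' \<inter> {fst J<..<snd J} = Z \<inter> {fst J<..<snd J}" by (auto simp: Z'_def)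
        moreover have "{fst J..snd J} - (R \<union> {a..b}) = {fst J..snd J} - R" using disj by blast
        ultimately show ?thesis using count[OF J(1)] by simp
      next
        assume nest: "{a..b} \<subseteq> {fst J<..<snd J}"
        have z0J: "z0 \<in> {fst J<..<snd J}" 
        proof -
          have "z0 \<in> {a..b}" using z0 by simp
          thus ?thesis using nest by blast
        qed
        have sub: "Z \<inter> {a<..<b} \<subseteq> Z \<inter> {fst J<..<snd J}" 
        proof -
          have "{a<..<b} \<subseteq> {a..b}" by auto
          thus ?thesis using nest by blast
        qed
        have "Z' \<inter> {fst J<..<snd J} = insert z0 (Z \<inter> {fst J<..<snd J} - Z \<inter> {a<..<b})"
          using z0J by (auto simp: Z'_def)
        hence "card (Z' \<inter> {fst J<..<snd J}) = card (Z \<inter> {fst J<..<snd J} - Z \<inter> {a<..<b}) + 1"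
          using z0 fin by simp
        also have "card (Z \<inter> {fst J<..<snd J} - Z \<inter> {a<..<b}) = card (Z \<inter> {fst J<..<snd J}) - card (Z \<inter> {a<..<b})"
          using sub fin by (intro card_Diff_subset) auto
        finally have "real (card (Z' \<inter> {fst J<..<snd J})) = real (card (Z \<inter> {fst J<..<snd J})) - real (card (Z \<inter> {a<..<b})) + 1"
          using card_mono[OF _ sub] fin by simp
        also have "\<dots> = L * (measure lborel ({fst J..snd J} - R) - measure lborel ({a..b} - R)) + 1"
          unfolding cI count[OF J(1)] by (simp add: algebra_simps)
        also have "measure lborel ({fst J..snd J} - R) - measure lborel ({a..b} - R) = measure lborel (({fst J..snd J} - R) - ({a..b} - R))"
        proof (rule measure_Diff[symmetric])
          show "{a..b} - R \<subseteq> {fst J..snd J} - R" using nest by force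
          show "emeasure lborel ({fst J..snd J} - R) \<noteq> \<infinity>" using fmeasurableD2[OF meas] by (simp add: infinity_ennreal_def)
        qed (use fmeasurableD[OF meas] in auto)
        also have "({fst J..snd J} - R) - ({a..b} - R) = {fst J..snd J} - (R \<union> {a..b})" by auto
        finally show ?thesis .
      qed
    next
      fix J K assume "J \<in> X - {I}" "K \<in> X - {I}" "J \<noteq> K"
      thus "{fst J..snd J} \<inter> {fst K..snd K} = {} \<or>
        {fst J..snd J} \<subseteq> {fst K<..<snd K} \<or> {fst K..snd K} \<subseteq> {fst J<..<snd J}" by (intro lam) auto
    qed
    moreover have "card (X - {I}) + 1 = card X" using fin I by (metis Suc_eq_plus1 card.remove)
    ultimately show ?thesis using cZ' by linarith
  qed
qed

subsection \<open>The logarithm of the divided difference\<close>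

text \<open>Logarithms of the same number differ by multiples of 2 pi i, so the range is discrete.
  This is the tool for comparing the abstract logarithm with explicit ones without a 2 pi
  ambiguity.\<close>

lemma constant_of_exp_constant:
  fixes h :: "'a :: topological_space \<Rightarrow> complex"
  assumes "connected S" "continuous_on S h" "\<And>x. x \<in> S \<Longrightarrow> exp (h x) = c" "x \<in> S" "y \<in> S"
  shows "h x = h y"
proof -
  have "h constant_on S"
  proof (rule continuous_discrete_range_constant[OF assms(1,2)])
    fix x assume x: "x \<in> S"
    have "2 * pi \<le> norm (h y - h x)" if "y \<in> S" "h y \<noteq> h x" for y
    proof -
      have "exp (h y) = exp (h x)" using that x assms(3) by metis
      then obtain n :: int where n: "h y = h x + (of_int (2 * n) * pi) * \<i>" by (auto simp: exp_eq)
      hence "n \<noteq> 0" using that by auto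
      hence "1 \<le> \<bar>real_of_int n\<bar>" by linarith
      moreover have "norm (h y - h x) = 2 * pi * \<bar>real_of_int n\<bar>" by (simp add: n norm_mult abs_mult)
      ultimately show ?thesis by simp
    qed
    thus "\<exists>e>0. \<forall>y. y \<in> S \<and> h y \<noteq> h x \<longrightarrow> e \<le> norm (h y - h x)" by (intro exI[of _ "2 * pi"]) auto
  qed
  thus ?thesis using assms(4,5) by (auto simp: constant_on_def)
qed

text \<open>The polar form is 1 - cis \<phi> = 2 sin(\<phi>/2) cis((\<phi> - pi)/2), with a positive
  modulus and an angle in the principal range.\<close>

lemma Im_Ln_one_minus_cis:
  assumes "0 < \<phi>" "\<phi> < 2 * pi"
  shows "Im (Ln (1 - cis \<phi>)) = (\<phi> - pi) / 2"
proof -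
  have s: "sin (\<phi> / 2) > 0" using assms by (intro sin_gt_zero) auto
  have "1 - cis \<phi> = of_real (2 * sin (\<phi> / 2)) * exp (\<i> * of_real ((\<phi> - pi) / 2))"
  proof -
    have "exp (\<i> * of_real ((\<phi> - pi) / 2)) = cis (\<phi> / 2 - pi / 2)" by (simp add: cis_conv_exp diff_divide_distrib)
    moreover have "cos (\<phi> / 2 - pi / 2) = sin (\<phi> / 2)" by (simp add: cos_diff)
    moreover have "sin (\<phi> / 2 - pi / 2) = - cos (\<phi> / 2)" by (simp add: sin_diff)
    moreover have "cos \<phi> = 1 - 2 * (sin (\<phi> / 2))\<^sup>2" using cos_double_sin[of "\<phi> / 2"] by simp
    moreover have "sin \<phi> = 2 * sin (\<phi> / 2) * cos (\<phi> / 2)" using sin_double[of "\<phi> / 2"] by simp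
    ultimately show ?thesis by (simp add: complex_eq_iff power2_eq_square)
  qed
  also have "\<dots> = exp (of_real (ln (2 * sin (\<phi> / 2))) + \<i> * of_real ((\<phi> - pi) / 2))"
    using s by (simp add: exp_add exp_of_real)
  finally have "Ln (1 - cis \<phi>) = of_real (ln (2 * sin (\<phi> / 2))) + \<i> * of_real ((\<phi> - pi) / 2)"
    using assms by (simp only: Ln_exp) (simp add: Ln_exp)
  thus ?thesis by simp
qed

lemma cis_diff_factor: "cis x - cis y = cis ((x + y) / 2) * (2 * \<i> * of_real (sin ((x - y) / 2)))"
proof -
  have "cis x = cis ((x + y) / 2) * cis ((x - y) / 2)" "cis y = cis ((x + y) / 2) * cis (- ((x - y) / 2))"
    by (simp_all add: cis_mult field_simps)
  moreover have "cis a - cis (- a) = 2 * \<i> * of_real (sin a)" for a by (simp add: complex_eq_iff)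
  ultimately show ?thesis by (metis right_diff_distrib)
qed

text \<open>A polynomial expression instead of a quotient makes the divided difference continuous
  across the diagonal, where it becomes the derivative.\<close>

definition divdiff :: "complex poly \<Rightarrow> complex \<Rightarrow> complex \<Rightarrow> complex" where
  "divdiff p z w = (\<Sum>k\<le>degree p. coeff p k * (\<Sum>i<k. w ^ (k - Suc i) * z ^ i))"

lemma divdiff: "(z - w) * divdiff p z w = poly p z - poly p w"
proof -
  have "poly p z - poly p w = (\<Sum>k\<le>degree p. coeff p k * (z ^ k - w ^ k))"
    by (simp add: poly_altdef sum_subtractf[symmetric] right_diff_distrib)
  also have "\<dots> = (\<Sum>k\<le>degree p. (z - w) * (coeff p k * (\<Sum>i<k. w ^ (k - Suc i) * z ^ i)))"
    unfolding power_diff_sumr2 by (simp add: mult_ac)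
  also have "\<dots> = (z - w) * divdiff p z w" by (simp add: divdiff_def sum_distrib_left)
  finally show ?thesis ..
qed

lemma continuous_on_divdiff [continuous_intros]:
  assumes "continuous_on A u" "continuous_on A v"
  shows "continuous_on A (\<lambda>x. divdiff p (u x) (v x))"
  unfolding divdiff_def by (intro continuous_intros assms)

lemma divdiff_diag: "divdiff p z z = poly (pderiv p) z"
proof -
  have "((\<lambda>w. divdiff p w z) \<longlongrightarrow> divdiff p z z) (at z)"
    using continuous_on_divdiff[of UNIV "\<lambda>w. w" "\<lambda>_. z" p]
    by (simp add: continuous_on_def)
  moreover have "((\<lambda>w. (poly p w - poly p z) / (w - z)) \<longlongrightarrow> poly (pderiv p) z) (at z)"
    using poly_DERIV[of p z] by (simp add: has_field_derivative_iff)
  hence "((\<lambda>w. divdiff p w z) \<longlongrightarrow> poly (pderiv p) z) (at z)"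
    by (rule Lim_transform_eventually)
       (auto simp: eventually_at_topological divdiff[symmetric] intro!: exI[of _ UNIV])
  ultimately show ?thesis by (rule LIM_unique)
qed

lemma divdiff_commute: "divdiff p z w = divdiff p w z"
proof (cases "z = w")
  case False
  have "(z - w) * divdiff p z w = (z - w) * divdiff p w z" 
  proof -
    have "(z - w) * divdiff p w z = - ((w - z) * divdiff p w z)" by (simp add: algebra_simps)
    thus ?thesis by (simp only: divdiff minus_diff_eq)
  qed
  thus ?thesis using False by simp
qed simp

lemma norm_cis_diff_le: "norm (cis a - cis b) \<le> \<bar>a - b\<bar>"
proof -
  have "norm (cis a - cis b) = 2 * \<bar>sin ((a - b) / 2)\<bar>" unfolding cis_diff_factor by (simp add: norm_mult)
  also have "\<dots> \<le> 2 * \<bar>(a - b) / 2\<bar>" by (intro mult_left_mono abs_sin_x_le_abs_x) auto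
  finally show ?thesis by simp
qed

lemma cis_eq_iff: "cis x = cis y \<longleftrightarrow> (\<exists>n::int. x = y + 2 * pi * n)"
  using sin_cos_eq_iff[of x y] by (auto simp: complex_eq_iff)

lemma cis_eq_imp_eq:
  assumes "cis x = cis y" "\<bar>x - y\<bar> < 2 * pi" shows "x = y"
proof -
  obtain n :: int where n: "x = y + 2 * pi * n" using assms(1) cis_eq_iff by blast
  hence "2 * pi * \<bar>real_of_int n\<bar> < 2 * pi * 1" using assms(2) by (simp add: abs_mult)
  hence "\<bar>real_of_int n\<bar> < 1" by (subst (asm) mult_less_cancel_left_pos) auto
  thus ?thesis using n by simp
qed

lemma ex_angle:
  assumes "norm z = 1" obtains \<phi> where "\<theta> \<le> \<phi>" "\<phi> < \<theta> + 2 * pi" "cis \<phi> = z"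
proof -
  define a where "a = Arg z"
  have a: "cis a = z" 
  proof -
    have "z \<noteq> 0" using assms by auto
    thus ?thesis using assms cis_Arg[of z] by (simp add: a_def sgn_div_norm)
  qed
  define n where "n = \<lfloor>(a - \<theta>) / (2 * pi)\<rfloor>"
  have "of_int n \<le> (a - \<theta>) / (2 * pi)" "(a - \<theta>) / (2 * pi) < of_int n + 1" unfolding n_def by linarith+
  hence "2 * pi * of_int n \<le> a - \<theta>" "a - \<theta> < 2 * pi * of_int n + 2 * pi"
    by (auto simp: field_simps)
  moreover have "cis (a - 2 * pi * of_int n) = z" unfolding a[symmetric]
    by (subst cis_eq_iff) (auto intro!: exI[of _ "-n"])
  ultimately show ?thesis by (intro that[of "a - 2 * pi * of_int n"]) auto
qed

lemma Re_one_minus_pos: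
  assumes "norm z \<le> 1" "z \<noteq> 1" shows "Re (1 - z) > 0"
proof -
  have "Re z \<noteq> 1"
  proof
    assume "Re z = 1"
    moreover from this have "Im z = 0" using assms(1) by (auto simp: cmod_def)
    ultimately show False using assms(2) by (simp add: complex_eq_iff)
  qed
  thus ?thesis using complex_Re_le_cmod[of z] assms(1) by simp
qed

section \<open>A global branch of the argument on the closed bidisc\<close>

context star_class
begin

definition dd_dom :: "(complex \<times> complex) set" where
  "dd_dom = {x. norm (fst x) \<le> 1 \<and> norm (snd x) \<le> 1 \<and> divdiff f (fst x) (snd x) \<noteq> 0}"

lemma divdiff_inside:
  assumes "norm z < 1" "norm w < 1" shows "divdiff f z w \<noteq> 0"
proof (cases "z = w")
  case True thus ?thesis using assms pderiv_f_nonzero by (simp add: divdiff_diag)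
next
  case False
  hence "poly f z \<noteq> poly f w" using f_inj assms by (auto simp: inj_on_def)
  thus ?thesis using divdiff[of z w f] by auto
qed

text \<open>A segment from the origin to a point of the closed bidisc meets the boundary at most in
  its end, and inside the bidisc the divided difference has no zero. Deleting boundary zeros
  therefore does not destroy star-shapedness.\<close>

lemma starlike_dd_dom: "starlike dd_dom"
  unfolding starlike_def
proof (intro bexI[of _ "(0, 0)"] ballI subsetI)
  show "(0, 0) \<in> dd_dom" using divdiff_inside[of 0 0] by (simp add: dd_dom_def)
  fix x y assume x: "x \<in> dd_dom" and y: "y \<in> closed_segment (0, 0) x"
  then obtain u where u: "0 \<le> u" "u \<le> 1" "y = u *\<^sub>R x" by (auto simp: closed_segment_def zero_prod_def[symmetric])
  show "y \<in> dd_dom"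
  proof (cases "u = 1")
    case True thus ?thesis using x u by simp
  next
    case False
    have "u * norm (fst x) < 1" "u * norm (snd x) < 1"
      using x u False mult_left_mono[of "norm (fst x)" 1 u] mult_left_mono[of "norm (snd x)" 1 u] by (auto simp: dd_dom_def)
    thus ?thesis using u divdiff_inside[of "fst y" "snd y"] by (simp add: dd_dom_def)
  qed
qed

lemma connected_dd_dom: "connected dd_dom"
  using starlike_dd_dom by (rule starlike_imp_connected)

text \<open>The choice is unique up to a constant in 2 pi i Z; only exponentials and differences of
  values are used.\<close>

definition dd_log :: "complex \<times> complex \<Rightarrow> complex" where
  "dd_log = (SOME G. continuous_on dd_dom G \<and> (\<forall>x\<in>dd_dom. divdiff f (fst x) (snd x) = exp (G x)))"

lemma dd_log: "continuous_on dd_dom dd_log" "x \<in> dd_dom \<Longrightarrow> exp (dd_log x) = divdiff f (fst x) (snd x)"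
proof -
  have cont: "continuous_on dd_dom (\<lambda>x. divdiff f (fst x) (snd x))" by (intro continuous_intros)
  have nz: "divdiff f (fst x) (snd x) \<noteq> 0" if "x \<in> dd_dom" for x using that by (simp add: dd_dom_def)
  have "\<exists>G. continuous_on dd_dom G \<and> (\<forall>x\<in>dd_dom. divdiff f (fst x) (snd x) = exp (G x))"
  proof (rule continuous_logarithm_on_contractible[OF cont starlike_imp_contractible[OF starlike_dd_dom]])
    fix G assume "continuous_on dd_dom G" "\<And>x. x \<in> dd_dom \<Longrightarrow> divdiff f (fst x) (snd x) = exp (G x)"
    thus ?thesis by blast
  qed (rule nz)
  from someI_ex[OF this] show "continuous_on dd_dom dd_log" "x \<in> dd_dom \<Longrightarrow> exp (dd_log x) = divdiff f (fst x) (snd x)"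
    unfolding dd_log_def[symmetric] by auto
qed

definition dd_arg :: "complex \<Rightarrow> complex \<Rightarrow> real" where "dd_arg z w = Im (dd_log (z, w))"

lemma continuous_on_dd_log [continuous_intros]:
  assumes "continuous_on S u" "continuous_on S v" "\<And>x. x \<in> S \<Longrightarrow> (u x, v x) \<in> dd_dom"
  shows "continuous_on S (\<lambda>x. dd_log (u x, v x))"
  using assms by (intro continuous_on_compose2[OF dd_log(1), of S "\<lambda>x. (u x, v x)"] continuous_intros) auto

lemma dd_dom_neq:
  assumes "norm z \<le> 1" "norm w \<le> 1" "poly f z \<noteq> poly f w" shows "(z, w) \<in> dd_dom"
  using assms divdiff[of z w f] by (auto simp: dd_dom_def)

lemma dd_dom_diag:
  assumes "norm z \<le> 1" "poly (pderiv f) z \<noteq> 0" shows "(z, z) \<in> dd_dom"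
  using assms by (auto simp: dd_dom_def divdiff_diag)

lemma dd_dom_sym: "(z, w) \<in> dd_dom \<Longrightarrow> (w, z) \<in> dd_dom"
  using divdiff_commute by (auto simp: dd_dom_def)

text \<open>Symmetry of the divided difference gives this modulo 2 pi; the difference of the two
  branches is constant and vanishes at the origin.\<close>

lemma dd_arg_commute:
  assumes "(z, w) \<in> dd_dom" shows "dd_arg z w = dd_arg w z"
proof -
  define h where "h = (\<lambda>x. dd_log (fst x, snd x) - dd_log (snd x, fst x))"
  have "(0, 0) \<in> dd_dom" using divdiff_inside[of 0 0] by (simp add: dd_dom_def)
  hence "h (z, w) = h (0, 0)"
  proof (rule constant_of_exp_constant[where h = h, OF connected_dd_dom, where c = 1, rotated -1])
    show "continuous_on dd_dom h" unfolding h_def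
      using dd_dom_sym by (intro continuous_intros) auto
    fix x assume x: "x \<in> dd_dom"
    hence x': "(fst x, snd x) \<in> dd_dom" "(snd x, fst x) \<in> dd_dom" using dd_dom_sym[of "fst x" "snd x"] by auto
    have "exp (dd_log (fst x, snd x)) = divdiff f (fst x) (snd x)" using dd_log(2)[OF x'(1)] by simp
    moreover have "exp (dd_log (snd x, fst x)) = divdiff f (fst x) (snd x)"
      using dd_log(2)[OF x'(2)] divdiff_commute[of f "fst x" "snd x"] by simp
    moreover have "divdiff f (fst x) (snd x) \<noteq> 0" using x by (simp add: dd_dom_def)
    ultimately show "exp (h x) = 1" by (simp add: h_def exp_diff)
  qed (rule assms)
  thus ?thesis by (simp add: dd_arg_def h_def)
qed

lemma exists_max_modulus_angle: "\<exists>\<theta>. \<forall>z. norm z \<le> 1 \<longrightarrow> norm (poly f z) \<le> norm (poly f (cis \<theta>))"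
proof -
  have "\<exists>x\<in>sphere 0 1. \<forall>y\<in>sphere 0 1. norm (poly f y) \<le> norm (poly f x)"
    by (intro continuous_attains_sup continuous_intros) auto
  then obtain x where x: "norm x = 1" "\<And>y. norm y = 1 \<Longrightarrow> norm (poly f y) \<le> norm (poly f x)" by auto
  have "norm (poly f z) \<le> norm (poly f x)" if "norm z \<le> 1" for z
  proof (rule maximum_modulus_frontier[of "poly f" "cball 0 1"])
    fix y assume "y \<in> frontier (cball 0 (1::real) :: complex set)"
    thus "norm (poly f y) \<le> norm (poly f x)" by (intro x(2)) simp
  qed (use that in \<open>auto intro!: holomorphic_intros continuous_intros\<close>)
  moreover obtain \<theta> where "cis \<theta> = x" using ex_angle[OF x(1)] by blast
  ultimately show ?thesis by auto
qed

end

text \<open>At a point of maximal modulus both \<open>1 - f(x) / f(\<zeta>0)\<close> and \<open>1 - x / \<zeta>0\<close> stay in the right half plane, which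
  makes the logarithm of the divided difference explicit there.\<close>

locale star_class_max = star_class +
  fixes \<theta>0 :: real
  assumes max_modulus: "\<And>z. norm z \<le> 1 \<Longrightarrow> norm (poly f z) \<le> norm (poly f (cis \<theta>0))"
begin

abbreviation "\<zeta>0 \<equiv> cis \<theta>0"

lemma f_base_nz: "poly f \<zeta>0 \<noteq> 0"
proof
  assume "poly f \<zeta>0 = 0"
  hence "poly f (1/2) = poly f 0" using max_modulus[of "1/2"] max_modulus[of 0] by (simp add: norm_divide)
  thus False using inj_onD[OF f_inj, of "1/2" 0] by (auto simp: dist_norm norm_divide)
qed

text \<open>In the coordinate \<zeta> exp s the real part of f / f(\<zeta>0) is at most 1 for Re s
  \<le> 0, with equality at s = 0. Its derivative along the axis is therefore 0, and its derivative
  to the right is not negative.\<close>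

lemma euler_at_max:
  assumes \<zeta>: "norm \<zeta> = 1" "poly f \<zeta> = poly f \<zeta>0"
  shows "Im (poly (euler_op f) \<zeta> / poly f \<zeta>0) = 0" "Re (poly (euler_op f) \<zeta> / poly f \<zeta>0) \<ge> 0"
proof -
  define c where "c = poly f \<zeta>0"
  have c: "c \<noteq> 0" using f_base_nz by (simp add: c_def)
  define F where "F = (\<lambda>s. poly f (\<zeta> * exp s) / c)"
  have dF: "(F has_field_derivative poly (euler_op f) (\<zeta> * exp s) / c) (at s)" for s
    unfolding F_def by (auto intro!: derivative_eq_intros simp: c poly_euler_op)
  have F0: "F 0 = 1" using \<zeta> c by (simp add: F_def c_def)
  have F1: "Re (F s) \<le> 1" if "Re s \<le> 0" for s
  proof -
    have "norm (\<zeta> * exp s) \<le> 1" using that \<zeta> by (simp add: norm_mult)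
    hence "norm (F s) \<le> 1" using max_modulus c by (simp add: F_def norm_divide c_def)
    thus ?thesis using complex_Re_le_cmod order_trans by blast
  qed
  have "((\<lambda>\<tau>. Re (F (0 + of_real \<tau> * \<i>))) has_real_derivative Re (poly (euler_op f) \<zeta> / c * \<i>)) (at 0)"
    using line_derivative(2)[where a = 0 and \<tau> = 0 and v = \<i>, OF dF] by simp
  hence "Re (poly (euler_op f) \<zeta> / c * \<i>) = 0"
    by (rule DERIV_local_max[where d = 1]) (use F0 F1 in auto)
  moreover have "Re (w * \<i>) = - Im w" for w by simp
  ultimately show "Im (poly (euler_op f) \<zeta> / poly f \<zeta>0) = 0" unfolding c_def by (metis neg_equal_0_iff_equal)
  have der: "((\<lambda>\<tau>. Re (F (0 + of_real \<tau> * 1))) has_real_derivative Re (poly (euler_op f) \<zeta> / c)) (at 0)"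
    using line_derivative(2)[where a = 0 and \<tau> = 0 and v = 1, OF dF] by simp
  have "\<not> Re (poly (euler_op f) \<zeta> / c) < 0"
  proof
    assume "Re (poly (euler_op f) \<zeta> / c) < 0"
    then obtain e where e: "e > 0" "\<forall>h>0. h < e \<longrightarrow> Re (F (0 + of_real 0 * 1)) < Re (F (0 + of_real (0 - h) * 1))"
      using DERIV_neg_dec_left[OF der] by blast
    hence "Re (F 0) < Re (F (- of_real (e / 2)))" using e(2)[rule_format, of "e / 2"] e(1) by simp
    thus False using F0 F1[of "- of_real (e / 2)"] e(1) by simp
  qed
  thus "Re (poly (euler_op f) \<zeta> / poly f \<zeta>0) \<ge> 0" by (simp add: c_def)
qed

text \<open>At two preimages both values of z f'(z) would point outward along f(\<zeta>0), whereas
  at a double point they are antiparallel and nonzero.\<close>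

lemma base_simple:
  assumes z: "norm z \<le> 1" "poly f z = poly f \<zeta>0"
  shows "z = \<zeta>0"
proof (rule ccontr)
  assume ne: "z \<noteq> \<zeta>0"
  have z1: "norm z = 1" using closed_disc_inj[of z \<zeta>0] z ne by force
  define a b where "a = poly (euler_op f) \<zeta>0 / poly f \<zeta>0" and "b = poly (euler_op f) z / poly f \<zeta>0"
  obtain c where c: "c > 0" "poly (euler_op f) z = - of_real c * poly (euler_op f) \<zeta>0"
    using double_pair(1)[of \<zeta>0 z] z1 z ne by auto
  have "poly (euler_op f) \<zeta>0 \<noteq> 0" using double_pair(2)[of \<zeta>0 z] z1 z ne by auto
  hence "a \<noteq> 0" using f_base_nz by (simp add: a_def)
  moreover have "Im a = 0" "Re a \<ge> 0" "Re b \<ge> 0"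
    using euler_at_max[of \<zeta>0] euler_at_max[of z] z z1 by (auto simp: a_def b_def)
  moreover have "Re b = - c * Re a" unfolding a_def b_def c(2) by (simp add: times_divide_eq_right[symmetric] del: times_divide_eq_right)
  ultimately show False using c(1) by (smt (verit) complex_eq_iff mult_pos_pos mult_minus_left zero_complex.simps)
qed

text \<open>With c = f(\<zeta>0) the divided difference is (c/\<zeta>0) (1 - f(z)/c) / (1 -
  z/\<zeta>0), a quotient of two right half plane quantities. For equal values of f the numerators
  cancel, and an exact difference remains, not one modulo 2 pi.\<close>

lemma dd_arg_base:
  assumes x: "norm x \<le> 1" "x \<noteq> \<zeta>0" and y: "norm y \<le> 1" "y \<noteq> \<zeta>0" and eq: "poly f x = poly f y"
  shows "dd_arg x \<zeta>0 - dd_arg y \<zeta>0 = Im (Ln (1 - y / \<zeta>0)) - Im (Ln (1 - x / \<zeta>0))"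
proof -
  define c where "c = poly f \<zeta>0"
  have c: "c \<noteq> 0" using f_base_nz by (simp add: c_def)
  define S where "S = cball 0 1 - {\<zeta>0}"
  define h where "h = (\<lambda>z. dd_log (z, \<zeta>0) - Ln (1 - poly f z / c) + Ln (1 - z / \<zeta>0))"
  have ne: "poly f z \<noteq> c" if "z \<in> S" for z using that base_simple[of z] by (auto simp: S_def c_def)
  have dom: "(z, \<zeta>0) \<in> dd_dom" if "z \<in> S" for z
    using that ne[OF that] by (intro dd_dom_neq) (auto simp: S_def c_def)
  have pos1: "Re (1 - z / \<zeta>0) > 0" if "z \<in> S" for z
    using that by (intro Re_one_minus_pos) (auto simp: S_def norm_divide)
  have pos2: "Re (1 - poly f z / c) > 0" if "z \<in> S" for z
    using that ne[OF that] c max_modulus[of z] by (intro Re_one_minus_pos) (auto simp: S_def norm_divide c_def)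
  have nonneg: "w \<notin> \<real>\<^sub>\<le>\<^sub>0" if "Re w > 0" for w using that by (auto simp: complex_nonpos_Reals_iff)
  have "starlike S" unfolding starlike_def
  proof (intro bexI[of _ 0] ballI subsetI)
    show "0 \<in> S" by (auto simp: S_def)
    fix x y assume x: "x \<in> S" and y: "y \<in> closed_segment 0 x"
    then obtain u where u: "0 \<le> u" "u \<le> 1" "y = u *\<^sub>R x" by (auto simp: closed_segment_def)
    show "y \<in> S"
    proof (cases "u = 1")
      case False
      have "norm y < 1" using x u False mult_left_mono[of "norm x" 1 u] by (auto simp: S_def)
      thus ?thesis by (auto simp: S_def)
    qed (use x u in simp)
  qed
  hence conn: "connected S" by (rule starlike_imp_connected)
  have "h x = h y"
  proof (rule constant_of_exp_constant[where h = h, OF conn, where c = "c / \<zeta>0"])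
    show "continuous_on S h" unfolding h_def
      using dom pos1 pos2 nonneg by (intro continuous_intros) (auto simp: c)
    fix z assume z: "z \<in> S"
    have nz: "1 - poly f z / c \<noteq> 0" "1 - z / \<zeta>0 \<noteq> 0" using pos1[OF z] pos2[OF z] by auto
    have "z - \<zeta>0 \<noteq> 0" using z by (auto simp: S_def)
    hence "divdiff f z \<zeta>0 = (poly f z - c) / (z - \<zeta>0)" using divdiff[of z \<zeta>0 f] by (simp add: c_def field_simps)
    also have "\<dots> = (c / \<zeta>0) * ((1 - poly f z / c) / (1 - z / \<zeta>0))"
      using c nz \<open>z - \<zeta>0 \<noteq> 0\<close> by (simp add: divide_simps) (simp add: algebra_simps)
    finally have "divdiff f z \<zeta>0 = (c / \<zeta>0) * ((1 - poly f z / c) / (1 - z / \<zeta>0))" .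
    thus "exp (h z) = c / \<zeta>0" using nz dom[OF z] by (simp add: h_def exp_add exp_diff dd_log)
  qed (use x y in \<open>auto simp: S_def\<close>)
  hence "Im (h x) = Im (h y)" by simp
  thus ?thesis by (simp add: h_def dd_arg_def eq)
qed

definition crit_angles :: "real set" where
  "crit_angles = {\<phi>. \<theta>0 \<le> \<phi> \<and> \<phi> < \<theta>0 + 2 * pi \<and> poly (pderiv f) (cis \<phi>) = 0}"

lemma bij_crit_angles: "bij_betw cis crit_angles crit_pts"
proof (rule bij_betwI')
  fix x y assume "x \<in> crit_angles" "y \<in> crit_angles"
  thus "cis x = cis y \<longleftrightarrow> x = y" using cis_eq_imp_eq[of x y] by (auto simp: crit_angles_def)
next
  fix x assume "x \<in> crit_angles" thus "cis x \<in> crit_pts" by (simp add: crit_angles_def crit_pts_def)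
next
  fix y assume "y \<in> crit_pts"
  hence "norm y = 1" "poly (pderiv f) y = 0" using norm_crit by (auto simp: crit_pts_def)
  thus "\<exists>x\<in>crit_angles. y = cis x" using ex_angle[of y \<theta>0] unfolding crit_angles_def by blast
qed

lemma finite_crit_angles: "finite crit_angles" and card_crit_angles: "card crit_angles = d - 1"
  using bij_crit_angles finite_crit_pts card_crit_pts bij_betw_finite bij_betw_same_card by metis+

text \<open>On the diagonal the argument is that of f', a sum over the \<open>d - 1\<close> factors
  1 - z/\<zeta>. Along the circle each summand grows at rate 1/2 and drops by pi when z passes
  \<zeta>.\<close>

lemma dd_arg_diag:
  assumes ab: "\<theta>0 \<le> a" "a < b" "b < \<theta>0 + 2 * pi" and nz: "poly (pderiv f) (cis a) \<noteq> 0" "poly (pderiv f) (cis b) \<noteq> 0"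
  shows "dd_arg (cis b) (cis b) - dd_arg (cis a) (cis a) = real (d - 1) * (b - a) / 2 - pi * card (crit_angles \<inter> {a<..<b})"
proof -
  define S where "S = {z. norm z \<le> 1 \<and> poly (pderiv f) z \<noteq> 0}"
  have dom: "(z, z) \<in> dd_dom" if "z \<in> S" for z using that dd_dom_diag by (auto simp: S_def)
  have pos: "Re (1 - z / \<zeta>) > 0" if "z \<in> S" "\<zeta> \<in> crit_pts" for z \<zeta>
  proof (rule Re_one_minus_pos)
    have "norm \<zeta> = 1" using that norm_crit by (auto simp: crit_pts_def)
    thus "norm (z / \<zeta>) \<le> 1" using that by (simp add: S_def norm_divide)
    show "z / \<zeta> \<noteq> 1" using that \<open>norm \<zeta> = 1\<close> by (auto simp: S_def crit_pts_def)
  qed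
  have "starlike S" unfolding starlike_def
  proof (intro bexI[of _ 0] ballI subsetI)
    show "0 \<in> S" using pderiv_f_nonzero[of 0] by (auto simp: S_def)
    fix x y assume x: "x \<in> S" and y: "y \<in> closed_segment 0 x"
    then obtain u where u: "0 \<le> u" "u \<le> 1" "y = u *\<^sub>R x" by (auto simp: closed_segment_def)
    show "y \<in> S"
    proof (cases "u = 1")
      case False
      have "norm y < 1" using x u False mult_left_mono[of "norm x" 1 u] by (auto simp: S_def)
      thus ?thesis using pderiv_f_nonzero[of y] by (auto simp: S_def)
    qed (use x u in simp)
  qed
  hence conn: "connected S" by (rule starlike_imp_connected)
  define h where "h = (\<lambda>z. dd_log (z, z) - (\<Sum>\<zeta>\<in>crit_pts. Ln (1 - z / \<zeta>)))"
  have "h (cis b) = h (cis a)"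
  proof (rule constant_of_exp_constant[where h = h, OF conn, where c = 1])
    have "continuous_on S (\<lambda>z. Ln (1 - z / \<zeta>))" if "\<zeta> \<in> crit_pts" for \<zeta>
    proof -
      have "\<zeta> \<noteq> 0" using \<open>\<zeta> \<in> crit_pts\<close> norm_crit[of \<zeta>] by (auto simp: crit_pts_def)
      moreover have "1 - x / \<zeta> \<notin> \<real>\<^sub>\<le>\<^sub>0" if "x \<in> S" for x
        using pos[OF that \<open>\<zeta> \<in> crit_pts\<close>] by (auto simp: complex_nonpos_Reals_iff)
      ultimately show ?thesis by (intro continuous_intros) auto
    qed
    hence "continuous_on S (\<lambda>z. \<Sum>\<zeta>\<in>crit_pts. Ln (1 - z / \<zeta>))" by (rule continuous_on_sum)
    moreover have "continuous_on S (\<lambda>z. dd_log (z, z))" using dom by (intro continuous_intros) auto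
    ultimately show "continuous_on S h" unfolding h_def by (rule continuous_on_diff[rotated])
    fix z assume z: "z \<in> S"
    have "exp (\<Sum>\<zeta>\<in>crit_pts. Ln (1 - z / \<zeta>)) = (\<Prod>\<zeta>\<in>crit_pts. exp (Ln (1 - z / \<zeta>)))" using finite_crit_pts by (rule exp_sum)
    also have "\<dots> = (\<Prod>\<zeta>\<in>crit_pts. 1 - z / \<zeta>)"
    proof (rule prod.cong)
      fix \<zeta> assume "\<zeta> \<in> crit_pts"
      hence "1 - z / \<zeta> \<noteq> 0" using pos[OF z] by fastforce
      thus "exp (Ln (1 - z / \<zeta>)) = 1 - z / \<zeta>" by (rule exp_Ln)
    qed simp
    finally have "exp (\<Sum>\<zeta>\<in>crit_pts. Ln (1 - z / \<zeta>)) = poly (pderiv f) z" by (simp add: poly_pderiv_f)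
    thus "exp (h z) = 1" using z dom[OF z] by (simp add: h_def exp_diff dd_log divdiff_diag S_def)
  qed (use nz in \<open>auto simp: S_def\<close>)
  hence "Im (h (cis b)) = Im (h (cis a))" by simp
  hence "dd_arg (cis b) (cis b) - dd_arg (cis a) (cis a) = (\<Sum>\<zeta>\<in>crit_pts. Im (Ln (1 - cis b / \<zeta>)) - Im (Ln (1 - cis a / \<zeta>)))"
    by (simp add: h_def dd_arg_def sum_subtractf)
  also have "\<dots> = (\<Sum>\<phi>\<in>crit_angles. Im (Ln (1 - cis b / cis \<phi>)) - Im (Ln (1 - cis a / cis \<phi>)))"
    by (rule sum.reindex_bij_betw[OF bij_crit_angles, symmetric])
  also have "\<dots> = (\<Sum>\<phi>\<in>crit_angles. (b - a) / 2 - (if \<phi> \<in> {a<..<b} then pi else 0))"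
  proof (rule sum.cong)
    fix \<phi> assume \<phi>: "\<phi> \<in> crit_angles"
    hence ne: "\<phi> \<noteq> a" "\<phi> \<noteq> b" using nz by (auto simp: crit_angles_def)
    have \<phi>': "\<theta>0 \<le> \<phi>" "\<phi> < \<theta>0 + 2 * pi" using \<phi> by (auto simp: crit_angles_def)
    \<comment> \<open>The two cases bring t - \<phi> into (0, 2 pi), where the half-angle formula
      holds.\<close>
    have val: "Im (Ln (1 - cis t / cis \<phi>)) = (if \<phi> < t then (t - \<phi> - pi) / 2 else (t - \<phi> + pi) / 2)"
      if t: "\<theta>0 \<le> t" "t < \<theta>0 + 2 * pi" "t \<noteq> \<phi>" for t
    proof (cases "\<phi> < t")
      case True
      thus ?thesis using Im_Ln_one_minus_cis[of "t - \<phi>"] t \<phi>' by (simp add: cis_divide)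
    next
      case False
      have "cis (t - \<phi>) = cis (t - \<phi> + 2 * pi)" by (subst cis_eq_iff) (auto intro!: exI[of _ "-1"])
      thus ?thesis using False Im_Ln_one_minus_cis[of "t - \<phi> + 2 * pi"] t \<phi>' by (simp add: cis_divide field_simps)
    qed
    show "Im (Ln (1 - cis b / cis \<phi>)) - Im (Ln (1 - cis a / cis \<phi>)) = (b - a) / 2 - (if \<phi> \<in> {a<..<b} then pi else 0)"
      using val[of a] val[of b] ab ne by (auto simp: field_simps)
  qed simp
  also have "\<dots> = real (d - 1) * (b - a) / 2 - pi * card (crit_angles \<inter> {a<..<b})"
    using finite_crit_angles
    by (simp only: sum_subtractf sum.inter_restrict[symmetric] sum_constant card_crit_angles) (simp add: mult.commute)
  finally show ?thesis .
qed

end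

section \<open>The argument near a double point\<close>

context star_class
begin

text \<open>At a double point the two boundary arcs lie in the two opposite half planes of their common
  tangent; hence differences of values near the two preimages avoid the other half plane, and their
  argument has a canonical branch.\<close>

lemma contact_half_plane:
  assumes \<theta>: "\<theta>1 < \<theta>2" "\<theta>2 < \<theta>1 + 2 * pi" and eq: "poly f (cis \<theta>1) = poly f (cis \<theta>2)"
  defines "v \<equiv> \<lambda>x y. (poly f (cis (\<theta>1 + x)) - poly f (cis (\<theta>2 + y))) / (\<i> * poly (euler_op f) (cis \<theta>1))"
  obtains \<epsilon> where "\<epsilon> > 0"
    "\<And>x y. \<bar>x\<bar> < \<epsilon> \<Longrightarrow> \<bar>y\<bar> < \<epsilon> \<Longrightarrow> (x, y) \<noteq> (0, 0) \<Longrightarrow> Im (v x y) > 0"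
    "\<And>e. 0 < e \<Longrightarrow> e < \<epsilon> \<Longrightarrow> Re (v 0 e) > 0 \<and> Re (v 0 (- e)) < 0 \<and> Re (v (- e) 0) < 0"
proof -
  define \<zeta>1 \<zeta>2 where "\<zeta>1 = cis \<theta>1" and "\<zeta>2 = cis \<theta>2"
  have ne: "\<zeta>1 \<noteq> \<zeta>2" using cis_eq_imp_eq[of \<theta>1 \<theta>2] \<theta> by (auto simp: \<zeta>1_def \<zeta>2_def)
  have n: "norm \<zeta>1 = 1" "norm \<zeta>2 = 1" by (auto simp: \<zeta>1_def \<zeta>2_def)
  define q where "q = poly (euler_op f) \<zeta>1"
  define w0 where "w0 = poly f \<zeta>1"
  have w0: "poly f \<zeta>1 = w0" "poly f \<zeta>2 = w0" using eq by (auto simp: w0_def \<zeta>1_def \<zeta>2_def)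
  obtain c where c: "c > 0" "poly (euler_op f) \<zeta>2 = - of_real c * q"
    using double_pair(1)[OF n ne] w0 by (auto simp: q_def)
  have q0: "q \<noteq> 0" using double_pair(2)[OF n ne] w0 by (auto simp: q_def)
  \<comment> \<open>The zero direction specialises the perturbation lemma to the curve of f
    itself.\<close>
  have sr0: "self_reciprocal d 0" by (simp add: self_reciprocal_def poly_euler_op)
  obtain e1 where e1: "e1 > 0" "\<And>z. norm (z - \<zeta>1) < e1 \<Longrightarrow> norm z \<le> 1 \<Longrightarrow> z \<noteq> \<zeta>1 \<Longrightarrow> Im ((poly f z - w0) / (\<i> * q)) > 0"
  proof (rule boundary_side[OF f_self_reciprocal sr0 n(1)])
    show "poly (euler_op f) \<zeta>1 \<noteq> 0" using q0 by (simp add: q_def)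
    fix e assume "e > 0" and *: "\<And>t z. \<bar>t\<bar> < e \<Longrightarrow> norm (z - \<zeta>1) < e \<Longrightarrow> norm z \<le> 1 \<Longrightarrow> z \<noteq> \<zeta>1 \<Longrightarrow>
       Im ((poly (f + smult (of_real t) 0) z - poly (f + smult (of_real t) 0) \<zeta>1) / (\<i> * poly (euler_op f) \<zeta>1)) > 0"
    show ?thesis by (rule that[of e]) (use \<open>e > 0\<close> *[of 0] in \<open>auto simp: q_def w0\<close>)
  qed
  obtain e2 where e2: "e2 > 0" "\<And>z. norm (z - \<zeta>2) < e2 \<Longrightarrow> norm z \<le> 1 \<Longrightarrow> z \<noteq> \<zeta>2 \<Longrightarrow> Im ((poly f z - w0) / (\<i> * q)) < 0"
  proof (rule boundary_side[OF f_self_reciprocal sr0 n(2)])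
    show "poly (euler_op f) \<zeta>2 \<noteq> 0" using q0 c by simp
    fix e assume "e > 0" and *: "\<And>t z. \<bar>t\<bar> < e \<Longrightarrow> norm (z - \<zeta>2) < e \<Longrightarrow> norm z \<le> 1 \<Longrightarrow> z \<noteq> \<zeta>2 \<Longrightarrow>
       Im ((poly (f + smult (of_real t) 0) z - poly (f + smult (of_real t) 0) \<zeta>2) / (\<i> * poly (euler_op f) \<zeta>2)) > 0"
    have "Im ((poly f z - w0) / (\<i> * q)) < 0" if "norm (z - \<zeta>2) < e" "norm z \<le> 1" "z \<noteq> \<zeta>2" for z
    proof -
      have "Im ((poly f z - w0) / (\<i> * poly (euler_op f) \<zeta>2)) > 0" using *[of 0 z] that \<open>e > 0\<close> w0 by simp
      moreover have "(poly f z - w0) / (\<i> * poly (euler_op f) \<zeta>2) = of_real (- 1 / c) * ((poly f z - w0) / (\<i> * q))"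
        using c q0 unfolding c(2) by (simp add: field_simps)
      moreover have "Im (of_real (- 1 / c) * X) = - Im X / c" for X by simp
      ultimately have "0 < - Im ((poly f z - w0) / (\<i> * q)) / c" by metis
      thus ?thesis using c(1) by (simp add: field_simps)
    qed
    thus ?thesis by (intro that[of e]) (use \<open>e > 0\<close> in auto)
  qed
  have v_split: "v x y = (poly f (cis (\<theta>1 + x)) - w0) / (\<i> * q) - (poly f (cis (\<theta>2 + y)) - w0) / (\<i> * q)" for x y
    by (simp add: v_def q_def \<zeta>1_def diff_divide_distrib)
  have side1: "Im ((poly f (cis (\<theta>1 + x)) - w0) / (\<i> * q)) > 0" if "\<bar>x\<bar> < min e1 (2 * pi)" "x \<noteq> 0" for x
  proof (rule e1(2))
    show "norm (cis (\<theta>1 + x) - \<zeta>1) < e1" using norm_cis_diff_le[of "\<theta>1 + x" \<theta>1] that by (simp add: \<zeta>1_def)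
    show "cis (\<theta>1 + x) \<noteq> \<zeta>1" using cis_eq_imp_eq[of "\<theta>1 + x" \<theta>1] that by (auto simp: \<zeta>1_def)
  qed simp
  have side2: "Im ((poly f (cis (\<theta>2 + x)) - w0) / (\<i> * q)) < 0" if "\<bar>x\<bar> < min e2 (2 * pi)" "x \<noteq> 0" for x
  proof (rule e2(2))
    show "norm (cis (\<theta>2 + x) - \<zeta>2) < e2" using norm_cis_diff_le[of "\<theta>2 + x" \<theta>2] that by (simp add: \<zeta>2_def)
    show "cis (\<theta>2 + x) \<noteq> \<zeta>2" using cis_eq_imp_eq[of "\<theta>2 + x" \<theta>2] that by (auto simp: \<zeta>2_def)
  qed simp
  have der: "((\<lambda>\<tau>. Re ((poly f (cis (\<theta> + \<tau>)) - w0) / (\<i> * q))) has_real_derivative Re (poly (euler_op f) (cis \<theta>) / q)) (at 0)" for \<theta>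
  proof -
    define F where "F = (\<lambda>s. (poly f (cis \<theta> * exp s) - w0) / (\<i> * q))"
    have dF: "(F has_field_derivative poly (euler_op f) (cis \<theta> * exp s) / (\<i> * q)) (at s)" for s
      unfolding F_def by (auto intro!: derivative_eq_intros simp: q0 poly_euler_op)
    have "((\<lambda>\<tau>. Re (F (0 + of_real \<tau> * \<i>))) has_real_derivative Re (poly (euler_op f) (cis \<theta>) / (\<i> * q) * \<i>)) (at 0)"
      using line_derivative(2)[where a = 0 and \<tau> = 0 and v = \<i>, OF dF] by simp
    moreover have "poly (euler_op f) (cis \<theta>) / (\<i> * q) * \<i> = poly (euler_op f) (cis \<theta>) / q" by simp
    moreover have "F (0 + of_real \<tau> * \<i>) = (poly f (cis (\<theta> + \<tau>)) - w0) / (\<i> * q)" for \<tau>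
      by (simp add: F_def cis_conv_exp distrib_left exp_add mult.commute)
    ultimately show ?thesis by simp
  qed
  have "((\<lambda>\<tau>. Re ((poly f (cis (\<theta>1 + \<tau>)) - w0) / (\<i> * q))) has_real_derivative 1) (at 0)"
    using der[of \<theta>1] q0 by (simp add: q_def \<zeta>1_def)
  from DERIV_pos_inc_left[OF this] obtain d1 where d1: "d1 > 0" "\<And>h. 0 < h \<Longrightarrow> h < d1 \<Longrightarrow> Re ((poly f (cis (\<theta>1 - h)) - w0) / (\<i> * q)) < 0"
    using w0 by (auto simp: \<zeta>1_def)
  have der2: "((\<lambda>\<tau>. Re ((poly f (cis (\<theta>2 + \<tau>)) - w0) / (\<i> * q))) has_real_derivative - c) (at 0)"
    using der[of \<theta>2] c q0 by (simp add: \<zeta>2_def)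
  from DERIV_neg_dec_left[OF this] obtain d2 where d2: "d2 > 0" "\<And>h. 0 < h \<Longrightarrow> h < d2 \<Longrightarrow> Re ((poly f (cis (\<theta>2 - h)) - w0) / (\<i> * q)) > 0"
    using w0 c by (auto simp: \<zeta>2_def)
  from DERIV_neg_dec_right[OF der2] obtain d3 where d3: "d3 > 0" "\<And>h. 0 < h \<Longrightarrow> h < d3 \<Longrightarrow> Re ((poly f (cis (\<theta>2 + h)) - w0) / (\<i> * q)) < 0"
    using w0 c by (auto simp: \<zeta>2_def)
  define \<epsilon> where "\<epsilon> = Min {e1, e2, d1, d2, d3, 1}"
  have \<epsilon>: "\<epsilon> > 0" "\<epsilon> \<le> e1" "\<epsilon> \<le> e2" "\<epsilon> \<le> d1" "\<epsilon> \<le> d2" "\<epsilon> \<le> d3" "\<epsilon> \<le> 1"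
    using e1(1) e2(1) d1(1) d2(1) d3(1) by (auto simp: \<epsilon>_def)
  have pi1: "1 < 2 * pi" using pi_gt3 by linarith
  have v0: "v 0 y = - ((poly f (cis (\<theta>2 + y)) - w0) / (\<i> * q))" "v x 0 = (poly f (cis (\<theta>1 + x)) - w0) / (\<i> * q)" for x y
    using w0 by (simp_all add: v_split \<zeta>1_def \<zeta>2_def)
  show ?thesis
  proof (rule that[of \<epsilon>])
    fix x y :: real assume xy: "\<bar>x\<bar> < \<epsilon>" "\<bar>y\<bar> < \<epsilon>" "(x, y) \<noteq> (0, 0)"
    have 1: "Im ((poly f (cis (\<theta>1 + x)) - w0) / (\<i> * q)) > 0 \<or> x = 0" using side1[of x] xy \<epsilon> pi1 by (cases "x = 0") auto
    have 2: "Im ((poly f (cis (\<theta>2 + y)) - w0) / (\<i> * q)) < 0 \<or> y = 0" using side2[of y] xy \<epsilon> pi1 by (cases "y = 0") auto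
    show "Im (v x y) > 0"
    proof (cases "x = 0 \<or> y = 0")
      case True thus ?thesis using 1 2 xy(3) by (auto simp: v0)
    next
      case False thus ?thesis using 1 2 unfolding v_split by (simp only: minus_complex.sel) linarith
    qed
  next
    fix e :: real assume e: "0 < e" "e < \<epsilon>"
    show "Re (v 0 e) > 0 \<and> Re (v 0 (- e)) < 0 \<and> Re (v (- e) 0) < 0"
      using d1(2)[of e] d2(2)[of e] d3(2)[of e] e \<epsilon> by (simp only: v0 uminus_complex.sel) auto
  qed (use \<epsilon> in auto)
qed

text \<open>Near a contact the divided difference is \<open>v\<close>, which stays in the upper half
  plane, divided by cis((x + y)/2) and constant or real factors of fixed sign. So differences of
  \<open>dd_arg\<close> are differences of the principal argument of \<open>v\<close>, corrected by
  (x + y)/2; between the points used this correction is \<open>e\<close>. The principal argument is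
  below pi/2 at (0, e) and above pi/2 at (0, -e) and (-e, 0).\<close>

lemma contact_log_constant:
  assumes \<theta>: "\<theta>1 < \<theta>2" "\<theta>2 < \<theta>1 + 2 * pi" and eq: "poly f (cis \<theta>1) = poly f (cis \<theta>2)"
  obtains \<epsilon> where "\<epsilon> > 0" "\<epsilon> < \<theta>2 - \<theta>1" "\<epsilon> < \<theta>1 + 2 * pi - \<theta>2"
    "\<And>e. 0 < e \<Longrightarrow> e < \<epsilon> \<Longrightarrow> 0 < dd_arg (cis \<theta>1) (cis (\<theta>2 - e)) - dd_arg (cis \<theta>1) (cis (\<theta>2 + e)) - e \<and>
        dd_arg (cis \<theta>1) (cis (\<theta>2 - e)) - dd_arg (cis \<theta>1) (cis (\<theta>2 + e)) - e < pi"
    "\<And>e. 0 < e \<Longrightarrow> e < \<epsilon> \<Longrightarrow> 0 < dd_arg (cis (\<theta>1 - e)) (cis \<theta>2) - dd_arg (cis \<theta>1) (cis (\<theta>2 + e)) - e \<and>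
        dd_arg (cis (\<theta>1 - e)) (cis \<theta>2) - dd_arg (cis \<theta>1) (cis (\<theta>2 + e)) - e < pi"
proof -
  define v where "v = (\<lambda>x y. (poly f (cis (\<theta>1 + x)) - poly f (cis (\<theta>2 + y))) / (\<i> * poly (euler_op f) (cis \<theta>1)))"
  obtain \<epsilon>1 where \<epsilon>1: "\<epsilon>1 > 0" "\<And>x y. \<bar>x\<bar> < \<epsilon>1 \<Longrightarrow> \<bar>y\<bar> < \<epsilon>1 \<Longrightarrow> (x, y) \<noteq> (0, 0) \<Longrightarrow> Im (v x y) > 0"
    "\<And>e. 0 < e \<Longrightarrow> e < \<epsilon>1 \<Longrightarrow> Re (v 0 e) > 0 \<and> Re (v 0 (- e)) < 0 \<and> Re (v (- e) 0) < 0"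
    using contact_half_plane[OF assms] unfolding v_def by blast
  define q where "q = poly (euler_op f) (cis \<theta>1)"
  have q0: "q \<noteq> 0"
    unfolding q_def by (rule double_pair(2)[of _ "cis \<theta>2"]) (use cis_eq_imp_eq[of \<theta>1 \<theta>2] \<theta> eq in auto)
  define \<epsilon> where "\<epsilon> = Min {\<epsilon>1, (\<theta>2 - \<theta>1) / 2, (\<theta>1 + 2 * pi - \<theta>2) / 2}"
  have \<epsilon>: "\<epsilon> > 0" "\<epsilon> \<le> \<epsilon>1" "\<epsilon> \<le> (\<theta>2 - \<theta>1) / 2" "\<epsilon> \<le> (\<theta>1 + 2 * pi - \<theta>2) / 2"
    using \<epsilon>1(1) \<theta> by (auto simp: \<epsilon>_def min_def)
  \<comment> \<open>The contact itself, where the divided difference vanishes, is removed; a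
    punctured disc in the plane is still connected, so one branch serves on both sides.\<close>
  define S where "S = ball (0 :: real \<times> real) \<epsilon> - {0}"
  have "connected S" unfolding S_def
  proof (rule connected_punctured_convex)
    have "aff_dim (ball (0 :: real \<times> real) \<epsilon>) = 2" using \<epsilon>(1) by (subst aff_dim_open) auto
    thus "aff_dim (ball (0 :: real \<times> real) \<epsilon>) \<noteq> 1" by simp
  qed simp
  have S: "\<bar>fst p\<bar> < \<epsilon>" "\<bar>snd p\<bar> < \<epsilon>" "(fst p, snd p) \<noteq> (0, 0)" if "p \<in> S" for p

  proof -
    have "norm p < \<epsilon>" "p \<noteq> 0" using that by (auto simp: S_def)
    thus "\<bar>fst p\<bar> < \<epsilon>" "\<bar>snd p\<bar> < \<epsilon>" "(fst p, snd p) \<noteq> (0, 0)"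
      using norm_fst_le[of "fst p" "snd p"] norm_snd_le[of "snd p" "fst p"] by (auto simp: zero_prod_def)
  qed
  have Imv: "Im (v (fst p) (snd p)) > 0" if "p \<in> S" for p
    using S[OF that] \<epsilon> by (intro \<epsilon>1(2)) auto
  have sinneg: "sin ((\<theta>1 + fst p - (\<theta>2 + snd p)) / 2) < 0" if "p \<in> S" for p
  proof -
    have "sin (- ((\<theta>1 + fst p - (\<theta>2 + snd p)) / 2)) > 0"
      using S[OF that] \<epsilon> by (intro sin_gt_zero) (auto simp: field_simps)
    thus ?thesis by simp
  qed
  have dom: "(cis (\<theta>1 + fst p), cis (\<theta>2 + snd p)) \<in> dd_dom" if "p \<in> S" for p
    using Imv[OF that] by (intro dd_dom_neq) (auto simp: v_def)
  define h where "h = (\<lambda>p. dd_log (cis (\<theta>1 + fst p), cis (\<theta>2 + snd p)) + \<i> * of_real ((fst p + snd p) / 2)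
      - Ln (v (fst p) (snd p)) + of_real (ln (- sin ((\<theta>1 + fst p - (\<theta>2 + snd p)) / 2))))"
  have hconst: "h p = h p'" if "p \<in> S" "p' \<in> S" for p p'
  proof (rule constant_of_exp_constant[where h = h, OF \<open>connected S\<close>, where c = "- q / 2 * cis (- ((\<theta>1 + \<theta>2) / 2))"])
    have "v (fst p) (snd p) \<notin> \<real>\<^sub>\<le>\<^sub>0" if "p \<in> S" for p using Imv[OF that] by (auto simp: complex_nonpos_Reals_iff)
    moreover have "continuous_on S (\<lambda>p. v (fst p) (snd p))"
      unfolding v_def using q0 by (intro continuous_intros) (auto simp: q_def)
    ultimately show "continuous_on S h" unfolding h_def using dom sinneg
      by (intro continuous_intros) (auto simp: less_imp_neq)
    fix p assume p: "p \<in> S"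
    define x y where "x = fst p" and "y = snd p"
    define s where "s = sin ((\<theta>1 + x - (\<theta>2 + y)) / 2)"
    have s: "s < 0" using sinneg[OF p] by (simp add: s_def x_def y_def)
    have v0: "v x y \<noteq> 0" using Imv[OF p] by (auto simp: x_def y_def)
    have "(cis (\<theta>1 + x) - cis (\<theta>2 + y)) * divdiff f (cis (\<theta>1 + x)) (cis (\<theta>2 + y)) = \<i> * q * v x y"
      unfolding divdiff using q0 by (simp add: v_def q_def)
    moreover have "cis (\<theta>1 + x) - cis (\<theta>2 + y) = cis ((\<theta>1 + \<theta>2) / 2) * cis ((x + y) / 2) * (2 * \<i> * of_real s)"
      unfolding cis_diff_factor s_def by (simp add: cis_mult add_divide_distrib algebra_simps)
    ultimately have *: "cis ((\<theta>1 + \<theta>2) / 2) * cis ((x + y) / 2) * (2 * of_real s) * divdiff f (cis (\<theta>1 + x)) (cis (\<theta>2 + y)) = q * v x y"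
      by (simp add: algebra_simps)
    have "exp (h p) = divdiff f (cis (\<theta>1 + x)) (cis (\<theta>2 + y)) * cis ((x + y) / 2) / v x y * of_real (- s)"
    proof -
      have "exp (of_real (ln (- s)) :: complex) = of_real (- s)" using s by (simp add: exp_of_real)
      moreover have "exp (\<i> * of_real ((x + y) / 2)) = cis ((x + y) / 2)" by (simp only: cis_conv_exp)
      moreover have "exp (dd_log (cis (\<theta>1 + x), cis (\<theta>2 + y))) = divdiff f (cis (\<theta>1 + x)) (cis (\<theta>2 + y))"
        using dd_log(2)[OF dom[OF p]] by (simp add: x_def y_def)
      ultimately show ?thesis using v0 unfolding h_def x_def[symmetric] y_def[symmetric] s_def[symmetric]
        by (simp only: exp_add exp_diff exp_Ln not_False_eq_True)
    qed
    also have "\<dots> = - (cis (- ((\<theta>1 + \<theta>2) / 2)) * (cis ((\<theta>1 + \<theta>2) / 2) * cis ((x + y) / 2) * (2 * of_real s) * divdiff f (cis (\<theta>1 + x)) (cis (\<theta>2 + y)))) / (2 * v x y)"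
      using v0 by (simp add: mult.assoc[symmetric] cis_mult)
    also have "\<dots> = - q / 2 * cis (- ((\<theta>1 + \<theta>2) / 2))" unfolding * using v0 by simp
    finally show "exp (h p) = - q / 2 * cis (- ((\<theta>1 + \<theta>2) / 2))" .
  qed (use that in auto)
  have Im_h: "Im (h p) = dd_arg (cis (\<theta>1 + fst p)) (cis (\<theta>2 + snd p)) + (fst p + snd p) / 2 - Im (Ln (v (fst p) (snd p)))" for p
    by (simp add: h_def dd_arg_def)
  have arg1: "0 < Im (Ln w)" "Im (Ln w) < pi / 2" if "Im w > 0" "Re w > 0" for w
    using Im_Ln_pos_lt_imp[OF that(1)] Re_Ln_pos_lt_imp[OF that(2)] by auto
  have arg2: "Im (Ln w) > pi / 2" "Im (Ln w) < pi" if "Im w > 0" "Re w < 0" for w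
  proof -
    have "w \<noteq> 0" using that by auto
    thus "Im (Ln w) > pi / 2" "Im (Ln w) < pi" using Im_Ln_pos_lt_imp[OF that(1)] Re_Ln_pos_le[of w] that(2) by auto
  qed
  show ?thesis
  proof (rule that[of \<epsilon>])
    fix e assume e: "0 < e" "e < \<epsilon>"
    have in_S: "(0, e) \<in> S" "(0, - e) \<in> S" "(- e, 0) \<in> S" using e by (auto simp: S_def zero_prod_def dist_Pair_Pair)
    have re: "Re (v 0 e) > 0" "Re (v 0 (- e)) < 0" "Re (v (- e) 0) < 0" using \<epsilon>1(3)[of e] e \<epsilon> by auto
    have im: "Im (v 0 e) > 0" "Im (v 0 (- e)) > 0" "Im (v (- e) 0) > 0" using in_S[THEN Imv] by auto
    note L = arg1[OF im(1) re(1)] arg2[OF im(2) re(2)] arg2[OF im(3) re(3)]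
    have "Im (h (0, - e)) = Im (h (0, e))" "Im (h (- e, 0)) = Im (h (0, e))" using hconst in_S by metis+
    hence h: "dd_arg (cis \<theta>1) (cis (\<theta>2 - e)) - dd_arg (cis \<theta>1) (cis (\<theta>2 + e)) - e = Im (Ln (v 0 (- e))) - Im (Ln (v 0 e))"
       "dd_arg (cis (\<theta>1 - e)) (cis \<theta>2) - dd_arg (cis \<theta>1) (cis (\<theta>2 + e)) - e = Im (Ln (v (- e) 0)) - Im (Ln (v 0 e))"
      unfolding Im_h by (simp_all add: field_simps)
    show "0 < dd_arg (cis \<theta>1) (cis (\<theta>2 - e)) - dd_arg (cis \<theta>1) (cis (\<theta>2 + e)) - e \<and>
        dd_arg (cis \<theta>1) (cis (\<theta>2 - e)) - dd_arg (cis \<theta>1) (cis (\<theta>2 + e)) - e < pi"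
      using L unfolding h by linarith
    show "0 < dd_arg (cis (\<theta>1 - e)) (cis \<theta>2) - dd_arg (cis \<theta>1) (cis (\<theta>2 + e)) - e \<and>
        dd_arg (cis (\<theta>1 - e)) (cis \<theta>2) - dd_arg (cis \<theta>1) (cis (\<theta>2 + e)) - e < pi"
      using L unfolding h by linarith
  qed (use \<epsilon> \<theta> in auto)
qed

lemma dd_arg_continuous_diag:
  assumes "norm \<zeta> = 1" "poly (pderiv f) \<zeta> \<noteq> 0" "\<eta> > 0"
  obtains \<delta> where "\<delta> > 0" "\<And>z w. (z, w) \<in> dd_dom \<Longrightarrow> norm (z - \<zeta>) + norm (w - \<zeta>) < \<delta> \<Longrightarrow> \<bar>dd_arg z w - dd_arg \<zeta> \<zeta>\<bar> < \<eta>"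
proof -
  have dom: "(\<zeta>, \<zeta>) \<in> dd_dom" using assms dd_dom_diag by simp
  obtain \<delta> where \<delta>: "\<delta> > 0" "\<And>x. x \<in> dd_dom \<Longrightarrow> dist x (\<zeta>, \<zeta>) < \<delta> \<Longrightarrow> dist (dd_log x) (dd_log (\<zeta>, \<zeta>)) < \<eta>"
    using dd_log(1) dom assms(3) unfolding continuous_on_iff by metis
  show ?thesis
  proof (rule that[OF \<delta>(1)])
    fix z w assume *: "(z, w) \<in> dd_dom" "norm (z - \<zeta>) + norm (w - \<zeta>) < \<delta>"
    have "dist (z, w) (\<zeta>, \<zeta>) \<le> norm (z - \<zeta>) + norm (w - \<zeta>)"
      by (simp add: dist_norm norm_Pair sqrt_sum_squares_le_sum)
    hence "norm (dd_log (z, w) - dd_log (\<zeta>, \<zeta>)) < \<eta>" using \<delta>(2)[OF *(1)] * by (simp add: dist_norm)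
    thus "\<bar>dd_arg z w - dd_arg \<zeta> \<zeta>\<bar> < \<eta>" using abs_Im_le_cmod[of "dd_log (z, w) - dd_log (\<zeta>, \<zeta>)"] by (simp add: dd_arg_def)
  qed
qed

end

subsection \<open>Bounding the number of double points\<close>

context star_class
begin

text \<open>By the inscribed angle theorem the argument of \<open>(\<zeta>2 - z) / (\<zeta>1 - z)\<close> is constant modulo \<open>\<pi>\<close> for \<open>z\<close> on the circle.\<close>

lemma contact_branch:
  assumes \<theta>: "\<theta>1 < \<theta>2" "\<theta>2 < \<theta>1 + 2 * pi" and eq: "poly f (cis \<theta>1) = poly f (cis \<theta>2)"
    and \<sigma>: "\<sigma> = 1 \<or> \<sigma> = - (1::real)"
    and sgn: "\<And>s. a < s \<Longrightarrow> s < b \<Longrightarrow> \<sigma> * (sin ((s - \<theta>2) / 2) * sin ((s - \<theta>1) / 2)) > 0"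
    and s: "a < s" "s < b"
  defines "B \<equiv> \<lambda>s. dd_arg (cis \<theta>1) (cis s) - dd_arg (cis \<theta>2) (cis s)"
  shows "cis (B s) = of_real \<sigma> * cis ((\<theta>2 - \<theta>1) / 2)"
    and "a < s' \<Longrightarrow> s' < b \<Longrightarrow> B s = B s'"
proof -
  define S where "S = {a<..<b}"
  have ne: "cis t \<noteq> cis \<theta>1" "cis t \<noteq> cis \<theta>2" if "t \<in> S" for t
  proof -
    have "sin ((t - \<theta>2) / 2) \<noteq> 0" "sin ((t - \<theta>1) / 2) \<noteq> 0" using sgn[of t] that by (auto simp: S_def)
    thus "cis t \<noteq> cis \<theta>1" "cis t \<noteq> cis \<theta>2" using cis_diff_factor[of t \<theta>1] cis_diff_factor[of t \<theta>2] by auto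
  qed
  have ne12: "cis \<theta>1 \<noteq> cis \<theta>2" using cis_eq_imp_eq[of \<theta>1 \<theta>2] \<theta> by auto
  have fne: "poly f (cis \<theta>1) \<noteq> poly f (cis t)" if "t \<in> S" for t
    using no_triple[of "cis \<theta>1" "cis \<theta>2" "cis t"] ne[OF that] ne12 eq by auto
  have dom: "(cis \<theta>1, cis t) \<in> dd_dom" "(cis \<theta>2, cis t) \<in> dd_dom" if "t \<in> S" for t
    using fne[OF that] eq by (auto intro!: dd_dom_neq)
  have rat: "\<sigma> * (sin ((t - \<theta>2) / 2) / sin ((t - \<theta>1) / 2)) > 0" if "t \<in> S" for t
  proof -
    have "\<sigma> * (sin ((t - \<theta>2) / 2) * sin ((t - \<theta>1) / 2)) > 0" using sgn[of t] that by (auto simp: S_def)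
    thus ?thesis by (auto simp: zero_less_mult_iff zero_less_divide_iff mult_less_0_iff divide_less_0_iff)
  qed
  have sne: "sin ((t - \<theta>1) / 2) \<noteq> 0" "sin ((t - \<theta>2) / 2) \<noteq> 0" if "t \<in> S" for t using rat[OF that] by auto
  \<comment> \<open>Since f agrees at the two contact points, the quotient of the divided
    differences is (cis \<theta>2 - cis t)/(cis \<theta>1 - cis t), a fixed unimodular number times
    a real quotient of sines of sign \<sigma>. Subtracting the logarithm of its modulus makes
    \<open>exp (h t)\<close> constant.\<close>
  define h where "h = (\<lambda>t. dd_log (cis \<theta>1, cis t) - dd_log (cis \<theta>2, cis t) - of_real (ln (\<sigma> * (sin ((t - \<theta>2) / 2) / sin ((t - \<theta>1) / 2)))))"
  have exph: "exp (h t) = of_real \<sigma> * cis ((\<theta>2 - \<theta>1) / 2)" if t: "t \<in> S" for t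
  proof -
    define s1 s2 where "s1 = sin ((t - \<theta>1) / 2)" and "s2 = sin ((t - \<theta>2) / 2)"
    have s12: "s1 \<noteq> 0" "s2 \<noteq> 0" "\<sigma> * (s2 / s1) > 0" using sne[OF t] rat[OF t] by (auto simp: s1_def s2_def)
    define D1 D2 where "D1 = divdiff f (cis \<theta>1) (cis t)" and "D2 = divdiff f (cis \<theta>2) (cis t)"
    have D: "D1 \<noteq> 0" "D2 \<noteq> 0" using dom[OF t] by (auto simp: dd_dom_def D1_def D2_def)
    have "(cis \<theta>1 - cis t) * D1 = (cis \<theta>2 - cis t) * D2" unfolding D1_def D2_def divdiff eq ..
    moreover have "cis \<theta>1 - cis t = - (cis ((\<theta>1 + t) / 2) * (2 * \<i> * of_real s1))"
    proof -
      have "sin ((\<theta>1 - t) / 2) = - s1" unfolding s1_def by (metis minus_diff_eq minus_divide_left sin_minus)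
      thus ?thesis unfolding cis_diff_factor by simp
    qed
    moreover have "cis \<theta>2 - cis t = - (cis ((\<theta>1 + t) / 2) * cis ((\<theta>2 - \<theta>1) / 2) * (2 * \<i> * of_real s2))"
    proof -
      have "sin ((\<theta>2 - t) / 2) = - s2" unfolding s2_def by (metis minus_diff_eq minus_divide_left sin_minus)
      moreover have "cis ((\<theta>2 + t) / 2) = cis ((\<theta>1 + t) / 2) * cis ((\<theta>2 - \<theta>1) / 2)"
        unfolding cis_mult by (rule arg_cong[where f = cis]) (simp add: field_simps)
      ultimately show ?thesis unfolding cis_diff_factor by simp
    qed
    ultimately have "of_real s1 * D1 = cis ((\<theta>2 - \<theta>1) / 2) * of_real s2 * D2" by simp
    hence "D1 / D2 = cis ((\<theta>2 - \<theta>1) / 2) * of_real (s2 / s1)" using D s12 by (simp add: field_simps)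
    moreover have "exp (h t) = D1 / D2 / of_real (\<sigma> * (s2 / s1))"
    proof -
      have "exp (dd_log (cis \<theta>1, cis t)) = D1" "exp (dd_log (cis \<theta>2, cis t)) = D2"
        using dd_log(2)[OF dom(1)[OF t]] dd_log(2)[OF dom(2)[OF t]] by (simp_all add: D1_def D2_def)
      moreover have "exp (of_real (ln (\<sigma> * (s2 / s1))) :: complex) = of_real (\<sigma> * (s2 / s1))"
        using s12(3) by (simp only: exp_of_real exp_ln)
      ultimately show ?thesis unfolding h_def s1_def[symmetric] s2_def[symmetric] by (simp only: exp_diff)
    qed
    ultimately show ?thesis using s12 \<sigma> by (auto simp: field_simps)
  qed
  have Imh: "Im (h t) = B t" for t by (simp add: h_def B_def dd_arg_def)
  have "norm (exp (h s)) = 1" using exph[of s] s \<sigma> by (auto simp: S_def norm_mult)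
  hence "exp (Re (h s)) = 1" by (simp only: norm_exp_eq_Re)
  hence "exp (h s) = cis (Im (h s))" by (subst exp_eq_polar) simp
  thus "cis (B s) = of_real \<sigma> * cis ((\<theta>2 - \<theta>1) / 2)" using exph[of s] s by (simp add: Imh S_def)
  assume s': "a < s'" "s' < b"
  have "h s = h s'"
  proof (rule constant_of_exp_constant[where h = h and S = S])
    show "connected S" by (simp add: S_def)
    have "\<sigma> \<noteq> 0" using \<sigma> by auto
    thus "continuous_on S h" unfolding h_def using dom sne
      by (intro continuous_intros) auto
    show "exp (h t) = of_real \<sigma> * cis ((\<theta>2 - \<theta>1) / 2)" if "t \<in> S" for t using exph[OF that] .
  qed (use s s' in \<open>auto simp: S_def\<close>)
  hence "Im (h s) = Im (h s')" by simp
  thus "B s = B s'" by (simp add: Imh)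
qed

end

section \<open>Exact argument increments and cusp counts for contact pairs\<close>

context star_class_max
begin

context
  fixes \<theta>1 \<theta>2 :: real
  assumes order: "\<theta>0 < \<theta>1" "\<theta>1 < \<theta>2" "\<theta>2 < \<theta>0 + 2 * pi"
    and contact: "poly f (cis \<theta>1) = poly f (cis \<theta>2)"
begin

text \<open>The difference is constant on the outer arc, and this arc contains the base point, where
  its exact value is known.\<close>

lemma dd_arg_outer:
  assumes "\<theta>2 < s" "s < \<theta>1 + 2 * pi"
  shows "dd_arg (cis \<theta>1) (cis s) - dd_arg (cis \<theta>2) (cis s) = (\<theta>2 - \<theta>1) / 2"
proof -
  define s0 where "s0 = \<theta>0 + 2 * pi"
  have s0: "\<theta>2 < s0" "s0 < \<theta>1 + 2 * pi" using order by (auto simp: s0_def)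
  have cis0: "cis s0 = \<zeta>0" unfolding s0_def by (subst cis_eq_iff) (auto intro!: exI[of _ 1])
  have "dd_arg (cis \<theta>1) (cis s) - dd_arg (cis \<theta>2) (cis s) = dd_arg (cis \<theta>1) (cis s0) - dd_arg (cis \<theta>2) (cis s0)"
  proof (rule contact_branch(2)[where \<sigma> = 1 and a = \<theta>2 and b = "\<theta>1 + 2 * pi"])
    fix t assume "\<theta>2 < t" "t < \<theta>1 + 2 * pi"
    hence "sin ((t - \<theta>2) / 2) > 0" "sin ((t - \<theta>1) / 2) > 0" using order by (auto intro!: sin_gt_zero)
    thus "1 * (sin ((t - \<theta>2) / 2) * sin ((t - \<theta>1) / 2)) > 0" by simp
  qed (use order contact assms s0 in auto)
  also have "\<dots> = Im (Ln (1 - cis \<theta>2 / \<zeta>0)) - Im (Ln (1 - cis \<theta>1 / \<zeta>0))"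
    unfolding cis0 using order contact cis_eq_imp_eq[of \<theta>1 \<theta>0] cis_eq_imp_eq[of \<theta>2 \<theta>0]
    by (intro dd_arg_base) auto
  also have "\<dots> = (\<theta>2 - \<theta>1) / 2"
    using Im_Ln_one_minus_cis[of "\<theta>2 - \<theta>0"] Im_Ln_one_minus_cis[of "\<theta>1 - \<theta>0"] order
    by (simp add: cis_divide field_simps)
  finally show ?thesis .
qed

lemma contact_values_differ:
  assumes "cis s \<noteq> cis \<theta>1" "cis s \<noteq> cis \<theta>2"
  shows "(cis \<theta>1, cis s) \<in> dd_dom" "(cis \<theta>2, cis s) \<in> dd_dom"
proof -
  have "cis \<theta>1 \<noteq> cis \<theta>2" using cis_eq_imp_eq[of \<theta>1 \<theta>2] order by auto
  hence "poly f (cis \<theta>1) \<noteq> poly f (cis s)"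
    using no_triple[of "cis \<theta>1" "cis \<theta>2" "cis s"] contact assms by auto
  thus "(cis \<theta>1, cis s) \<in> dd_dom" "(cis \<theta>2, cis s) \<in> dd_dom" using contact by (auto intro!: dd_dom_neq)
qed

lemma contact_regular: "poly (pderiv f) (cis \<theta>1) \<noteq> 0" "poly (pderiv f) (cis \<theta>2) \<noteq> 0"
proof -
  have ne: "cis \<theta>1 \<noteq> cis \<theta>2" using cis_eq_imp_eq[of \<theta>1 \<theta>2] order by auto
  show "poly (pderiv f) (cis \<theta>1) \<noteq> 0" using double_pair(2)[of "cis \<theta>1" "cis \<theta>2"] ne contact by (auto simp: poly_euler_op)
  show "poly (pderiv f) (cis \<theta>2) \<noteq> 0" using double_pair(2)[of "cis \<theta>2" "cis \<theta>1"] ne contact by (auto simp: poly_euler_op)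
qed

text \<open>One \<open>e\<close> serves both applications. Each of them adds up three errors below
  1/4, within the slack 2 allowed by \<open>near_pi\<close>.\<close>

lemma dd_arg_limits:
  obtains e where "e > 0" "e < 1/4" "e < \<theta>2 - \<theta>1" "e < \<theta>1 + 2 * pi - \<theta>2"
    "0 < dd_arg (cis \<theta>1) (cis (\<theta>2 - e)) - dd_arg (cis \<theta>1) (cis (\<theta>2 + e)) - e \<and>
        dd_arg (cis \<theta>1) (cis (\<theta>2 - e)) - dd_arg (cis \<theta>1) (cis (\<theta>2 + e)) - e < pi"
    "0 < dd_arg (cis (\<theta>1 - e)) (cis \<theta>2) - dd_arg (cis \<theta>1) (cis (\<theta>2 + e)) - e \<and>
        dd_arg (cis (\<theta>1 - e)) (cis \<theta>2) - dd_arg (cis \<theta>1) (cis (\<theta>2 + e)) - e < pi"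
    "\<bar>dd_arg (cis \<theta>2) (cis (\<theta>2 - e)) - dd_arg (cis \<theta>2) (cis \<theta>2)\<bar> < 1/4"
    "\<bar>dd_arg (cis \<theta>2) (cis (\<theta>2 + e)) - dd_arg (cis \<theta>2) (cis \<theta>2)\<bar> < 1/4"
    "\<bar>dd_arg (cis \<theta>1) (cis (\<theta>1 - e)) - dd_arg (cis \<theta>1) (cis \<theta>1)\<bar> < 1/4"
proof -
  have \<theta>: "\<theta>1 < \<theta>2" "\<theta>2 < \<theta>1 + 2 * pi" using order by auto
  obtain \<epsilon> where \<epsilon>: "\<epsilon> > 0" "\<epsilon> < \<theta>2 - \<theta>1" "\<epsilon> < \<theta>1 + 2 * pi - \<theta>2"
    "\<And>e. 0 < e \<Longrightarrow> e < \<epsilon> \<Longrightarrow> 0 < dd_arg (cis \<theta>1) (cis (\<theta>2 - e)) - dd_arg (cis \<theta>1) (cis (\<theta>2 + e)) - e \<and>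
        dd_arg (cis \<theta>1) (cis (\<theta>2 - e)) - dd_arg (cis \<theta>1) (cis (\<theta>2 + e)) - e < pi"
    "\<And>e. 0 < e \<Longrightarrow> e < \<epsilon> \<Longrightarrow> 0 < dd_arg (cis (\<theta>1 - e)) (cis \<theta>2) - dd_arg (cis \<theta>1) (cis (\<theta>2 + e)) - e \<and>
        dd_arg (cis (\<theta>1 - e)) (cis \<theta>2) - dd_arg (cis \<theta>1) (cis (\<theta>2 + e)) - e < pi"
    by (rule contact_log_constant[OF \<theta> contact]) blast
  obtain \<delta>1 where \<delta>1: "\<delta>1 > 0" "\<And>z w. (z, w) \<in> dd_dom \<Longrightarrow> norm (z - cis \<theta>1) + norm (w - cis \<theta>1) < \<delta>1 \<Longrightarrow> \<bar>dd_arg z w - dd_arg (cis \<theta>1) (cis \<theta>1)\<bar> < 1/4"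
    by (rule dd_arg_continuous_diag[of "cis \<theta>1" "1/4"]) (use contact_regular in auto)
  obtain \<delta>2 where \<delta>2: "\<delta>2 > 0" "\<And>z w. (z, w) \<in> dd_dom \<Longrightarrow> norm (z - cis \<theta>2) + norm (w - cis \<theta>2) < \<delta>2 \<Longrightarrow> \<bar>dd_arg z w - dd_arg (cis \<theta>2) (cis \<theta>2)\<bar> < 1/4"
    by (rule dd_arg_continuous_diag[of "cis \<theta>2" "1/4"]) (use contact_regular in auto)
  define e where "e = Min {\<epsilon>, \<delta>1, \<delta>2, 1/4} / 2"
  have e: "e > 0" "e < \<epsilon>" "e < \<delta>1" "e < \<delta>2" "e < 1/4" using \<epsilon>(1) \<delta>1(1) \<delta>2(1) by (auto simp: e_def min_def)
  have ne: "cis s \<noteq> cis t" if "s \<noteq> t" "\<bar>s - t\<bar> < 2 * pi" for s t using cis_eq_imp_eq that by blast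
  have dom: "(cis \<theta>2, cis (\<theta>2 - e)) \<in> dd_dom" "(cis \<theta>2, cis (\<theta>2 + e)) \<in> dd_dom" "(cis \<theta>1, cis (\<theta>1 - e)) \<in> dd_dom"
  proof -
    show "(cis \<theta>2, cis (\<theta>2 - e)) \<in> dd_dom"
      by (rule contact_values_differ; rule ne; use e \<epsilon>(2,3) \<theta> in linarith)
    show "(cis \<theta>2, cis (\<theta>2 + e)) \<in> dd_dom"
      by (rule contact_values_differ; rule ne; use e \<epsilon>(2,3) \<theta> in linarith)
    show "(cis \<theta>1, cis (\<theta>1 - e)) \<in> dd_dom"
      by (rule contact_values_differ; rule ne; use e \<epsilon>(2,3) \<theta> in linarith)
  qed
  show ?thesis
  proof (rule that[of e])
    show "\<bar>dd_arg (cis \<theta>2) (cis (\<theta>2 - e)) - dd_arg (cis \<theta>2) (cis \<theta>2)\<bar> < 1/4"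
      using norm_cis_diff_le[of "\<theta>2 - e" \<theta>2] e by (intro \<delta>2 dom) auto
    show "\<bar>dd_arg (cis \<theta>2) (cis (\<theta>2 + e)) - dd_arg (cis \<theta>2) (cis \<theta>2)\<bar> < 1/4"
      using norm_cis_diff_le[of "\<theta>2 + e" \<theta>2] e by (intro \<delta>2 dom) auto
    show "\<bar>dd_arg (cis \<theta>1) (cis (\<theta>1 - e)) - dd_arg (cis \<theta>1) (cis \<theta>1)\<bar> < 1/4"
      using norm_cis_diff_le[of "\<theta>1 - e" \<theta>1] e by (intro \<delta>1 dom) auto
  qed (use e \<epsilon> in auto)
qed

text \<open>The neighbouring candidates -pi and 3 pi lie outside the interval because pi > 2. Crude
  bounds thus suffice to select the branch.\<close>

lemma near_pi:
  assumes "cis t = - 1" "- 2 < t" "t < pi + 2" shows "t = pi"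
proof -
  have "cis t = cis pi" using assms(1) by (simp add: complex_eq_iff)
  thus ?thesis using assms pi_gt3 by (intro cis_eq_imp_eq) auto
qed

text \<open>Crossing \<theta>2 from the outer to the inner arc, the argument based at \<theta>2 is
  continuous, since this point is regular, and the one based at \<theta>1 changes by an amount
  between 0 and pi up to small errors. The inscribed angle fixes the change as pi modulo 2 pi, hence
  as pi.\<close>

lemma dd_arg_inner:
  assumes "\<theta>1 < s" "s < \<theta>2"
  shows "dd_arg (cis \<theta>1) (cis s) - dd_arg (cis \<theta>2) (cis s) = (\<theta>2 - \<theta>1) / 2 + pi"
proof -
  define B where "B = (\<lambda>s. dd_arg (cis \<theta>1) (cis s) - dd_arg (cis \<theta>2) (cis s))"
  have sgn: "- 1 * (sin ((t - \<theta>2) / 2) * sin ((t - \<theta>1) / 2)) > 0" if "\<theta>1 < t" "t < \<theta>2" for t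
  proof -
    have "sin ((\<theta>2 - t) / 2) > 0" "sin ((t - \<theta>1) / 2) > 0" using order that by (auto intro!: sin_gt_zero)
    moreover have "sin ((t - \<theta>2) / 2) = - sin ((\<theta>2 - t) / 2)" by (metis minus_diff_eq minus_divide_left sin_minus)
    ultimately show ?thesis by simp
  qed
  have \<theta>: "\<theta>1 < \<theta>2" "\<theta>2 < \<theta>1 + 2 * pi" using order by auto
  obtain e where e: "e > 0" "e < 1/4" "e < \<theta>2 - \<theta>1" "e < \<theta>1 + 2 * pi - \<theta>2"
    "0 < dd_arg (cis \<theta>1) (cis (\<theta>2 - e)) - dd_arg (cis \<theta>1) (cis (\<theta>2 + e)) - e \<and>
        dd_arg (cis \<theta>1) (cis (\<theta>2 - e)) - dd_arg (cis \<theta>1) (cis (\<theta>2 + e)) - e < pi"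
    "\<bar>dd_arg (cis \<theta>2) (cis (\<theta>2 - e)) - dd_arg (cis \<theta>2) (cis \<theta>2)\<bar> < 1/4"
    "\<bar>dd_arg (cis \<theta>2) (cis (\<theta>2 + e)) - dd_arg (cis \<theta>2) (cis \<theta>2)\<bar> < 1/4"
    by (rule dd_arg_limits) blast
  have "B s = B (\<theta>2 - e)" unfolding B_def
    by (rule contact_branch(2)[OF \<theta> contact _ sgn]) (use assms e in auto)
  moreover have "B (\<theta>2 + e) = (\<theta>2 - \<theta>1) / 2" unfolding B_def by (rule dd_arg_outer) (use e in auto)
  ultimately have "- 2 < B s - (\<theta>2 - \<theta>1) / 2" "B s - (\<theta>2 - \<theta>1) / 2 < pi + 2"
    using e(1,2,6-7) conjunct1[OF e(5)] conjunct2[OF e(5)] unfolding B_def by linarith+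
  moreover have "cis (B s - (\<theta>2 - \<theta>1) / 2) = - 1"
  proof -
    have "cis (B s) = of_real (- 1) * cis ((\<theta>2 - \<theta>1) / 2)" unfolding B_def
      by (rule contact_branch(1)[OF \<theta> contact _ sgn]) (use assms in auto)
    thus ?thesis by (simp flip: cis_divide)
  qed
  ultimately have "B s - (\<theta>2 - \<theta>1) / 2 = pi" by (intro near_pi)
  thus ?thesis by (simp add: B_def)
qed

text \<open>The total turning of the tangent between the two preimages is computed twice: through
  the contact and the outer arc, which gives an exact value, and along the diagonal, where it counts
  the cusps passed.\<close>

lemma contact_cusp_count:
  "real (card (crit_angles \<inter> {\<theta>1<..<\<theta>2})) = real (d + 1) / (2 * pi) * (\<theta>2 - \<theta>1) + 1"
proof -
  obtain e where e: "e > 0" "e < 1/4" "e < \<theta>2 - \<theta>1" "e < \<theta>1 + 2 * pi - \<theta>2"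
    "0 < dd_arg (cis (\<theta>1 - e)) (cis \<theta>2) - dd_arg (cis \<theta>1) (cis (\<theta>2 + e)) - e \<and>
        dd_arg (cis (\<theta>1 - e)) (cis \<theta>2) - dd_arg (cis \<theta>1) (cis (\<theta>2 + e)) - e < pi"
    "\<bar>dd_arg (cis \<theta>2) (cis (\<theta>2 + e)) - dd_arg (cis \<theta>2) (cis \<theta>2)\<bar> < 1/4"
    "\<bar>dd_arg (cis \<theta>1) (cis (\<theta>1 - e)) - dd_arg (cis \<theta>1) (cis \<theta>1)\<bar> < 1/4"
    by (rule dd_arg_limits) blast
  have \<theta>: "\<theta>1 < \<theta>2" "\<theta>2 < \<theta>1 + 2 * pi" using order by auto
  have ne: "cis s \<noteq> cis t" if "s \<noteq> t" "\<bar>s - t\<bar> < 2 * pi" for s t using cis_eq_imp_eq that by blast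
  have ne12: "cis \<theta>1 \<noteq> cis \<theta>2" using ne[of \<theta>1 \<theta>2] \<theta> by auto
  define a1 a2 where "a1 = dd_arg (cis \<theta>1) (cis \<theta>1)" and "a2 = dd_arg (cis \<theta>2) (cis \<theta>2)"
  \<comment> \<open>This is the difference of the arguments of z f'(z) at the two preimages.
    Antiparallel tangents make it an odd multiple of pi.\<close>
  define \<tau> where "\<tau> = a1 - a2 - (\<theta>2 - \<theta>1)"
  have "dd_arg (cis (\<theta>1 - e)) (cis \<theta>2) = dd_arg (cis \<theta>2) (cis (\<theta>1 - e))"
    using e \<theta> by (intro dd_arg_commute[symmetric] contact_values_differ ne) auto
  moreover have "dd_arg (cis \<theta>1) (cis (\<theta>1 - e)) - dd_arg (cis \<theta>2) (cis (\<theta>1 - e)) = (\<theta>2 - \<theta>1) / 2"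
  proof -
    have "cis (\<theta>1 - e) = cis (\<theta>1 + 2 * pi - e)" by (subst cis_eq_iff) (auto intro!: exI[of _ "-1"])
    thus ?thesis using dd_arg_outer[of "\<theta>1 + 2 * pi - e"] e by simp
  qed
  moreover have "dd_arg (cis \<theta>1) (cis (\<theta>2 + e)) - dd_arg (cis \<theta>2) (cis (\<theta>2 + e)) = (\<theta>2 - \<theta>1) / 2"
    by (rule dd_arg_outer) (use e in auto)
  \<comment> \<open>Both passages through the outer arc contribute (\<theta>2 - \<theta>1)/2. The
    remaining arguments are taken near the diagonal, so they approximate \<open>a1\<close> and
    \<open>a2\<close>.\<close>
  ultimately have YX: "dd_arg (cis (\<theta>1 - e)) (cis \<theta>2) - dd_arg (cis \<theta>1) (cis (\<theta>2 + e)) =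
      dd_arg (cis \<theta>1) (cis (\<theta>1 - e)) - dd_arg (cis \<theta>2) (cis (\<theta>2 + e)) - (\<theta>2 - \<theta>1)" by (simp add: field_simps)
  have "- 2 < \<tau>" "\<tau> < pi + 2"
    using e(1,2,5-7) unfolding \<tau>_def a1_def a2_def YX abs_less_iff by auto
  moreover have "cis \<tau> = - 1"
  proof -
    define L1 L2 where "L1 = dd_log (cis \<theta>1, cis \<theta>1)" and "L2 = dd_log (cis \<theta>2, cis \<theta>2)"
    have L: "exp L1 = poly (pderiv f) (cis \<theta>1)" "exp L2 = poly (pderiv f) (cis \<theta>2)"
      using contact_regular by (simp_all add: L1_def L2_def dd_log dd_dom_diag divdiff_diag)
    obtain c where c: "c > 0" "poly (euler_op f) (cis \<theta>2) = - of_real c * poly (euler_op f) (cis \<theta>1)"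
      using double_pair(1)[of "cis \<theta>1" "cis \<theta>2"] ne12 contact by auto
    have E: "exp L2 * cis \<theta>2 = - of_real c * (exp L1 * cis \<theta>1)" using c(2) by (simp add: poly_euler_op L mult.commute)
    have P: "exp L1 = of_real (exp (Re L1)) * cis a1" "exp L2 = of_real (exp (Re L2)) * cis a2"
      by (simp_all add: exp_eq_polar L1_def L2_def a1_def a2_def dd_arg_def)
    have "of_real (exp (Re L2)) * cis (a2 + \<theta>2) = - of_real (c * exp (Re L1)) * cis (a1 + \<theta>1)"
      using E unfolding P by (simp add: cis_mult[symmetric] mult_ac)
    moreover from this have "exp (Re L2) = c * exp (Re L1)"
      using c(1) by (metis abs_of_pos exp_gt_zero mult_pos_pos norm_cis norm_minus_cancel norm_mult norm_of_real mult.right_neutral)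
    ultimately have "of_real (exp (Re L2)) * cis (a2 + \<theta>2) = of_real (exp (Re L2)) * (- cis (a1 + \<theta>1))" by simp
    hence "cis (a2 + \<theta>2) = - cis (a1 + \<theta>1)" by (metis mult_left_cancel of_real_eq_0_iff exp_not_eq_zero)
    moreover have "\<tau> = (a1 + \<theta>1) - (a2 + \<theta>2)" by (simp add: \<tau>_def)
    ultimately show ?thesis by (simp flip: cis_divide)
  qed
  ultimately have "\<tau> = pi" by (intro near_pi)
  moreover have "a2 - a1 = real (d - 1) * (\<theta>2 - \<theta>1) / 2 - pi * card (crit_angles \<inter> {\<theta>1<..<\<theta>2})"
    unfolding a1_def a2_def using order contact_regular by (intro dd_arg_diag) auto
  moreover have "real (d - 1) = real (d + 1) - 2" using d2 by simp
  ultimately have "pi * card (crit_angles \<inter> {\<theta>1<..<\<theta>2}) = pi + real (d + 1) * (\<theta>2 - \<theta>1) / 2"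
    unfolding \<tau>_def by (simp add: field_simps)
  hence "real (card (crit_angles \<inter> {\<theta>1<..<\<theta>2})) = (pi + real (d + 1) * (\<theta>2 - \<theta>1) / 2) / pi"
    by (simp add: field_simps)
  thus ?thesis by (simp add: field_simps)
qed

end

text \<open>For crossing pairs the mixed difference of \<open>dd_arg\<close> over the four endpoints equals \<open>\<pi>\<close> when read off
  one pair, and \<open>- \<pi>\<close> when read off the other.\<close>

lemma contacts_noncrossing:
  assumes "\<theta>0 < a" "a < a'" "a' < b" "b < b'" "b' < \<theta>0 + 2 * pi"
    and "poly f (cis a) = poly f (cis b)" "poly f (cis a') = poly f (cis b')"
  shows False
proof -
  have ne: "cis s \<noteq> cis t" if "s \<noteq> t" "\<bar>s - t\<bar> < 2 * pi" for s t using cis_eq_imp_eq that by blast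
  have o1: "dd_arg (cis a) (cis b') - dd_arg (cis b) (cis b') = (b - a) / 2"
    by (rule dd_arg_outer) (use assms in auto)
  have i1: "dd_arg (cis a) (cis a') - dd_arg (cis b) (cis a') = (b - a) / 2 + pi"
    by (rule dd_arg_inner) (use assms in auto)
  have o2: "dd_arg (cis a') (cis a) - dd_arg (cis b') (cis a) = (b' - a') / 2"
  proof -
    have "cis (a + 2 * pi) = cis a" by (subst cis_eq_iff) (auto intro!: exI[of _ 1])
    moreover have "dd_arg (cis a') (cis (a + 2 * pi)) - dd_arg (cis b') (cis (a + 2 * pi)) = (b' - a') / 2"
      by (rule dd_arg_outer) (use assms in auto)
    ultimately show ?thesis by simp
  qed
  have i2: "dd_arg (cis a') (cis b) - dd_arg (cis b') (cis b) = (b' - a') / 2 + pi"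
    by (rule dd_arg_inner) (use assms in auto)
  have dm: "(cis a, cis a') \<in> dd_dom" "(cis b, cis a') \<in> dd_dom" "(cis a, cis b') \<in> dd_dom" "(cis b, cis b') \<in> dd_dom"
    using contact_values_differ[of a b a'] contact_values_differ[of a b b'] ne[of a' a] ne[of a' b] ne[of b' a] ne[of b' b] assms
    by simp_all
  show False using dm[THEN dd_arg_commute]  o1 i1 o2 i2 pi_gt_zero by linarith
qed

text \<open>Each unordered pair appears once, cut open at the base angle; \<open>base_simple\<close>
  ensures that excluding \<theta>0 loses no pair.\<close>

definition contacts :: "(real \<times> real) set" where
  "contacts = {(a, b). \<theta>0 < a \<and> a < b \<and> b < \<theta>0 + 2 * pi \<and> poly f (cis a) = poly f (cis b)}"

lemma contact_third:
  assumes "\<theta>0 < a" "a < b" "b < \<theta>0 + 2 * pi" "poly f (cis a) = poly f (cis b)"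
    "\<theta>0 < t" "t < \<theta>0 + 2 * pi" "poly f (cis t) = poly f (cis a)"
  shows "t = a \<or> t = b"
proof -
  have ne: "cis s \<noteq> cis t" if "s \<noteq> t" "\<bar>s - t\<bar> < 2 * pi" for s t using cis_eq_imp_eq that by blast
  show ?thesis
  proof (rule ccontr)
    assume "\<not> ?thesis"
    hence "cis a \<noteq> cis b" "cis a \<noteq> cis t" "cis b \<noteq> cis t" using assms ne[of a b] ne[of a t] ne[of b t] by (simp_all add: abs_less_iff)
    thus False using no_triple[of "cis a" "cis b" "cis t"] assms(4,7) by simp
  qed
qed

lemma bij_contacts: "bij_betw (\<lambda>I. poly f (cis (fst I))) contacts (double_points f)"
proof (rule bij_betwI')
  fix I J assume I: "I \<in> contacts" and J: "J \<in> contacts"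
  show "poly f (cis (fst I)) = poly f (cis (fst J)) \<longleftrightarrow> I = J"
  proof
    assume eq: "poly f (cis (fst I)) = poly f (cis (fst J))"
    have "fst J = fst I \<or> fst J = snd I" "snd J = fst I \<or> snd J = snd I"
      using I J eq by (intro contact_third; auto simp: contacts_def)+
    moreover have "fst I < snd I" "fst J < snd J" using I J by (auto simp: contacts_def)
    ultimately show "I = J" by (auto simp: prod_eq_iff)
  qed simp
next
  fix I assume "I \<in> contacts"
  then obtain a b where I: "I = (a, b)" "\<theta>0 < a" "a < b" "b < \<theta>0 + 2 * pi" "poly f (cis a) = poly f (cis b)"
    by (auto simp: contacts_def)
  have "cis a \<noteq> cis b" using cis_eq_imp_eq[of a b] I by auto
  thus "poly f (cis (fst I)) \<in> double_points f"
    unfolding double_points_def I(1) fst_conv using I(5) norm_cis[of a] norm_cis[of b] by blast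
next
  fix w assume "w \<in> double_points f"
  then obtain \<zeta>1 \<zeta>2 where \<zeta>: "norm \<zeta>1 = 1" "norm \<zeta>2 = 1" "\<zeta>1 \<noteq> \<zeta>2" "poly f \<zeta>1 = poly f \<zeta>2" "w = poly f \<zeta>1"
    by (auto simp: double_points_def)
  obtain a where a: "\<theta>0 \<le> a" "a < \<theta>0 + 2 * pi" "cis a = \<zeta>1" using ex_angle[OF \<zeta>(1)] by blast
  obtain b where b: "\<theta>0 \<le> b" "b < \<theta>0 + 2 * pi" "cis b = \<zeta>2" using ex_angle[OF \<zeta>(2)] by blast
  have "a \<noteq> \<theta>0" "b \<noteq> \<theta>0" using base_simple[of \<zeta>2] base_simple[of \<zeta>1] \<zeta> a b by force+
  have "a \<noteq> b" using a b \<zeta> by auto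
  show "\<exists>I\<in>contacts. w = poly f (cis (fst I))"
  proof (cases "a < b")
    case True
    thus ?thesis using a b \<zeta> \<open>a \<noteq> \<theta>0\<close> by (intro bexI[of _ "(a, b)"]) (auto simp: contacts_def)
  next
    case False
    thus ?thesis using a b \<zeta> \<open>b \<noteq> \<theta>0\<close> \<open>a \<noteq> b\<close> by (intro bexI[of _ "(b, a)"]) (auto simp: contacts_def)
  qed
qed

text \<open>With \<open>R\<close> empty and L = (d+1)/(2 pi), the cusp count is the hypothesis of
  the interval count, whose conclusion bounds the number of pairs plus 1 by
  \<open>d - 1\<close>.\<close>

lemma card_double_points_le: "card (double_points f) \<le> d - 2"
proof (cases "contacts = {}")
  case True
  thus ?thesis using bij_betw_same_card[OF bij_contacts] by simp
next
  case False
  have fin: "finite contacts" using bij_contacts finite_double_points bij_betw_finite by blast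
  have mem: "\<theta>0 < fst I" "fst I < snd I" "snd I < \<theta>0 + 2 * pi" "poly f (cis (fst I)) = poly f (cis (snd I))"
    if "I \<in> contacts" for I using that by (auto simp: contacts_def)
  have "card contacts + 1 \<le> card crit_angles"
  proof (rule laminar_interval_count[where R = "{}" and L = "real (d + 1) / (2 * pi)"])
    fix I assume I: "I \<in> contacts"
    have "measure lborel ({fst I..snd I} - {}) = snd I - fst I" using mem(2)[OF I] by simp
    thus "real (card (crit_angles \<inter> {fst I<..<snd I})) = real (d + 1) / (2 * pi) * measure lborel ({fst I..snd I} - {}) + 1"
      using contact_cusp_count[OF mem[OF I]] by simp
  next
    fix I J assume I: "I \<in> contacts" and J: "J \<in> contacts" and IJ: "I \<noteq> J"
    have "poly f (cis (fst I)) \<noteq> poly f (cis (fst J))"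
      using IJ I J bij_betw_imp_inj_on[OF bij_contacts] by (auto simp: inj_on_def)
    hence ne: "fst I \<noteq> fst J" "fst I \<noteq> snd J" "snd I \<noteq> fst J" "snd I \<noteq> snd J"
      using mem(4)[OF I] mem(4)[OF J] by auto
    have "\<not> (fst I < fst J \<and> fst J < snd I \<and> snd I < snd J)" "\<not> (fst J < fst I \<and> fst I < snd J \<and> snd J < snd I)"
      using contacts_noncrossing[of "fst I" "fst J" "snd I" "snd J"] contacts_noncrossing[of "fst J" "fst I" "snd J" "snd I"]
        mem[OF I] mem[OF J] by blast+
    hence "snd I < fst J \<or> snd J < fst I \<or> (fst J < fst I \<and> snd I < snd J) \<or> (fst I < fst J \<and> snd J < snd I)"
      using ne mem(2)[OF I] mem(2)[OF J] by linarith
    thus "{fst I..snd I} \<inter> {fst J..snd J} = {} \<or> {fst I..snd I} \<subseteq> {fst J<..<snd J} \<or> {fst J..snd J} \<subseteq> {fst I<..<snd I}"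
      using mem(2)[OF I] mem(2)[OF J] by auto
  qed (use fin False finite_crit_angles mem in auto)
  thus ?thesis using bij_betw_same_card[OF bij_contacts] card_crit_angles by simp
qed

end

theorem theorem2p5:
  fixes d :: nat and f :: "complex poly"
  assumes "d \<ge> 2"
    and "extreme_point_poly (S_star_poly d) f"
  shows "suffridge d f"
proof -
  interpret star_class d f
    using assms by unfold_locales (auto simp: extreme_point_poly_def)
  obtain \<theta>0 where "\<forall>z. norm z \<le> 1 \<longrightarrow> norm (poly f z) \<le> norm (poly f (cis \<theta>0))"
    using exists_max_modulus_angle by blast
  then interpret star_class_max d f \<theta>0
    by unfold_locales auto
  have "card (double_points f) = d - 2"
    using card_double_points_le extreme_card_double_points[OF assms(2)] by (rule order_antisym)
  thus ?thesis
    using card_cusps finite_double_points f_star by (simp add: suffridge_def S_star_poly_def)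
qed

end
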